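(* Let $P$ be a polygonal domain in the plane with $n$ vertices, let $\phi$ be the smallest internal angle of $P$, let $0<\alpha\le\sin\tfrac{\phi}{2}$, and let $S$ be a set of $m$ points in $P$. Let $\mathrm{OPT}_\alpha^S$ be a minimum-cardinality set of points of $P$ that $\alpha$-robustly guards $S$. Then one can compute in $\mathrm{poly}(n,m)$ time a set of $O(\alpha^{-2})\,|\mathrm{OPT}_\alpha^S|$ points that $\tfrac{\alpha}{2}$-robustly guard $S$. (The constant hidden in $O(\cdot)$ is absolute.)
   Context: A polygonal domain $P$ is a (closed) polygon in the plane, possibly with holes; $n$ is its total number of vertices. Two points of $P$ see each other if the line segment between them is contained in $P$. $D(p,r)$ denotes the disk of radius $r$ centered at $p$. For $0<\alpha\le 1$, a point $g\in P$ $\alpha$-robustly guards a point $p\in P$ if $p$ sees every point of $D(g,\alpha\|p-g\|)$. A set $G\subseteq P$ $\alpha$-robustly guards a set $S\subseteq P$ if every point of $S$ is $\alpha$-robustly guarded by at least one point of $G$. *)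

theory Defs
  imports "HOL-Analysis.Analysis" "HOL-Library.More_List"
begin

text \<open>The Euclidean plane is the type \<^typ>\<open>complex\<close>.\<close>

subsection \<open>Polygonal domains\<close>

text \<open>A closed polygonal curve is the cyclic list of its vertices.\<close>

definition succ_vertex :: "complex list \<Rightarrow> nat \<Rightarrow> complex" where
  "succ_vertex vs i = vs ! (Suc i mod length vs)"

definition pred_vertex :: "complex list \<Rightarrow> nat \<Rightarrow> complex" where
  "pred_vertex vs i = vs ! ((i + length vs - 1) mod length vs)"

definition edge :: "complex list \<Rightarrow> nat \<Rightarrow> complex set" where
  "edge vs i = closed_segment (vs ! i) (succ_vertex vs i)"

definition curve :: "complex list \<Rightarrow> complex set" where
  "curve vs = (\<Union>i<length vs. edge vs i)"

definition simple_polygon :: "complex list \<Rightarrow> bool" where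
  "simple_polygon vs \<longleftrightarrow>
     3 \<le> length vs \<and> distinct vs \<and>
     (\<forall>i<length vs. \<forall>j<length vs. i \<noteq> j \<longrightarrow>
        edge vs i \<inter> edge vs j = {vs ! i, succ_vertex vs i} \<inter> {vs ! j, succ_vertex vs j})"

definition polygon_region :: "complex list \<Rightarrow> complex set" where
  "polygon_region vs = curve vs \<union> inside (curve vs)"

text \<open>
  A polygonal domain is given by its outer boundary and the list of the boundaries of its holes.
  The closed holes are pairwise disjoint and lie in the interior of the outer polygon; only their
  interiors are removed, so the domain is closed. Vertices with internal angle \<open>\<pi>\<close> are allowed,
  and no orientation of the boundary curves is prescribed.
\<close>

definition polygonal_domain :: "complex list \<Rightarrow> complex list list \<Rightarrow> bool" where
  "polygonal_domain outer holes \<longleftrightarrow>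
     simple_polygon outer \<and>
     (\<forall>h\<in>set holes. simple_polygon h \<and> polygon_region h \<subseteq> inside (curve outer)) \<and>
     (\<forall>i<length holes. \<forall>j<length holes. i \<noteq> j \<longrightarrow>
        polygon_region (holes ! i) \<inter> polygon_region (holes ! j) = {})"

definition domain_set :: "complex list \<Rightarrow> complex list list \<Rightarrow> complex set" where
  "domain_set outer holes = polygon_region outer - (\<Union>h\<in>set holes. inside (curve h))"

definition num_vertices :: "complex list \<Rightarrow> complex list list \<Rightarrow> nat" where
  "num_vertices outer holes = length (concat (outer # holes))"

text \<open>The angle, in \<open>[0, 2\<pi>)\<close>, by which the ray from \<open>v\<close> through \<open>a\<close> has to be turned
  counterclockwise to reach the ray from \<open>v\<close> through \<open>b\<close>.\<close>

definition ccw_angle :: "complex \<Rightarrow> complex \<Rightarrow> complex \<Rightarrow> real" where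
  "ccw_angle v a b = Arg2pi ((b - v) / (a - v))"

text \<open>The two edges at a vertex \<open>v\<close>, leading to \<open>a\<close> and \<open>b\<close>, split a small disk around \<open>v\<close> into
  two sectors, exactly one of which belongs to \<open>P\<close>. It is the one whose bisecting ray starts out
  inside \<open>P\<close>. This also covers the vertices of holes.\<close>

definition internal_angle :: "complex set \<Rightarrow> complex \<Rightarrow> complex \<Rightarrow> complex \<Rightarrow> real" where
  "internal_angle P v a b =
     (if \<forall>\<^sub>F t in at_right 0. v + of_real t * (sgn (a - v) * cis (ccw_angle v a b / 2)) \<in> P
      then ccw_angle v a b else ccw_angle v b a)"

definition min_internal_angle :: "complex list \<Rightarrow> complex list list \<Rightarrow> real" where
  "min_internal_angle outer holes =
     Min {internal_angle (domain_set outer holes) (vs ! i) (succ_vertex vs i) (pred_vertex vs i) |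
            vs i. vs \<in> set (outer # holes) \<and> i < length vs}"

subsection \<open>Robust guarding\<close>

definition sees :: "complex set \<Rightarrow> complex \<Rightarrow> complex \<Rightarrow> bool" where
  "sees P p q \<longleftrightarrow> closed_segment p q \<subseteq> P"

definition robustly_guards_point :: "complex set \<Rightarrow> real \<Rightarrow> complex \<Rightarrow> complex \<Rightarrow> bool" where
  "robustly_guards_point P \<alpha> g p \<longleftrightarrow>
     g \<in> P \<and> p \<in> P \<and> (\<forall>x \<in> cball g (\<alpha> * dist p g). sees P p x)"

definition robustly_guards :: "complex set \<Rightarrow> real \<Rightarrow> complex set \<Rightarrow> complex set \<Rightarrow> bool" where
  "robustly_guards P \<alpha> G S \<longleftrightarrow>
     G \<subseteq> P \<and> S \<subseteq> P \<and> (\<forall>p\<in>S. \<exists>g\<in>G. robustly_guards_point P \<alpha> g p)"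

definition min_guard_set :: "complex set \<Rightarrow> real \<Rightarrow> complex set \<Rightarrow> complex set \<Rightarrow> bool" where
  "min_guard_set P \<alpha> S G \<longleftrightarrow>
     finite G \<and> robustly_guards P \<alpha> G S \<and>
     (\<forall>G'. finite G' \<and> robustly_guards P \<alpha> G' S \<longrightarrow> card G \<le> card G')"

subsection \<open>Real RAM programs\<close>

text \<open>
  Algorithms are structured programs for a real RAM. Memory consists of arrays of natural numbers
  and arrays of real numbers, each array having a name; a scalar is an array used at index 0 only.
  Reals admit exact arithmetic, square roots and comparison, but no rounding and no conversion
  to natural numbers. Natural numbers, which serve as counters and as array indices, admit only
  addition, truncated subtraction and comparison, so that their values are at most
  exponential in the running time. There are no real constants other than the natural numbers.
\<close>

datatype nexp =
    NConst nat
  | NGet string nexp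
  | NAdd nexp nexp
  | NSub nexp nexp

datatype rexp =
    RNat nexp
  | RGet string nexp
  | RAdd rexp rexp
  | RSub rexp rexp
  | RMul rexp rexp
  | RDiv rexp rexp
  | RSqrt rexp

datatype bexp =
    NLess nexp nexp
  | RLess rexp rexp
  | BNot bexp
  | BAnd bexp bexp

datatype com =
    Skip
  | NSet string nexp nexp
  | RSet string nexp rexp
  | Seq com com
  | Cond bexp com com
  | While bexp com

record state =
  nmem :: "string \<Rightarrow> nat \<Rightarrow> nat"
  rmem :: "string \<Rightarrow> nat \<Rightarrow> real"

fun nval :: "nexp \<Rightarrow> state \<Rightarrow> nat" where
  "nval (NConst k) s = k"
| "nval (NGet x e) s = nmem s x (nval e s)"
| "nval (NAdd e1 e2) s = nval e1 s + nval e2 s"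
| "nval (NSub e1 e2) s = nval e1 s - nval e2 s"

fun rval :: "rexp \<Rightarrow> state \<Rightarrow> real" where
  "rval (RNat e) s = real (nval e s)"
| "rval (RGet x e) s = rmem s x (nval e s)"
| "rval (RAdd e1 e2) s = rval e1 s + rval e2 s"
| "rval (RSub e1 e2) s = rval e1 s - rval e2 s"
| "rval (RMul e1 e2) s = rval e1 s * rval e2 s"
| "rval (RDiv e1 e2) s = rval e1 s / rval e2 s"
| "rval (RSqrt e) s = sqrt (rval e s)"

fun bval :: "bexp \<Rightarrow> state \<Rightarrow> bool" where
  "bval (NLess e1 e2) s \<longleftrightarrow> nval e1 s < nval e2 s"
| "bval (RLess e1 e2) s \<longleftrightarrow> rval e1 s < rval e2 s"
| "bval (BNot b) s \<longleftrightarrow> \<not> bval b s"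
| "bval (BAnd b1 b2) s \<longleftrightarrow> bval b1 s \<and> bval b2 s"

definition nupd :: "string \<Rightarrow> nat \<Rightarrow> nat \<Rightarrow> state \<Rightarrow> state" where
  "nupd x i k s = s\<lparr>nmem := (nmem s)(x := (nmem s x)(i := k))\<rparr>"

definition rupd :: "string \<Rightarrow> nat \<Rightarrow> real \<Rightarrow> state \<Rightarrow> state" where
  "rupd x i r s = s\<lparr>rmem := (rmem s)(x := (rmem s x)(i := r))\<rparr>"

text \<open>\<open>exec c s t s'\<close>: started in \<open>s\<close>, the program \<open>c\<close> terminates in \<open>s'\<close> after \<open>t\<close> steps.
  Every assignment and every evaluation of a test counts as one step; since a program
  contains finitely many expressions, charging for each operation separately would change
  the running time by at most a constant factor depending on the program.\<close>

inductive exec :: "com \<Rightarrow> state \<Rightarrow> nat \<Rightarrow> state \<Rightarrow> bool" where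
  Skip: "exec Skip s 1 s"
| NSet: "exec (NSet x i e) s 1 (nupd x (nval i s) (nval e s) s)"
| RSet: "exec (RSet x i e) s 1 (rupd x (nval i s) (rval e s) s)"
| Seq: "exec c1 s t1 s1 \<Longrightarrow> exec c2 s1 t2 s2 \<Longrightarrow> exec (Seq c1 c2) s (t1 + t2) s2"
| CondTrue: "bval b s \<Longrightarrow> exec c1 s t s' \<Longrightarrow> exec (Cond b c1 c2) s (1 + t) s'"
| CondFalse: "\<not> bval b s \<Longrightarrow> exec c2 s t s' \<Longrightarrow> exec (Cond b c1 c2) s (1 + t) s'"
| WhileFalse: "\<not> bval b s \<Longrightarrow> exec (While b c) s 1 s"
| WhileTrue: "bval b s \<Longrightarrow> exec c s t1 s1 \<Longrightarrow> exec (While b c) s1 t2 s2 \<Longrightarrow>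
    exec (While b c) s (1 + t1 + t2) s2"

text \<open>
  Input: the vertices of all boundary curves are stored consecutively, outer boundary first, in
  \<open>px\<close> and \<open>py\<close>; \<open>len\<close> holds the number of vertices of each of the \<open>c\<close> curves, and \<open>n\<close> the total.
  The \<open>m\<close> points to be guarded are in \<open>sx\<close> and \<open>sy\<close>. All other memory cells are 0.
\<close>

definition input_state ::
  "complex list \<Rightarrow> complex list list \<Rightarrow> complex list \<Rightarrow> real \<Rightarrow> state" where
  "input_state outer holes ps \<alpha> =
    \<lparr>nmem = (\<lambda>_ _. 0)
       (''n'' := nth_default 0 [num_vertices outer holes],
        ''c'' := nth_default 0 [Suc (length holes)],
        ''len'' := nth_default 0 (map length (outer # holes)),
        ''m'' := nth_default 0 [length ps]),
     rmem = (\<lambda>_ _. 0)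
       (''alpha'' := nth_default 0 [\<alpha>],
        ''px'' := nth_default 0 (map Re (concat (outer # holes))),
        ''py'' := nth_default 0 (map Im (concat (outer # holes))),
        ''sx'' := nth_default 0 (map Re ps),
        ''sy'' := nth_default 0 (map Im ps))\<rparr>"

text \<open>Output: the first \<open>k\<close> entries of \<open>gx\<close> and \<open>gy\<close>.\<close>

definition output_points :: "state \<Rightarrow> complex set" where
  "output_points s = {Complex (rmem s ''gx'' i) (rmem s ''gy'' i) | i. i < nmem s ''k'' 0}"

end

theory Submission
  imports Defs
begin

text \<open>
  If \<open>g\<close> robustly guards \<open>p\<close>, so does every point between \<open>p\<close> and \<open>g\<close>. Let \<open>F p\<close> be, up to the
  robustness constant, the largest distance from \<open>p\<close> to a robust guard of \<open>p\<close>. The algorithm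
  repeatedly picks an unguarded point \<open>p\<close> of \<open>S\<close> with the smallest \<open>F p\<close>, lays a grid with
  \<open>O(\<alpha>\<^sup>-\<^sup>2)\<close> points of spacing about \<open>\<alpha> F p\<close> around \<open>p\<close>, and keeps those grid points that
  guard something new. Suppose \<open>g\<close> guards both \<open>p\<close> and another unguarded point \<open>q\<close>; then
  \<open>dist p g \<le> F p\<close>. If \<open>q\<close> is at distance at least \<open>F p\<close> from \<open>g\<close>, a grid point close to \<open>g\<close>
  guards \<open>q\<close> with the weaker constant. Otherwise \<open>q\<close> is close to \<open>p\<close>, and since \<open>F q \<ge> F p\<close>
  it has a guard at distance \<open>F p\<close>, which also lies in the range of the grid. So after the round
  for \<open>p\<close> no unguarded point shares a guard with \<open>p\<close>, and the number of rounds is at most the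
  optimum.

  To make everything computable, the cone from a point over the disk around its guard is replaced by
  a kite, a convex quadrilateral that sits between the cones for \<open>\<alpha>\<close> and \<open>\<alpha> / 2\<close>. The largest
  kite with given apex and axis that avoids all edges is found by clipping every edge against the
  kite; whether it lies in \<open>P\<close> is decided by counting the edges above a sample point. The resolution
  \<open>N \<approx> 100 / \<alpha>\<close> is cut off at \<open>100 m\<close> to keep the time polynomial: beyond this \<open>m \<le> \<alpha>\<^sup>-\<^sup>2\<close>,
  and at most \<open>m\<close> points are ever output.
\<close>

text \<open>Two kite widths absorb the discretization. Reaches are measured with
  \<open>9 / 10 * \<alpha>\<close>: this fits into the cone of an \<alpha>-robust guard even along a
  lattice direction that is off by \<open>3 / 100 * \<alpha>\<close>. Guards are tested with
  \<open>3 / 4 * \<alpha>\<close>: this contains the cone over the disk for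
  \<open>\<alpha> / 2\<close>, and when its tip moves by a fraction \<open>\<alpha> / 50\<close> of
  its length it still fits into the wider kite. The kites are open. They may touch the boundary, as
  lines of sight may, and the scales at which a kite avoids the edges form a closed half-line, so a
  largest scale exists and can be characterized by an equivalence. The machine shapes the rest.
  Without trigonometry, directions are normalized lattice vectors; without rounding, the resolution
  is found by counting; membership in the domain becomes the parity of a crossing count, which needs
  the Jordan curve theorem and care with vertices on the test ray. All loops have bounds known on
  entry, so running time is read off the syntax.\<close>

subsection \<open>Polygonal curves\<close>

text \<open>The path along the last k + 1 edges. It grows at its start and remains an arc as long as
  edge 0 is left out; that edge closes the loop in \<open>curve_simple_path\<close>.\<close>

primrec tail_path :: "complex list \<Rightarrow> nat \<Rightarrow> real \<Rightarrow> complex" where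
  "tail_path vs 0 = linepath (vs ! (length vs - 1)) (vs ! 0)"
| "tail_path vs (Suc k) =
     linepath (vs ! (length vs - 2 - k)) (vs ! (length vs - 1 - k)) +++ tail_path vs k"

lemma edge_inter:
  assumes "simple_polygon vs" "i < length vs" "j < length vs" "i \<noteq> j"
  shows "edge vs i \<inter> edge vs j = {vs ! i, succ_vertex vs i} \<inter> {vs ! j, succ_vertex vs j}"
  using assms by (auto simp: simple_polygon_def)

lemma nth_eq_iff_simple:
  assumes "simple_polygon vs" "i < length vs" "j < length vs"
  shows "vs ! i = vs ! j \<longleftrightarrow> i = j"
  using assms by (auto simp: simple_polygon_def nth_eq_iff_index_eq)

lemma succ_vertex_neq:
  assumes "simple_polygon vs" "i < length vs"
  shows "succ_vertex vs i \<noteq> vs ! i"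
proof -
  have "Suc i mod length vs \<noteq> i" "Suc i mod length vs < length vs"
    using assms by (auto simp: simple_polygon_def mod_Suc)
  then show ?thesis
    using nth_eq_iff_simple[OF assms(1) _ assms(2)] by (auto simp: succ_vertex_def)
qed

lemma tail_path_props:
  assumes "simple_polygon vs" "k + 2 \<le> length vs"
  shows "arc (tail_path vs k) \<and> pathstart (tail_path vs k) = vs ! (length vs - 1 - k) \<and>
     pathfinish (tail_path vs k) = vs ! 0 \<and>
     path_image (tail_path vs k) = (\<Union>i\<in>{length vs - 1 - k..<length vs}. edge vs i)"
  using assms(2)
proof (induction k)
  case 0
  have "{length vs - 1..<length vs} = {length vs - 1}" using 0 by auto
  moreover have "Suc (length vs - 1) = length vs" using 0 by simp
  then have "succ_vertex vs (length vs - 1) = vs ! 0" unfolding succ_vertex_def by simp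
  moreover have "vs ! (length vs - 1) \<noteq> vs ! 0"
    using nth_eq_iff_simple[OF assms(1), of "length vs - 1" 0] 0 by (cases vs) auto
  ultimately show ?case by (auto simp: edge_def arc_linepath)
next
  case (Suc k)
  let ?n = "length vs" let ?j = "?n - 2 - k"
  have j: "?n - 1 - k = Suc ?j" "?n - 1 - Suc k = ?j" "Suc ?j < ?n" "?j \<ge> 1 \<or> ?j = 0" using Suc.prems by auto
  have sv: "succ_vertex vs ?j = vs ! Suc ?j" using j(3) by (simp add: succ_vertex_def)
  have IH: "arc (tail_path vs k)" "pathstart (tail_path vs k) = vs ! Suc ?j"
    "pathfinish (tail_path vs k) = vs ! 0"
    "path_image (tail_path vs k) = (\<Union>i\<in>{Suc ?j..<?n}. edge vs i)"
    using Suc j by auto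
  have jpos: "?j \<ge> 1" using Suc.prems by auto
  have ne: "vs ! ?j \<noteq> vs ! Suc ?j" using nth_eq_iff_simple[OF assms(1)] j by auto
  have int: "edge vs ?j \<inter> edge vs i \<subseteq> {vs ! Suc ?j}" if "i \<in> {Suc ?j..<?n}" for i
  proof -
    have "edge vs ?j \<inter> edge vs i = {vs ! ?j, vs ! Suc ?j} \<inter> {vs ! i, succ_vertex vs i}"
      using edge_inter[OF assms(1), of ?j i] that j sv by auto
    moreover have "vs ! ?j \<noteq> vs ! i" using nth_eq_iff_simple[OF assms(1)] that j by auto
    moreover have "vs ! ?j \<noteq> succ_vertex vs i"
    proof -
      \<comment> \<open>Only the last edge wraps around. It ends at vertex 0, which differs from
        vertex \<open>?j\<close> by \<open>jpos\<close>.\<close>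
      have "Suc i mod ?n \<noteq> ?j" using that j jpos by (cases "Suc i = ?n") auto
      then show ?thesis unfolding succ_vertex_def
        using nth_eq_iff_simple[OF assms(1), of ?j "Suc i mod ?n"] j(3)
        mod_less_divisor[of ?n "Suc i"] by linarith
    qed
    ultimately show ?thesis by auto
  qed
  have "arc (linepath (vs ! ?j) (vs ! Suc ?j) +++ tail_path vs k)"
  proof (rule arc_join)
    show "path_image (linepath (vs ! ?j) (vs ! Suc ?j)) \<inter> path_image (tail_path vs k)
        \<subseteq> {pathstart (tail_path vs k)}"
    proof -
      have "path_image (linepath (vs ! ?j) (vs ! Suc ?j)) = edge vs ?j" using sv by (simp add: edge_def)
      then show ?thesis unfolding IH(2,4) using int by blast
    qed
  qed (use IH ne in \<open>auto simp: arc_linepath\<close>)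
  moreover have "path_image (linepath (vs ! ?j) (vs ! Suc ?j) +++ tail_path vs k)
      = edge vs ?j \<union> (\<Union>i\<in>{Suc ?j..<?n}. edge vs i)"
    using IH sv by (subst path_image_join) (auto simp: edge_def)
  moreover have "{?j..<?n} = insert ?j {Suc ?j..<?n}" using j by auto
  ultimately show ?case using IH j by auto
qed

lemma curve_simple_path:
  assumes "simple_polygon vs"
  obtains c where "simple_path c" "pathfinish c = pathstart c" "path_image c = curve vs"
proof -
  let ?n = "length vs" and ?g = "tail_path vs (length vs - 2)"
  have n: "3 \<le> ?n" using assms by (simp add: simple_polygon_def)
  have idx: "?n - 1 - (?n - 2) = 1" using n by simp
  have g: "arc ?g" "pathstart ?g = vs ! 1" "pathfinish ?g = vs ! 0"
    "path_image ?g = (\<Union>i\<in>{1..<?n}. edge vs i)"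
    using tail_path_props[OF assms, of "?n - 2"] n unfolding idx by auto
  have sv: "succ_vertex vs 0 = vs ! 1" using n by (simp add: succ_vertex_def)
  have ne: "vs ! 0 \<noteq> vs ! 1" using nth_eq_iff_simple[OF assms, of 0 1] n by linarith
  have "edge vs 0 \<inter> edge vs i \<subseteq> {vs ! 0, vs ! 1}" if "i \<in> {1..<?n}" for i
  proof -
    have "0 < ?n" using n by linarith
    from edge_inter[OF assms this, of i] show ?thesis using that sv by auto
  qed
  moreover have "path_image (linepath (vs ! 0) (vs ! 1)) = edge vs 0" using sv by (simp add: edge_def)
  ultimately have "path_image (linepath (vs ! 0) (vs ! 1)) \<inter> path_image ?g \<subseteq> {vs ! 0, vs ! 1}"
    unfolding g(4) by blast
  then have "simple_path (linepath (vs ! 0) (vs ! 1) +++ ?g)"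
    using g(1-3) ne by (intro simple_path_join_loop) (auto simp: arc_linepath)
  moreover have "path_image (linepath (vs ! 0) (vs ! 1) +++ ?g) = curve vs"
  proof -
    have "{..<?n} = insert 0 {1..<?n}" using n by auto
    moreover have "path_image (linepath (vs ! 0) (vs ! 1) +++ ?g) = edge vs 0 \<union> (\<Union>i\<in>{1..<?n}. edge vs i)"
      using g sv by (subst path_image_join) (auto simp: edge_def)
    ultimately show ?thesis by (simp add: curve_def)
  qed
  ultimately show ?thesis using that[of "linepath (vs ! 0) (vs ! 1) +++ ?g"] g by simp
qed

lemma simple_polygon_Jordan:
  assumes "simple_polygon vs"
  shows "open (inside (curve vs))" "connected (inside (curve vs))"
    "open (outside (curve vs))" "connected (outside (curve vs))"
    "inside (curve vs) \<inter> outside (curve vs) = {}"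
    "inside (curve vs) \<union> outside (curve vs) = - curve vs"
    "frontier (inside (curve vs)) = curve vs" "frontier (outside (curve vs)) = curve vs"
    "compact (curve vs)"
proof -
  obtain c where c: "simple_path c" "pathfinish c = pathstart c" "path_image c = curve vs"
    using curve_simple_path[OF assms] .
  note J = Jordan_inside_outside[OF c(1,2), unfolded c(3)]
  show "open (inside (curve vs))" "connected (inside (curve vs))"
    "open (outside (curve vs))" "connected (outside (curve vs))"
    "inside (curve vs) \<inter> outside (curve vs) = {}"
    "inside (curve vs) \<union> outside (curve vs) = - curve vs"
    "frontier (inside (curve vs)) = curve vs" "frontier (outside (curve vs)) = curve vs"
    using J by auto
  show "compact (curve vs)" using compact_simple_path_image[OF c(1)] c(3) by simp
qed

section \<open>Point location in a simple polygon by the parity of crossings\<close>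

subsection \<open>Counting crossings\<close>

text \<open>The cross product of \<open>b - a\<close> and \<open>z - a\<close>, positive to the left
  of the line. As an inner product with a normal vector it fits the library's facts on half-spaces
  and hyperplanes.\<close>

definition side :: "complex \<Rightarrow> complex \<Rightarrow> complex \<Rightarrow> real" where
  "side a b z = (\<i> * (b - a)) \<bullet> (z - a)"

lemma side_eq: "side a b z = Re (b - a) * Im (z - a) - Im (b - a) * Re (z - a)"
  by (simp add: side_def inner_complex_def algebra_simps)

lemma side_segment: "z \<in> closed_segment a b \<Longrightarrow> side a b z = 0"
proof -
  assume "z \<in> closed_segment a b"
  then obtain u where "z = (1 - u) *\<^sub>R a + u *\<^sub>R b" by (auto simp: closed_segment_def)
  then have e: "Re z = (1 - u) * Re a + u * Re b" "Im z = (1 - u) * Im a + u * Im b" by simp_all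
  show ?thesis unfolding side_eq minus_complex.sel e by (simp add: algebra_simps)
qed

lemma connected_disjoint_frontier:
  assumes "connected U" "U \<inter> frontier T = {}" "U \<inter> T \<noteq> {}"
  shows "U \<subseteq> T"
  using connected_Int_frontier[of U T] assms by auto

text \<open>Close to a point inside an edge the curve is just that edge, so each open half-disk lies
  entirely inside or entirely outside. Both regions have the whole curve as frontier and hence reach
  into the disk; being disjoint, they take one half-disk each.\<close>

lemma sides_of_edge:
  assumes sp: "simple_polygon vs" and i: "i < length vs" and c: "c \<in> edge vs i"
    and nv: "c \<noteq> vs ! i" "c \<noteq> succ_vertex vs i"
  obtains e where "e > 0"
    "\<And>z w. \<lbrakk>z \<in> ball c e; w \<in> ball c e;
        side (vs ! i) (succ_vertex vs i) z * side (vs ! i) (succ_vertex vs i) w < 0\<rbrakk>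
      \<Longrightarrow> z \<in> inside (curve vs) \<longleftrightarrow> w \<notin> inside (curve vs)"
proof -
  let ?s = "side (vs ! i) (succ_vertex vs i)"
  note J = simple_polygon_Jordan[OF sp]
  define K where "K = (\<Union>j\<in>{..<length vs} - {i}. edge vs j)"
  have "c \<notin> K"
  proof
    assume "c \<in> K"
    then obtain j where "j < length vs" "j \<noteq> i" "c \<in> edge vs j" by (auto simp: K_def)
    then have "c \<in> {vs ! i, succ_vertex vs i}" using edge_inter[OF sp i, of j] c by blast
    then show False using nv by auto
  qed
  moreover have "closed K" unfolding K_def edge_def by (intro closed_UN) auto
  ultimately have "\<exists>e>0. ball c e \<subseteq> - K"
    using open_contains_ball[of "- K"] by (simp add: open_Compl)
  then obtain e where e: "e > 0" "ball c e \<inter> K = {}" by blast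
  have cv: "curve vs = edge vs i \<union> K" using i by (auto simp: curve_def K_def)
  have "?s z = 0" if "z \<in> curve vs" "z \<in> ball c e" for z
    using that e cv side_segment by (auto simp: edge_def)
  note s0 = this
  let ?U = "\<lambda>\<sigma>. ball c e \<inter> {z. \<sigma> * ?s z > 0}"
  have conv: "convex (?U \<sigma>)" for \<sigma>
  proof -
    have "{z. \<sigma> * ?s z > 0} = {z. (\<sigma> *\<^sub>R (\<i> * (succ_vertex vs i - vs ! i))) \<bullet> z >
        (\<sigma> *\<^sub>R (\<i> * (succ_vertex vs i - vs ! i))) \<bullet> (vs ! i)}"
      by (auto simp: side_def inner_diff_right algebra_simps)
    then show ?thesis by (simp only:) (intro convex_Int convex_ball convex_halfspace_gt)
  qed
  have disj: "?U \<sigma> \<inter> curve vs = {}" for \<sigma> using s0 by force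
  have whole: "?U \<sigma> \<subseteq> T" if "?U \<sigma> \<inter> T \<noteq> {}" "frontier T = curve vs" for \<sigma> T
    using connected_disjoint_frontier[OF convex_connected[OF conv]] that disj by metis
  have meets: "?U 1 \<subseteq> T \<or> ?U (-1) \<subseteq> T" if T: "open T" "frontier T = curve vs" for T
  proof -
    have "c \<in> closure T" using c i T(2) cv by (auto simp: frontier_def)
    moreover have "c \<in> ball c e" using e(1) by simp
    ultimately have "ball c e \<inter> closure T \<noteq> {}" by blast
    then have "T \<inter> ball c e \<noteq> {}" using open_Int_closure_eq_empty[OF open_ball, of c e T] by (simp add: Int_commute)
    moreover have "open (T \<inter> ball c e)" using T by auto
    \<comment> \<open>An open set is not contained in a line. So \<open>T\<close> meets one of the
      half-disks and contains it by \<open>whole\<close>.\<close>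
    moreover have "interior {z. ?s z = 0} = {}"
    proof -
      have "{z. ?s z = 0} = {z. (\<i> * (succ_vertex vs i - vs ! i)) \<bullet> z = (\<i> * (succ_vertex vs i - vs ! i)) \<bullet> (vs ! i)}"
        by (auto simp: side_def inner_diff_right)
      then show ?thesis using interior_hyperplane[of "\<i> * (succ_vertex vs i - vs ! i)"] succ_vertex_neq[OF sp i] by simp
    qed
    ultimately have "\<not> (T \<inter> ball c e \<subseteq> {z. ?s z = 0})" by (metis interior_maximal subset_empty)
    then obtain z where "z \<in> T" "z \<in> ball c e" "?s z \<noteq> 0" unfolding subset_iff mem_Collect_eq by blast
    then have "?U 1 \<inter> T \<noteq> {} \<or> ?U (-1) \<inter> T \<noteq> {}" by (cases "?s z > 0") auto
    then show ?thesis using whole[OF _ T(2)] by metis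
  qed
  \<comment> \<open>The points \<open>z\<close> and \<open>w\<close> witness that neither half-disk
    is empty, so the disjoint sets \<open>T\<close> and \<open>V\<close> cannot contain the same
    one.\<close>
  have opp: "(A \<subseteq> T \<or> B \<subseteq> T) \<Longrightarrow> (A \<subseteq> V \<or> B \<subseteq> V) \<Longrightarrow> T \<inter> V = {} \<Longrightarrow>
      (z \<in> A \<and> w \<in> B) \<or> (z \<in> B \<and> w \<in> A) \<Longrightarrow> z \<in> T \<longleftrightarrow> w \<notin> T" for A B T V :: "complex set" and z w
    by blast
  have "z \<in> inside (curve vs) \<longleftrightarrow> w \<notin> inside (curve vs)"
    if zw: "z \<in> ball c e" "w \<in> ball c e" "?s z * ?s w < 0" for z w
  proof (rule opp[OF meets[OF J(1,7)] meets[OF J(3,8)] J(5)])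
    show "(z \<in> ?U 1 \<and> w \<in> ?U (-1)) \<or> (z \<in> ?U (-1) \<and> w \<in> ?U 1)"
      using zw by (auto simp: mult_less_0_iff)
  qed
  with e(1) show ?thesis using that by blast
qed

definition height :: "complex \<Rightarrow> complex \<Rightarrow> real \<Rightarrow> real" where
  "height a b x = Im a + (x - Re a) / (Re b - Re a) * (Im b - Im a)"

text \<open>The comparisons are half-open so that an edge count stays correct when the vertical ray runs
  through vertices: it equals the count for a ray slightly further to the right.\<close>

definition crosses :: "complex \<Rightarrow> complex \<Rightarrow> complex \<Rightarrow> bool" where
  "crosses z a b \<longleftrightarrow> (Re a \<le> Re z) \<noteq> (Re b \<le> Re z) \<and> Im z < height a b (Re z)"

lemma height_in_segment:
  assumes "(Re a \<le> x) \<noteq> (Re b \<le> x)"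
  shows "Complex x (height a b x) \<in> closed_segment a b"
proof -
  define u where "u = (x - Re a) / (Re b - Re a)"
  have "Re b \<noteq> Re a" using assms by auto
  then have "u * (Re b - Re a) = x - Re a" by (simp add: u_def)
  moreover have "0 \<le> u" "u \<le> 1" using assms by (auto simp: u_def divide_simps)
  ultimately show ?thesis unfolding in_segment
    by (intro exI[of _ u]) (auto simp: complex_eq_iff height_def u_def[symmetric] algebra_simps)
qed

lemma segment_height:
  assumes "Complex x y \<in> closed_segment a b" "Re a \<noteq> x" "Re b \<noteq> x"
  shows "(Re a \<le> x) \<noteq> (Re b \<le> x)" "y = height a b x"
proof -
  obtain u where u: "0 \<le> u" "u \<le> 1" "Complex x y = (1 - u) *\<^sub>R a + u *\<^sub>R b"
    using assms(1) by (auto simp: in_segment)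
  then have x: "x - Re a = u * (Re b - Re a)" and y: "y = Im a + u * (Im b - Im a)"
    by (auto simp: complex_eq_iff algebra_simps)
  have "u \<noteq> 0" "u \<noteq> 1" using x assms(2,3) by auto
  then have "0 < u" "u < 1" using u(1,2) by auto
  have ne: "Re b \<noteq> Re a" using x assms by auto
  then have "u = (x - Re a) / (Re b - Re a)" using x by simp
  then show "y = height a b x" by (simp add: y height_def)
  have q: "Re b - x = (1 - u) * (Re b - Re a)" using x by (simp add: algebra_simps)
  have "u * (Re b - Re a) > 0 \<and> (1 - u) * (Re b - Re a) > 0 \<or>
      u * (Re b - Re a) < 0 \<and> (1 - u) * (Re b - Re a) < 0"
    using ne \<open>0 < u\<close> \<open>u < 1\<close> by (auto simp: zero_less_mult_iff mult_less_0_iff)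
  then show "(Re a \<le> x) \<noteq> (Re b \<le> x)"
  proof (elim disjE conjE)
    assume "0 < u * (Re b - Re a)" "0 < (1 - u) * (Re b - Re a)"
    with q x have "Re a < x" "x < Re b" by linarith+
    then show ?thesis by simp
  next
    assume "u * (Re b - Re a) < 0" "(1 - u) * (Re b - Re a) < 0"
    with q x have "x < Re a" "Re b < x" by linarith+
    then show ?thesis by simp
  qed
qed

lemma vertical_convex: "convex {Complex x t | t. P t}" if "convex (Collect P)"
proof -
  have "{Complex x t | t. P t} = (\<lambda>t. Complex x 0 + t *\<^sub>R \<i>) ` Collect P"
    by (auto simp: image_iff complex_eq_iff)
  moreover have "convex ((+) (Complex x 0) ` ((\<lambda>t. t *\<^sub>R \<i>) ` Collect P))"
    using that by (intro convex_translation convex_scaled)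
  ultimately show ?thesis by (simp add: image_image)
qed

text \<open>Induction on the number of edges above the point. If there are none, the upward ray
  misses the curve and is unbounded, so the point is outside. Otherwise the point is moved up just
  past the lowest of these edges: membership flips and the count drops by one.\<close>

lemma generic_parity:
  assumes sp: "simple_polygon vs" and gen: "\<And>i. i < length vs \<Longrightarrow> Re (vs ! i) \<noteq> x"
    and z: "Complex x y \<notin> curve vs"
  shows "Complex x y \<in> inside (curve vs) \<longleftrightarrow>
    odd (card {i. i < length vs \<and> crosses (Complex x y) (vs ! i) (succ_vertex vs i)})"
  using z
proof (induction "card {i. i < length vs \<and> crosses (Complex x y) (vs ! i) (succ_vertex vs i)}"
    arbitrary: y rule: less_induct)
  case less
  note J = simple_polygon_Jordan[OF sp]
  let ?a = "\<lambda>i. vs ! i" and ?b = "succ_vertex vs"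
  let ?h = "\<lambda>i. height (?a i) (?b i) x"
  have genb: "Re (?b i) \<noteq> x" if "i < length vs" for i
    unfolding succ_vertex_def using that by (intro gen) (metis mod_less_divisor gr_zeroI not_less_zero)
  define I where "I = {i. i < length vs \<and> (Re (?a i) \<le> x) \<noteq> (Re (?b i) \<le> x)}"
  have edge: "Complex x t \<in> curve vs \<longleftrightarrow> (\<exists>i\<in>I. t = ?h i)" for t
  proof
    assume "Complex x t \<in> curve vs"
    then obtain i where i: "i < length vs" "Complex x t \<in> closed_segment (?a i) (?b i)"
      by (auto simp: curve_def edge_def)
    from segment_height[OF i(2) gen[OF i(1)] genb[OF i(1)]] i(1)
    show "\<exists>i\<in>I. t = ?h i" unfolding I_def by blast
  next
    assume "\<exists>i\<in>I. t = ?h i"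
    then obtain i where "i < length vs" "(Re (?a i) \<le> x) \<noteq> (Re (?b i) \<le> x)" "t = ?h i"
      unfolding I_def by blast
    then show "Complex x t \<in> curve vs"
      using height_in_segment[of "?a i" x "?b i"] by (auto simp: curve_def edge_def)
  qed
  have cs: "{i. i < length vs \<and> crosses (Complex x t) (?a i) (?b i)} = {i\<in>I. t < ?h i}" for t
    by (auto simp: I_def crosses_def)
  have fin: "finite I" by (auto simp: I_def)
  define A where "A = {i\<in>I. y < ?h i}"
  have same: "Complex x t1 \<in> T \<longleftrightarrow> Complex x t2 \<in> T"
    if "t1 \<le> t2" "\<And>t. t1 \<le> t \<Longrightarrow> t \<le> t2 \<Longrightarrow> Complex x t \<notin> curve vs" "frontier T = curve vs" for t1 t2 T
  proof -
    let ?U = "{Complex x t | t. t1 \<le> t \<and> t \<le> t2}"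
    have "convex {t. t1 \<le> t \<and> t \<le> t2}" using convex_real_interval(5)[of t1 t2] by (simp add: atLeastAtMost_def atLeast_def atMost_def Int_def)
    then have "connected ?U" by (intro convex_connected vertical_convex)
    moreover have "?U \<inter> frontier T = {}" using that by auto
    ultimately have "?U \<inter> T \<noteq> {} \<Longrightarrow> ?U \<subseteq> T" by (rule connected_disjoint_frontier)
    then show ?thesis using that(1) by blast
  qed
  show ?case
  proof (cases "A = {}")
    case True
    let ?U = "{Complex x t | t. y \<le> t}"
    have "Complex x t \<notin> curve vs" if "t \<ge> y" for t
      using less.prems True that unfolding edge A_def by force
    then have U1: "?U \<inter> frontier (inside (curve vs)) = {}" using J(7) by auto
    have U2: "connected ?U"
      using convex_real_interval(1)[of y] by (intro convex_connected vertical_convex) (simp add: atLeast_def)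
    have U3:  "\<not> ?U \<subseteq> inside (curve vs)"
    proof
      assume "?U \<subseteq> inside (curve vs)"
      then have "bounded ?U" using bounded_inside[OF compact_imp_bounded[OF J(9)]] bounded_subset by blast
      then obtain B where B: "\<And>t. t \<ge> y \<Longrightarrow> norm (Complex x t) \<le> B" by (auto simp: bounded_iff)
      have "norm (Complex x (max y (B + 1))) \<le> B" by (rule B) auto
      moreover have "\<bar>max y (B + 1)\<bar> \<le> norm (Complex x (max y (B + 1)))"
        using abs_Im_le_cmod[of "Complex x (max y (B + 1))"] by simp
      ultimately show False by linarith
    qed
    have "?U \<inter> inside (curve vs) = {}" using connected_disjoint_frontier[OF U2 U1] U3 by argo
    moreover have "Complex x y \<in> ?U" by auto
    ultimately have "Complex x y \<notin> inside (curve vs)" by blast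
    then show ?thesis using True unfolding cs A_def[symmetric] by simp
  next
    case False
    have finA: "finite A" using fin by (auto simp: A_def)
    obtain i where i: "i \<in> A" "\<And>j. j \<in> A \<Longrightarrow> ?h i \<le> ?h j"
      using ex_is_arg_min_if_finite[OF finA False, of ?h] by (force simp: is_arg_min_linorder)
    have il: "i < length vs" "i \<in> I" "y < ?h i" using i by (auto simp: A_def I_def)
    \<comment> \<open>Equal heights would give a point on two edges, which is a vertex on the
      vertical line.\<close>
    have inj: "?h i \<noteq> ?h j" if "j \<in> I" "j \<noteq> i" for j
    proof
      assume eq: "?h i = ?h j"
      have "Complex x (?h i) \<in> edge vs i" "Complex x (?h i) \<in> edge vs j"
        using height_in_segment[of "?a i" x "?b i"] height_in_segment[of "?a j" x "?b j"] il that eq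
        by (auto simp: edge_def I_def)
      then have "Complex x (?h i) \<in> {?a i, ?b i}"
        using edge_inter[OF sp il(1), of j] that by (auto simp: I_def)
      then show False using gen[OF il(1)] genb[OF il(1)] complex.sel(1)[of x "?h i"] by (metis empty_iff insert_iff)
    qed
    let ?c = "Complex x (?h i)"
    have "?c \<in> edge vs i" using height_in_segment il by (auto simp: edge_def I_def)
    moreover have "?c \<noteq> ?a i" "?c \<noteq> ?b i" using gen[OF il(1)] genb[OF il(1)] complex.sel(1)[of x "?h i"] by metis+
    ultimately obtain e where e: "e > 0" "\<And>z w. \<lbrakk>z \<in> ball ?c e; w \<in> ball ?c e;
        side (?a i) (?b i) z * side (?a i) (?b i) w < 0\<rbrakk>
      \<Longrightarrow> z \<in> inside (curve vs) \<longleftrightarrow> w \<notin> inside (curve vs)"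
      using sides_of_edge[OF sp il(1)] by metis
    have dist: "Complex x t \<in> ball ?c e \<longleftrightarrow> \<bar>?h i - t\<bar> < e" for t
      by (simp add: dist_norm complex_norm cmod_def)
    define y1 where "y1 = max ((y + ?h i) / 2) (?h i - e / 2)"
    have y1: "y < y1" "y1 < ?h i" "Complex x y1 \<in> ball ?c e"
    proof -
      show "y < y1" "y1 < ?h i" using il(3) e(1) by (auto simp: y1_def less_max_iff_disj)
      moreover have "?h i - e / 2 \<le> y1" by (simp add: y1_def)
      ultimately show "Complex x y1 \<in> ball ?c e" unfolding dist using e(1) by linarith
    qed
    \<comment> \<open>The height of the next edge, cut off at the radius \<open>e\<close>. Halfway
      up to it, only edge \<open>i\<close> has been passed.\<close>
    define M where "M = Min (insert (?h i + e) (?h ` (A - {i})))"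
    have Mi: "?h i < M" unfolding M_def using finA e inj i
      by (subst Min_gr_iff) (auto simp: A_def order_less_le)
    define y2 where "y2 = (?h i + M) / 2"
    have "M \<le> ?h i + e" and Mj: "\<And>j. j \<in> A \<Longrightarrow> j \<noteq> i \<Longrightarrow> M \<le> ?h j" unfolding M_def using finA by auto
    then have y2: "?h i < y2" "y2 < M" "Complex x y2 \<in> ball ?c e" using Mi by (auto simp: y2_def dist simp del: mem_ball)
    have A2: "{j\<in>I. y2 < ?h j} = A - {i}"
      using Mj y2 il by (fastforce simp: A_def)
    have "Complex x y2 \<notin> curve vs"
    proof
      assume "Complex x y2 \<in> curve vs"
      then obtain j where "j \<in> I" "y2 = ?h j" using edge by auto
      then show False using Mj[of j] y2 il by (auto simp: A_def)
    qed
    then have IH: "Complex x y2 \<in> inside (curve vs) \<longleftrightarrow> odd (card (A - {i}))"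
      using less.hyps[of y2] card_Diff1_less[OF finA i(1)] unfolding cs A2 A_def[symmetric] by blast
    \<comment> \<open>On the vertical line \<open>side\<close> is a non-zero multiple of the signed
      distance to edge \<open>i\<close>, so \<open>y1\<close> and \<open>y2\<close> have opposite
      sides.\<close>
    have "side (?a i) (?b i) (Complex x t) = (Re (?b i) - Re (?a i)) * (t - ?h i)" for t
      using il(2) by (auto simp: side_eq height_def I_def algebra_simps divide_simps)
    then have "side (?a i) (?b i) (Complex x y1) * side (?a i) (?b i) (Complex x y2)
        = (Re (?b i) - Re (?a i))\<^sup>2 * ((y1 - ?h i) * (y2 - ?h i))" by (simp add: power2_eq_square)
    moreover have "(Re (?b i) - Re (?a i))\<^sup>2 > 0" using il(2) by (auto simp: I_def)
    moreover have "(y1 - ?h i) * (y2 - ?h i) < 0" using y1 y2 by (simp add: mult_neg_pos)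
    ultimately have "Complex x y1 \<in> inside (curve vs) \<longleftrightarrow> Complex x y2 \<notin> inside (curve vs)"
      using e(2)[OF y1(3) y2(3)] by (simp add: mult_pos_neg)
    moreover have "Complex x y \<in> inside (curve vs) \<longleftrightarrow> Complex x y1 \<in> inside (curve vs)"
    proof (rule same[OF _ _ J(7)])
      show "y \<le> y1" using y1 by simp
      fix t assume t: "y \<le> t" "t \<le> y1"
      show "Complex x t \<notin> curve vs"
      proof
        assume "Complex x t \<in> curve vs"
        then obtain j where j: "j \<in> I" "t = ?h j" using edge by auto
        then have "j \<in> A" using t less.prems edge by (fastforce simp: A_def)
        then show False using i(2)[of j] j t y1 by auto
      qed
    qed
    moreover have "card A = Suc (card (A - {i}))" using finA i by (metis card.remove)
    ultimately show ?thesis using IH unfolding cs A_def[symmetric] by simp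
  qed
qed

text \<open>Comparisons of the form \<open>t \<le> x\<close> do not change under a small shift to
  the right. Neither does the comparison with \<open>height\<close>, which is continuous there and
  differs from \<open>Im z\<close> because \<open>z\<close> is off the segment.\<close>

lemma eventually_crosses:
  assumes "z \<notin> closed_segment a b"
  shows "\<forall>\<^sub>F x in at_right (Re z). Re a \<noteq> x \<and> (crosses (Complex x (Im z)) a b \<longleftrightarrow> crosses z a b)"
proof -
  have small: "\<forall>\<^sub>F x in at_right (Re z). (t \<le> x \<longleftrightarrow> t \<le> Re z) \<and> t \<noteq> x" for t
  proof (cases "t \<le> Re z")
    case True
    then show ?thesis by (auto simp: eventually_at_filter)
  next
    case False
    then have "\<forall>\<^sub>F x in at_right (Re z). x < t"
      by (auto intro: eventually_at_rightI[of _ t])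
    then show ?thesis using False by (auto elim: eventually_mono)
  qed
  have "\<forall>\<^sub>F x in at_right (Re z). ((Re a \<le> x) \<noteq> (Re b \<le> x) \<longrightarrow>
      (Im z < height a b x \<longleftrightarrow> Im z < height a b (Re z)))" if c: "(Re a \<le> Re z) \<noteq> (Re b \<le> Re z)"
  proof -
    have "height a b (Re z) \<noteq> Im z"
      using height_in_segment[OF c] assms by (metis complex_surj)
    moreover have "(height a b \<longlongrightarrow> height a b (Re z)) (at_right (Re z))"
      unfolding height_def using c by (intro tendsto_intros) auto
    ultimately have "\<forall>\<^sub>F x in at_right (Re z). Im z < height a b x \<longleftrightarrow> Im z < height a b (Re z)"
    proof (cases "Im z < height a b (Re z)")
      case True
      then show ?thesis using order_tendstoD(1)[OF \<open>(height a b \<longlongrightarrow> _) _\<close> True] by (auto elim: eventually_mono)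
    next
      case False
      then have "height a b (Re z) < Im z" using \<open>height a b (Re z) \<noteq> Im z\<close> by simp
      then have "\<forall>\<^sub>F x in at_right (Re z). height a b x < Im z"
        using order_tendstoD(2)[OF \<open>(height a b \<longlongrightarrow> _) _\<close>] by blast
      then show ?thesis using False by (auto elim: eventually_mono)
    qed
    then show ?thesis by eventually_elim simp
  qed
  then have "\<forall>\<^sub>F x in at_right (Re z). (Re a \<le> Re z) \<noteq> (Re b \<le> Re z) \<longrightarrow> (Re a \<le> x) \<noteq> (Re b \<le> x) \<longrightarrow>
      (Im z < height a b x \<longleftrightarrow> Im z < height a b (Re z))"
    by (cases "(Re a \<le> Re z) \<noteq> (Re b \<le> Re z)") auto
  with small[of "Re a"] small[of "Re b"] show ?thesis
    by eventually_elim (auto simp: crosses_def)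
qed

text \<open>A small shift to the right makes the position generic. It alters neither the crossings
  nor, within a disk that avoids the curve, the membership.\<close>

lemma polygon_parity:
  assumes sp: "simple_polygon vs" and z: "z \<notin> curve vs"
  shows "z \<in> inside (curve vs) \<longleftrightarrow>
    odd (card {i. i < length vs \<and> crosses z (vs ! i) (succ_vertex vs i)})"
proof -
  note J = simple_polygon_Jordan[OF sp]
  have "open (- curve vs)" using compact_imp_closed[OF J(9)] by (simp add: open_Compl)
  then obtain e where e: "e > 0" "ball z e \<subseteq> - curve vs" using z open_contains_ball[of "- curve vs"] by auto
  have near: "\<forall>\<^sub>F x in at_right (Re z). x < Re z + e \<and> Re z < x"
    by (rule eventually_at_rightI[of _ "Re z + e"]) (use e in auto)
  have "\<forall>\<^sub>F x in at_right (Re z). \<forall>i\<in>{..<length vs}. Re (vs ! i) \<noteq> x \<and>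
      (crosses (Complex x (Im z)) (vs ! i) (succ_vertex vs i) \<longleftrightarrow> crosses z (vs ! i) (succ_vertex vs i))"
    using z by (intro eventually_ball_finite ballI eventually_crosses) (auto simp: curve_def edge_def)
  from eventually_happens[OF eventually_conj[OF near this]]
  obtain x where x: "Re z < x" "x < Re z + e" "\<And>i. i < length vs \<Longrightarrow> Re (vs ! i) \<noteq> x"
    "\<And>i. i < length vs \<Longrightarrow> crosses (Complex x (Im z)) (vs ! i) (succ_vertex vs i) \<longleftrightarrow> crosses z (vs ! i) (succ_vertex vs i)"
    by auto
  let ?z = "Complex x (Im z)"
  have "dist z ?z = \<bar>x - Re z\<bar>" by (simp add: dist_norm cmod_def)
  then have "?z \<in> ball z e" "z \<in> ball z e" using x e by auto
  then have in_iff: "z \<in> inside (curve vs) \<longleftrightarrow> ?z \<in> inside (curve vs)" and "?z \<notin> curve vs"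
    using connected_disjoint_frontier[OF connected_ball, of z e "inside (curve vs)"] e(2) J(7) by blast+
  have "{i. i < length vs \<and> crosses ?z (vs ! i) (succ_vertex vs i)} = {i. i < length vs \<and> crosses z (vs ! i) (succ_vertex vs i)}"
    using x(4) by auto
  then show ?thesis using generic_parity[OF sp x(3) \<open>?z \<notin> curve vs\<close>] in_iff by simp
qed

section \<open>Boundary, parity and convex hull for domains with holes\<close>

subsection \<open>Domains with holes\<close>

definition domain_curves :: "complex list \<Rightarrow> complex list list \<Rightarrow> complex set" where
  "domain_curves outer holes = (\<Union>vs\<in>set (outer # holes). curve vs)"

lemma polygonal_domain_simple:
  "polygonal_domain outer holes \<Longrightarrow> vs \<in> set (outer # holes) \<Longrightarrow> simple_polygon vs"
  by (auto simp: polygonal_domain_def)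

text \<open>Each boundary curve is the frontier of a region that the domain omits: the inside of a
  hole, or the outside of the outer polygon.\<close>

lemma domain_closure_complement:
  assumes "polygonal_domain outer holes" "z \<in> domain_curves outer holes"
  shows "z \<notin> interior (domain_set outer holes)"
proof -
  obtain vs where vs: "vs \<in> set (outer # holes)" "z \<in> curve vs" using assms(2) by (auto simp: domain_curves_def)
  note J = simple_polygon_Jordan[OF polygonal_domain_simple[OF assms(1) vs(1)]]
  define T where "T = (if vs \<in> set holes then inside (curve vs) else outside (curve vs))"
  have "T \<inter> domain_set outer holes = {}"
    using vs(1) by (auto simp: T_def domain_set_def polygon_region_def outside_inside)
  moreover have "z \<in> closure T"
    using vs(2) J(7,8) unfolding T_def by (auto simp: frontier_def)
  ultimately show ?thesis
    using open_Int_closure_eq_empty[OF open_interior, of "domain_set outer holes" T]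
      interior_subset[of "domain_set outer holes"] by blast
qed

lemma frontier_domain_set:
  assumes "polygonal_domain outer holes"
  shows "frontier (domain_set outer holes) \<subseteq> domain_curves outer holes"
proof
  fix z assume z: "z \<in> frontier (domain_set outer holes)"
  let ?P = "domain_set outer holes"
  note Js = simple_polygon_Jordan[OF polygonal_domain_simple[OF assms]]
  show "z \<in> domain_curves outer holes"
  proof (rule ccontr)
    assume nz: "z \<notin> domain_curves outer holes"
    have out: "outer \<in> set (outer # holes)" by simp
    \<comment> \<open>Off the curves the plane is the union of two open sets, \<open>I\<close>
      within the domain and \<open>E\<close> disjoint from it, so no frontier point is left.\<close>
    define I where "I = inside (curve outer) \<inter> (\<Inter>h\<in>set holes. outside (curve h))"
    define E where "E = outside (curve outer) \<union> (\<Union>h\<in>set holes. inside (curve h))"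
    have "open I" unfolding I_def using Js(1,3) by (intro open_Int open_INT) auto
    moreover have "open E" unfolding E_def using Js(1,3) by (intro open_Un open_UN) auto
    moreover have "I \<subseteq> ?P"
      by (auto simp: I_def domain_set_def polygon_region_def outside_inside)
    moreover have "E \<inter> ?P = {}"
      by (auto simp: E_def domain_set_def polygon_region_def outside_inside)
    moreover have "z \<in> I \<union> E"
    proof (cases "z \<in> E")
      case False
      then show ?thesis using nz by (auto simp: I_def E_def domain_curves_def outside_inside)
    qed simp
    ultimately have "z \<in> interior ?P \<or> z \<in> interior (- ?P)"
      by (metis Un_iff disjoint_eq_subset_Compl interior_maximal subsetD)
    then show False using z by (auto simp: frontier_def interior_complement)
  qed
qed

definition crossing_number :: "complex list \<Rightarrow> complex \<Rightarrow> nat" where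
  "crossing_number vs z = card {i. i < length vs \<and> crosses z (vs ! i) (succ_vertex vs i)}"

text \<open>The outer polygon contributes an odd number exactly for points inside it. At most one of
  the disjoint holes contributes an odd number, and then the outer one does too. So the sum is odd
  exactly when only the outer summand is.\<close>

lemma domain_parity:
  assumes pd: "polygonal_domain outer holes" and z: "z \<notin> domain_curves outer holes"
  shows "z \<in> domain_set outer holes \<longleftrightarrow> odd (\<Sum>vs\<leftarrow>outer # holes. crossing_number vs z)"
proof -
  have par: "odd (crossing_number vs z) \<longleftrightarrow> z \<in> inside (curve vs)" if "vs \<in> set (outer # holes)" for vs
    using polygon_parity[OF polygonal_domain_simple[OF pd that], of z] z that
    by (auto simp: crossing_number_def domain_curves_def)
  have reg: "z \<in> polygon_region vs \<longleftrightarrow> z \<in> inside (curve vs)" if "vs \<in> set (outer # holes)" for vs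
    using z that by (auto simp: domain_curves_def polygon_region_def)
  \<comment> \<open>A separate name lets the induction shorten the list while \<open>holes\<close>
    stays fixed.\<close>
  define hs where "hs = holes"
  have sub: "\<And>i j. i < length hs \<Longrightarrow> j < length hs \<Longrightarrow> i \<noteq> j \<Longrightarrow>
      polygon_region (hs ! i) \<inter> polygon_region (hs ! j) = {}" "set hs \<subseteq> set holes"
    using pd by (auto simp: hs_def polygonal_domain_def)
  have "odd (\<Sum>vs\<leftarrow>hs. crossing_number vs z) \<longleftrightarrow> (\<exists>h\<in>set hs. z \<in> inside (curve h))"
    using sub
  proof (induction hs)
    case (Cons h hs)
    have IH: "odd (\<Sum>vs\<leftarrow>hs. crossing_number vs z) \<longleftrightarrow> (\<exists>h\<in>set hs. z \<in> inside (curve h))"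
    proof (rule Cons.IH)
      show "polygon_region (hs ! i) \<inter> polygon_region (hs ! j) = {}"
        if "i < length hs" "j < length hs" "i \<noteq> j" for i j
        using Cons.prems(1)[of "Suc i" "Suc j"] that by simp
    qed (use Cons.prems in auto)
    have "z \<notin> inside (curve h')" if "z \<in> inside (curve h)" and h': "h' \<in> set hs" for h'
    proof -
      obtain j where "j < length hs" "h' = hs ! j" using h' by (auto simp: in_set_conv_nth)
      then have "polygon_region h \<inter> polygon_region h' = {}" using Cons.prems(1)[of 0 "Suc j"] by simp
      then show ?thesis using that by (auto simp: polygon_region_def)
    qed
    then show ?case using IH par[of h] Cons.prems(2) by auto
  qed simp
  moreover have "z \<in> inside (curve outer)" if "h \<in> set holes" "z \<in> inside (curve h)" for h
    using that pd by (auto simp: polygonal_domain_def polygon_region_def)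
  ultimately show ?thesis
    using par[of outer] reg[of outer] unfolding hs_def domain_set_def by auto
qed

text \<open>The complement of a convex set around the curve belongs to the unbounded outside.
  Applied to a disk, this bounds the distance to any guard in \<open>P_in_cap\<close>.\<close>

lemma domain_set_bounded_by:
  assumes pd: "polygonal_domain outer holes" and K: "convex K" "set outer \<subseteq> K"
  shows "domain_set outer holes \<subseteq> K"
proof -
  have c: "curve outer \<subseteq> K"
  proof -
    have "succ_vertex outer i \<in> set outer" if "i < length outer" for i
      using that by (auto simp: succ_vertex_def intro!: nth_mem mod_less_divisor)
    then have "edge outer i \<subseteq> K" if "i < length outer" for i
      unfolding edge_def using K that by (intro closed_segment_subset) auto
    then show ?thesis by (auto simp: curve_def)
  qed
  have "inside (curve outer) \<subseteq> K"
    using outside_subset_convex[OF K(1) c] by (auto simp: outside_inside)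
  then show ?thesis using c by (auto simp: domain_set_def polygon_region_def)
qed

section \<open>Open convex quadrilaterals in place of cones over disks\<close>

subsection \<open>Kites\<close>

text \<open>The kite has the vertices \<open>0\<close>, \<open>1 + s\<close> and \<open>1 \<plusminus> \<i> s\<close>, scaled by \<open>r\<close>.\<close>

definition kite0 :: "real \<Rightarrow> real \<Rightarrow> complex set" where
  "kite0 s r = {z. \<bar>Im z\<bar> < s * Re z \<and> Re z + \<bar>Im z\<bar> < r * (1 + s)}"

text \<open>Complex multiplication by \<open>v\<close> rotates and scales, so that no angle has to
  be computed. For \<open>r = 1\<close> the image of the point 1 is \<open>q + v\<close>, the place
  of the guard.\<close>

definition kite :: "real \<Rightarrow> complex \<Rightarrow> complex \<Rightarrow> real \<Rightarrow> complex set" where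
  "kite s q v r = (\<lambda>z. q + v * z) ` kite0 s r"

lemma kite0_Re_pos: "0 < s \<Longrightarrow> z \<in> kite0 s r \<Longrightarrow> 0 < Re z"
  unfolding kite0_def using zero_less_mult_pos[of s "Re z"] by fastforce

lemma convex_kite0: "convex (kite0 s r)"
proof (rule convexI)
  fix x y :: complex and u w :: real
  assume xy: "x \<in> kite0 s r" "y \<in> kite0 s r" and uw: "0 \<le> u" "0 \<le> w" "u + w = 1"
  define z where "z = u *\<^sub>R x + w *\<^sub>R y"
  have *: "u * a + w * b < c" if "a < c" "b < c" for a b c
    using convex_bound_lt[OF that uw] .
  have abs: "\<bar>Im z\<bar> \<le> u * \<bar>Im x\<bar> + w * \<bar>Im y\<bar>"
    using uw by (auto simp: z_def abs_mult intro!: order_trans[OF abs_triangle_ineq])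
  have re: "Re z = u * Re x + w * Re y" by (simp add: z_def)
  have "u * (\<bar>Im x\<bar> - s * Re x) + w * (\<bar>Im y\<bar> - s * Re y) < 0"
    by (rule *) (use xy in \<open>auto simp: kite0_def\<close>)
  then have 1: "\<bar>Im z\<bar> < s * Re z" using abs unfolding re by (simp add: algebra_simps)
  have "u * (Re x + \<bar>Im x\<bar>) + w * (Re y + \<bar>Im y\<bar>) < r * (1 + s)"
    by (rule *) (use xy in \<open>auto simp: kite0_def\<close>)
  then have "Re z + \<bar>Im z\<bar> < r * (1 + s)" using abs unfolding re by (simp add: algebra_simps)
  with 1 show "u *\<^sub>R x + w *\<^sub>R y \<in> kite0 s r" by (simp add: kite0_def z_def)
qed

lemma open_kite0: "open (kite0 s r)"
  unfolding kite0_def by (intro open_Collect_conj open_Collect_less continuous_intros)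

lemma mem_kite: "v \<noteq> 0 \<Longrightarrow> x \<in> kite s q v r \<longleftrightarrow> (x - q) / v \<in> kite0 s r"
  by (force simp: kite_def image_iff field_simps)

lemma connected_kite: "connected (kite s q v r)"
  unfolding kite_def
  by (intro connected_continuous_image continuous_intros convex_connected convex_kite0)

lemma open_kite: "v \<noteq> 0 \<Longrightarrow> open (kite s q v r)"
proof -
  assume v: "v \<noteq> 0"
  have "kite s q v r = (\<lambda>x. (x - q) / v) -` kite0 s r" using mem_kite[OF v] by auto
  then show ?thesis using v
    by (auto intro!: open_vimage open_kite0 continuous_intros)
qed

lemma kite_mono: "0 < s \<Longrightarrow> r \<le> r' \<Longrightarrow> kite s q v r \<subseteq> kite s q v r'"
  unfolding kite_def kite0_def
  by (auto intro!: image_mono elim: order_less_le_trans mult_right_mono)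

lemma kite_center: "0 < s \<Longrightarrow> 0 < r \<Longrightarrow> q + of_real (r / 2) * v \<in> kite s q v r"
  unfolding kite_def
proof (rule image_eqI)
  show "0 < s \<Longrightarrow> 0 < r \<Longrightarrow> of_real (r / 2) \<in> kite0 s r" by (simp add: kite0_def field_simps add_pos_pos)
qed simp

section \<open>Inclusions between kites and cones over disks\<close>

subsection \<open>Kites and robust guards\<close>

text \<open>In the frame with \<open>q\<close> at 0 and the guard at 1, the disk consists of points
  \<open>1 + d\<close> with \<open>norm d \<le> \<alpha> / 2\<close>. It respects the sides at the
  apex because \<open>5 / 4 * \<alpha> / 2 < 3 / 4 * \<alpha>\<close>, and the far sides because
  \<open>29 / 20 * \<alpha> / 2 < 3 / 4 * \<alpha>\<close>. Shrinking towards the apex preserves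
  both; the apex itself is not in the open kite and is covered by \<open>q \<in> P\<close>.\<close>

lemma kite_guards:
  assumes \<alpha>: "0 < \<alpha>" "\<alpha> \<le> 1" and K: "kite (3 / 4 * \<alpha>) q v 1 \<subseteq> P" and P: "q \<in> P" "q + v \<in> P"
  shows "robustly_guards_point P (\<alpha> / 2) (q + v) q"
  unfolding robustly_guards_point_def
proof (intro conjI ballI P)
  fix x assume x: "x \<in> cball (q + v) (\<alpha> / 2 * dist q (q + v))"
  show "sees P q x"
  proof (cases "v = 0")
    case True
    then show ?thesis using x P by (simp add: sees_def)
  next
    case False
    define d where "d = (x - q) / v - 1"
    have xd: "x = q + v * (1 + d)" using False by (simp add: d_def)
    have "norm (x - (q + v)) \<le> \<alpha> / 2 * norm v" using x by (simp add: dist_norm norm_minus_commute)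
    then have "norm v * norm d \<le> norm v * (\<alpha> / 2)" unfolding xd by (simp add: algebra_simps norm_mult[symmetric])
    then have d: "norm d \<le> \<alpha> / 2" using False by simp
    have n2: "(norm d)\<^sup>2 = \<bar>Re d\<bar>\<^sup>2 + \<bar>Im d\<bar>\<^sup>2" by (simp add: cmod_power2)
    \<comment> \<open>Cauchy-Schwarz with the vector (1, 3 / 4), whose length is 5 / 4.\<close>
    have "(\<bar>Im d\<bar> + 3 / 4 * \<bar>Re d\<bar>)\<^sup>2 \<le> (5 / 4 * norm d)\<^sup>2"
      unfolding power_mult_distrib n2 using zero_le_power2[of "3 / 4 * \<bar>Im d\<bar> - \<bar>Re d\<bar>"]
      by (simp add: power2_eq_square algebra_simps)
    then have 1: "\<bar>Im d\<bar> + 3 / 4 * \<bar>Re d\<bar> \<le> 5 / 4 * norm d" by (rule power2_le_imp_le) simp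
    \<comment> \<open>Here 29 / 20 is a rational upper bound for the square root of 2.\<close>
    have "(\<bar>Im d\<bar> + \<bar>Re d\<bar>)\<^sup>2 \<le> 2 * (norm d)\<^sup>2"
      unfolding n2 using zero_le_power2[of "\<bar>Im d\<bar> - \<bar>Re d\<bar>"]
      by (simp add: power2_eq_square algebra_simps)
    also have "\<dots> \<le> (29 / 20 * norm d)\<^sup>2" by (simp add: power2_eq_square)
    finally have 2: "\<bar>Im d\<bar> + \<bar>Re d\<bar> \<le> 29 / 20 * norm d" by (rule power2_le_imp_le) simp
    have inK: "q + v * (of_real t * (1 + d)) \<in> kite (3 / 4 * \<alpha>) q v 1" if t: "0 < t" "t \<le> 1" for t
    proof -
      have "\<alpha> * \<bar>Re d\<bar> \<le> 1 * \<bar>Re d\<bar>" using \<alpha> by (intro mult_right_mono) auto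
      then have "3 / 4 * \<alpha> * \<bar>Re d\<bar> \<le> 3 / 4 * \<bar>Re d\<bar>" by simp
      moreover have "- (3 / 4 * \<alpha> * \<bar>Re d\<bar>) \<le> 3 / 4 * \<alpha> * Re d" using \<alpha> by (simp add: abs_if)
      ultimately have "\<bar>Im d\<bar> < 3 / 4 * \<alpha> * (1 + Re d)" using 1 d \<alpha>(1) by (simp add: algebra_simps)
      then have "t * \<bar>Im d\<bar> < t * (3 / 4 * \<alpha> * (1 + Re d))" using t by (simp only: mult_less_cancel_left_pos)
      moreover have "t * (1 + Re d + \<bar>Im d\<bar>) < 1 + 3 / 4 * \<alpha>"
      proof -
        have "1 + Re d + \<bar>Im d\<bar> \<le> 1 + 29 / 40 * \<alpha>" using 2 d by simp
        then have "t * (1 + Re d + \<bar>Im d\<bar>) \<le> t * (1 + 29 / 40 * \<alpha>)" using t by simp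
        also have "\<dots> \<le> 1 * (1 + 29 / 40 * \<alpha>)" using t \<alpha> by (intro mult_right_mono) auto
        finally show ?thesis using \<alpha> by simp
      qed
      ultimately have "of_real t * (1 + d) \<in> kite0 (3 / 4 * \<alpha>) 1"
        using t by (simp add: kite0_def abs_mult algebra_simps)
      then show ?thesis unfolding kite_def by blast
    qed
    show ?thesis unfolding sees_def
    proof
      fix y assume "y \<in> closed_segment q x"
      then obtain t where t: "0 \<le> t" "t \<le> 1" "y = (1 - t) *\<^sub>R q + t *\<^sub>R x" by (auto simp: in_segment)
      show "y \<in> P"
      proof (cases "t = 0")
        case False
        have "y = q + v * (of_real t * (1 + d))" using t(3) xd by (simp add: scaleR_conv_of_real algebra_simps)
        then show ?thesis using inK[of t] t False K by auto
      qed (use t P in simp)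
    qed
  qed
qed

text \<open>A point of the kite lies on a segment from the apex to a point of the far sides. These
  sides lie in the disk of radius \<open>s\<close> about 1, so with the scaling by \<open>v\<close>
  and the offset of its tip they stay in the disk around \<open>g\<close>, all of which
  \<open>q\<close> sees. The vector \<open>v\<close> need not point at \<open>g\<close> exactly,
  which leaves room for rounded directions and positions.\<close>

lemma guard_kite:
  assumes g: "robustly_guards_point P \<alpha> g q" and s: "0 < s"
    and near: "s * norm v + norm (v - (g - q)) < \<alpha> * dist q g"
  shows "kite s q v 1 \<subseteq> P"
proof
  fix y assume "y \<in> kite s q v 1"
  then obtain z where z: "z \<in> kite0 s 1" "y = q + v * z" by (auto simp: kite_def)
  \<comment> \<open>The radial coordinate with value 1 on the far sides; \<open>w\<close> is the
    projection of \<open>z\<close> onto them.\<close>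
  define c where "c = (Re z + \<bar>Im z\<bar>) / (1 + s)"
  have re: "0 < Re z" using kite0_Re_pos[OF s z(1)] .
  have c: "0 < c" "c < 1" using z(1) re s by (auto simp: c_def kite0_def field_simps)
  define w where "w = z / of_real c"
  have zw: "z = of_real c * w" using c by (simp add: w_def)
  have "Re z = c * Re w" "\<bar>Im z\<bar> = c * \<bar>Im w\<bar>" using zw c by (simp_all add: abs_mult)
  moreover have "c * (1 + s) = Re z + \<bar>Im z\<bar>" using s by (simp add: c_def)
  ultimately have "c * (Re w + \<bar>Im w\<bar>) = c * (1 + s)" by (simp only: distrib_left)
  then have sum: "Re w + \<bar>Im w\<bar> = 1 + s" using c by simp
  have "c * \<bar>Im w\<bar> < c * (s * Re w)" using z(1) c zw by (simp add: kite0_def abs_mult algebra_simps)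
  then have "\<bar>Im w\<bar> < s * Re w" using c by simp
  moreover have "s * Re w + s * \<bar>Im w\<bar> = s * (1 + s)" using sum by (metis distrib_left)
  ultimately have "\<bar>Im w\<bar> * (1 + s) < s * (1 + s)" by (simp add: algebra_simps)
  then have im: "\<bar>Im w\<bar> < s" using s by simp
  \<comment> \<open>The far sides are chords of the circle of radius \<open>s\<close> about 1,
    joining \<open>1 + s\<close> to the two side vertices.\<close>
  have "(norm (w - 1))\<^sup>2 = (s - \<bar>Im w\<bar>)\<^sup>2 + \<bar>Im w\<bar>\<^sup>2"
  proof -
    have "Re (w - 1) = s - \<bar>Im w\<bar>" using sum by simp
    then show ?thesis by (simp only: cmod_power2) simp
  qed
  also have "\<dots> = s\<^sup>2 - 2 * \<bar>Im w\<bar> * (s - \<bar>Im w\<bar>)" by (simp add: power2_eq_square algebra_simps)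
  also have "\<dots> \<le> s\<^sup>2" using im by simp
  finally have n2: "(norm (w - 1))\<^sup>2 \<le> s\<^sup>2" .
  have n: "norm (w - 1) \<le> s" by (rule power2_le_imp_le[OF n2]) (use s in linarith)
  have "dist g (q + v * w) = norm ((v - (g - q)) + v * (w - 1))"
    by (simp add: dist_norm algebra_simps norm_minus_commute)
  also have "\<dots> \<le> norm (v - (g - q)) + norm v * norm (w - 1)"
    by (metis norm_mult norm_triangle_ineq)
  also have "\<dots> \<le> norm (v - (g - q)) + norm v * s" using n by (simp add: mult_left_mono)
  also have "\<dots> \<le> \<alpha> * dist q g" using near by (simp add: mult.commute)
  finally have "closed_segment q (q + v * w) \<subseteq> P"
    using g by (auto simp: robustly_guards_point_def sees_def)
  moreover have "y \<in> closed_segment q (q + v * w)"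
    unfolding in_segment using c z(2) zw
    by (intro exI[of _ c]) (auto simp: scaleR_conv_of_real algebra_simps)
  ultimately show "y \<in> P" by blast
qed

text \<open>Changing \<open>v\<close> multiplies points by \<open>1 + e\<close> with
  \<open>norm e \<le> \<alpha> / 50\<close>. Points of the unit kite have norm at most
  \<open>2 * Re z\<close> and at most 2, so they move by at most \<open>\<alpha> / 25 * Re z\<close>
  and at most \<open>\<alpha> / 25\<close>. Both are below the gap:
  \<open>3 / 4 + 1 / 25 \<le> 9 / 10 * (1 - 1 / 25)\<close> at the apex,
  \<open>3 / 4 + 2 / 25 < 9 / 10\<close> at the far sides.\<close>

lemma kite_perturb:
  assumes \<alpha>: "0 < \<alpha>" "\<alpha> \<le> 1" and w: "norm w = 1" "0 < r"
    and near: "norm (v - of_real r * w) \<le> \<alpha> / 50 * r"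
  shows "kite (3 / 4 * \<alpha>) q v 1 \<subseteq> kite (9 / 10 * \<alpha>) q w r"
proof
  fix y assume "y \<in> kite (3 / 4 * \<alpha>) q v 1"
  then obtain z where z: "z \<in> kite0 (3 / 4 * \<alpha>) 1" "y = q + v * z" by (auto simp: kite_def)
  have w0: "w \<noteq> 0" using w by auto
  define e where "e = v / (of_real r * w) - 1"
  have v: "v = of_real r * w * (1 + e)" using w w0 by (simp add: e_def)
  have "r * norm e = norm (v - of_real r * w)" unfolding v using w by (simp add: algebra_simps norm_mult)
  then have "r * norm e \<le> r * (\<alpha> / 50)" using near by (simp add: mult.commute)
  then have e: "norm e \<le> \<alpha> / 50" using w(2) by (simp only: mult_le_cancel_left_pos)
  have re: "0 < Re z" using kite0_Re_pos[OF _ z(1)] \<alpha> by simp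
  have im: "\<bar>Im z\<bar> < 3 / 4 * \<alpha> * Re z" and hz: "Re z + \<bar>Im z\<bar> < 1 + 3 / 4 * \<alpha>"
    using z(1) by (auto simp: kite0_def)
  have "\<alpha> * Re z \<le> Re z" using \<alpha> re by simp
  then have im2: "\<bar>Im z\<bar> < Re z" using im re by linarith
  have nz: "norm z \<le> 2 * Re z" using cmod_le[of z] im2 re by simp
  have nz2: "norm z \<le> 2" using cmod_le[of z] hz re \<alpha> by simp
  \<comment> \<open>The first bound vanishes at the apex, as the sides there require; the second
    serves the far sides.\<close>
  have ez: "norm (e * z) \<le> \<alpha> / 50 * (2 * Re z)" "norm (e * z) \<le> \<alpha> / 50 * 2"
    unfolding norm_mult using e nz nz2 re \<alpha> by (intro mult_mono; simp)+
  let ?u = "(1 + e) * z"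
  have u: "Re ?u = Re z + Re (e * z)" "Im ?u = Im z + Im (e * z)" by (simp_all add: algebra_simps)
  have r1: "\<bar>Re (e * z)\<bar> \<le> norm (e * z)" "\<bar>Im (e * z)\<bar> \<le> norm (e * z)"
    using abs_Re_le_cmod abs_Im_le_cmod by blast+
  have "\<bar>Im ?u\<bar> < 9 / 10 * \<alpha> * Re ?u"
  proof -
    have "\<bar>Im ?u\<bar> < 3 / 4 * \<alpha> * Re z + \<alpha> / 25 * Re z" using u r1 ez im by (simp add: abs_if split: if_splits)
    moreover have "Re ?u \<ge> Re z * (1 - 1 / 25)"
      using u r1 ez(1) \<open>\<alpha> * Re z \<le> Re z\<close> by (simp add: abs_if split: if_splits)
    then have "9 / 10 * \<alpha> * (Re z * (1 - 1 / 25)) \<le> 9 / 10 * \<alpha> * Re ?u" using \<alpha> by (intro mult_left_mono) auto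
    moreover have "3 / 4 * \<alpha> * Re z + \<alpha> / 25 * Re z \<le> 9 / 10 * \<alpha> * (Re z * (1 - 1 / 25))"
      using mult_pos_pos[OF \<alpha>(1) re] by (simp add: algebra_simps)
    ultimately show ?thesis by linarith
  qed
  moreover have "Re ?u + \<bar>Im ?u\<bar> < 1 + 9 / 10 * \<alpha>"
    using u r1 ez(2) hz \<alpha> by (simp add: abs_if split: if_splits)
  ultimately have *: "Re ?u + \<bar>Im ?u\<bar> < 1 + 9 / 10 * \<alpha>" "\<bar>Im ?u\<bar> < 9 / 10 * \<alpha> * Re ?u" by blast+
  have "of_real r * ?u \<in> kite0 (9 / 10 * \<alpha>) r"
  proof -
    have "r * (Re ?u + \<bar>Im ?u\<bar>) < r * (1 + 9 / 10 * \<alpha>)" "r * \<bar>Im ?u\<bar> < r * (9 / 10 * \<alpha> * Re ?u)"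
      using * w(2) by (simp_all only: mult_less_cancel_left_pos)
    moreover have "Re (of_real r * ?u) = r * Re ?u" "\<bar>Im (of_real r * ?u)\<bar> = r * \<bar>Im ?u\<bar>"
    proof -
      have *: "Re (of_real r * u) = r * Re u" "Im (of_real r * u) = r * Im u" for u by simp_all
      show "Re (of_real r * ?u) = r * Re ?u" "\<bar>Im (of_real r * ?u)\<bar> = r * \<bar>Im ?u\<bar>"
        unfolding * abs_mult using w(2) by simp_all
    qed
    ultimately show ?thesis unfolding kite0_def mem_Collect_eq by (simp only: distrib_left mult_ac)
  qed
  moreover have "y = q + w * (of_real r * ?u)" using z(2) v by (simp add: algebra_simps)
  ultimately show "y \<in> kite (9 / 10 * \<alpha>) q w r" unfolding kite_def by blast
qed

section \<open>The largest kite that avoids a segment\<close>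

subsection \<open>Clipping edges\<close>

text \<open>Liang-Barsky clipping of a parameter interval by one half-plane. The arguments
  \<open>l0\<close> and \<open>l1\<close> are the values at parameters 0 and 1 of an affine function
  that has to be positive; \<open>l0 / (l0 - l1)\<close> is its root.\<close>

definition clip_lo :: "real \<Rightarrow> real \<Rightarrow> real \<Rightarrow> real" where
  "clip_lo l0 l1 lo = (if l0 < 0 \<and> 0 < l1 then max lo (l0 / (l0 - l1)) else lo)"

text \<open>Setting the upper end to 0 makes the parameter interval empty, since its lower end is never
  negative.\<close>

definition clip_hi :: "real \<Rightarrow> real \<Rightarrow> real \<Rightarrow> real" where
  "clip_hi l0 l1 hi = (if l0 \<le> 0 \<and> l1 \<le> 0 then 0 else if l1 < 0 then min hi (l0 / (l0 - l1)) else hi)"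

lemma affine_gt_root: "(l0::real) < 0 \<Longrightarrow> 0 < l1 \<Longrightarrow> 0 < l0 + t * (l1 - l0) \<longleftrightarrow> l0 / (l0 - l1) < t"
  by (simp add: divide_less_eq) (simp add: algebra_simps)

lemma affine_lt_root: "0 < (l0::real) \<Longrightarrow> l1 < 0 \<Longrightarrow> 0 < l0 + t * (l1 - l0) \<longleftrightarrow> t < l0 / (l0 - l1)"
  by (simp add: less_divide_eq) (simp add: algebra_simps)

lemma affine_pos_endpoints:
  assumes "0 \<le> t" "t \<le> 1" "0 < l0 + t * (l1 - (l0::real))"
  shows "\<not> (l0 \<le> 0 \<and> l1 \<le> 0)"
proof
  assume "l0 \<le> 0 \<and> l1 \<le> 0"
  then have "(1 - t) * l0 + t * l1 \<le> 0" using assms by (intro add_nonpos_nonpos mult_nonneg_nonpos) auto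
  then show False using assms(3) by (simp add: algebra_simps)
qed

text \<open>One constraint moves at most one end, and the root that becomes the new end differs from
  \<open>t\<close>, where the function is positive. So the interval keeps positive length.\<close>

lemma clip_complete:
  assumes "0 \<le> t" "t \<le> 1" "0 < l0 + t * (l1 - l0)" "lo \<le> t" "t \<le> hi" "lo < hi"
  shows "clip_lo l0 l1 lo \<le> t" "t \<le> clip_hi l0 l1 hi" "clip_lo l0 l1 lo < clip_hi l0 l1 hi"
  using assms affine_pos_endpoints[OF assms(1-3)] affine_gt_root[of l0 l1 t] affine_lt_root[of l0 l1 t]
  by (auto simp: clip_lo_def clip_hi_def)

lemma clip_mono: "lo \<le> clip_lo l0 l1 lo" "0 \<le> hi \<Longrightarrow> clip_hi l0 l1 hi \<le> hi"
  by (auto simp: clip_lo_def clip_hi_def)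

lemma clip_hi_nonneg: "0 \<le> hi \<Longrightarrow> 0 \<le> clip_hi l0 l1 hi"
  by (auto simp: clip_hi_def)

text \<open>Only the open interval qualifies, since the affine function may vanish at the ends. The
  proof of \<open>edge_bound\<close> passes to the closure.\<close>

lemma clip_sound:
  assumes "0 \<le> lo" "hi \<le> 1" "clip_lo l0 l1 lo < t" "t < clip_hi l0 l1 hi"
  shows "0 < l0 + t * (l1 - l0)"
proof -
  have t: "0 < t" and n: "\<not> (l0 \<le> 0 \<and> l1 \<le> 0)" using assms clip_mono(1)[of lo l0 l1] by (auto simp: clip_hi_def)
  consider "l0 < 0" "0 < l1" | "0 < l0" "l1 < 0" | "0 \<le> l0" "0 \<le> l1" "0 < l0 \<or> 0 < l1" using n by linarith
  then show ?thesis
  proof cases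
    case 1
    then show ?thesis using assms affine_gt_root by (simp add: clip_lo_def)
  next
    case 2
    then show ?thesis using assms affine_lt_root by (simp add: clip_hi_def)
  next
    case 3
    have "t < 1" using assms 3 by (auto simp: clip_hi_def split: if_splits)
    then have "0 \<le> (1 - t) * l0" "0 \<le> t * l1" "0 < (1 - t) * l0 \<or> 0 < t * l1" using t 3 by auto
    then have "0 < (1 - t) * l0 + t * l1" by linarith
    then show ?thesis by (simp add: algebra_simps)
  qed
qed

text \<open>The value of \<open>Re z + \<bar>Im z\<bar>\<close> along the edge. Divided by
  \<open>1 + s\<close> it is the scale of the kite whose far sides pass through that point.\<close>

definition gauge :: "real \<Rightarrow> real \<Rightarrow> real \<Rightarrow> real \<Rightarrow> real \<Rightarrow> real" where
  "gauge x0 y0 x1 y1 t = x0 + t * (x1 - x0) + \<bar>y0 + t * (y1 - y0)\<bar>"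

text \<open>The gauge is piecewise affine with a kink where the edge crosses the axis of the kite. If the
  edge is parallel to the axis, the quotient is 0, but then there is no kink.\<close>

lemma gauge_min:
  assumes t: "lo \<le> t" "t \<le> hi"
  shows "min (gauge x0 y0 x1 y1 lo) (min (gauge x0 y0 x1 y1 hi)
      (gauge x0 y0 x1 y1 (max lo (min hi (y0 / (y0 - y1)))))) \<le> gauge x0 y0 x1 y1 t"
proof -
  define c where "c = max lo (min hi (y0 / (y0 - y1)))"
  let ?h = "gauge x0 y0 x1 y1" and ?y = "\<lambda>t. y0 + t * (y1 - y0)"
  \<comment> \<open>Where the ordinate keeps its sign the gauge is affine, hence at least the
    smaller of its two end values.\<close>
  have *: "min (?h a) (?h b) \<le> ?h t" if ab: "a \<le> t" "t \<le> b" and same: "(0 \<le> ?y a \<and> 0 \<le> ?y b) \<or> (?y a \<le> 0 \<and> ?y b \<le> 0)" for a b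
  proof (cases "a = b")
    case False
    define u where "u = (t - a) / (b - a)"
    have u: "0 \<le> u" "u \<le> 1" and tu: "t = (1 - u) * a + u * b"
    proof -
      have "u * (b - a) = t - a" using False by (simp add: u_def)
      then show "t = (1 - u) * a + u * b" by (simp add: algebra_simps)
    qed (use ab False in \<open>auto simp: u_def divide_simps\<close>)
    have y: "?y t = (1 - u) * ?y a + u * ?y b" unfolding tu by (simp add: algebra_simps)
    have "\<bar>?y t\<bar> = (1 - u) * \<bar>?y a\<bar> + u * \<bar>?y b\<bar>"
    proof (cases "0 \<le> ?y a \<and> 0 \<le> ?y b")
      case True
      then have "0 \<le> (1 - u) * ?y a + u * ?y b" using u by simp
      then show ?thesis using True unfolding y by simp
    next
      case False
      then have neg: "?y a \<le> 0" "?y b \<le> 0" using same by auto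
      then have "0 \<le> (1 - u) * - ?y a + u * - ?y b" using u by (intro add_nonneg_nonneg mult_nonneg_nonneg) auto
      then have "?y t \<le> 0" using y by linarith
      then show ?thesis using neg y by (simp only: abs_of_nonpos)
    qed
    moreover have "x0 + t * (x1 - x0) = (1 - u) * (x0 + a * (x1 - x0)) + u * (x0 + b * (x1 - x0))"
      unfolding tu by (simp add: algebra_simps)
    ultimately have "?h t = (1 - u) * ?h a + u * ?h b" unfolding gauge_def by (simp only: distrib_left)
    moreover have "(1 - u) * min (?h a) (?h b) + u * min (?h a) (?h b) \<le> (1 - u) * ?h a + u * ?h b"
      using u by (intro add_mono mult_left_mono) auto
    moreover have "(1 - u) * min (?h a) (?h b) + u * min (?h a) (?h b) = min (?h a) (?h b)"
      by (simp add: algebra_simps)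
    ultimately show ?thesis by linarith
  qed (use ab in auto)
  have prod: "0 \<le> ?y a * ?y b \<Longrightarrow> (0 \<le> ?y a \<and> 0 \<le> ?y b) \<or> (?y a \<le> 0 \<and> ?y b \<le> 0)" for a b
    by (auto simp: zero_le_mult_iff)
  have c: "lo \<le> c" "c \<le> hi" using t by (auto simp: c_def)
  \<comment> \<open>The root of the ordinate, clamped to the interval, splits it into two pieces
    without a sign change.\<close>
  have s: "0 \<le> ?y lo * ?y c \<and> 0 \<le> ?y c * ?y hi"
  proof (cases "y0 = y1")
    case False
    define r where "r = y0 / (y0 - y1)"
    have y: "?y a = (y1 - y0) * (a - r)" for a using False by (simp add: r_def field_simps)
    have "?y a * ?y b = (y1 - y0)\<^sup>2 * ((a - r) * (b - r))" for a b
      unfolding y by (simp add: power2_eq_square)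
    moreover have "0 \<le> (lo - r) * (c - r)" "0 \<le> (c - r) * (hi - r)"
      using t unfolding c_def r_def[symmetric] by (auto simp: zero_le_mult_iff max_def min_def)
    ultimately show ?thesis by simp
  qed simp
  show ?thesis
  proof (cases "t \<le> c")
    case True
    then show ?thesis using *[OF t(1) True prod] s unfolding c_def[symmetric] by auto
  next
    case False
    then show ?thesis using *[of c hi] t(2) prod s unfolding c_def[symmetric] by auto
  qed
qed

definition edge_bound :: "real \<Rightarrow> complex \<Rightarrow> complex \<Rightarrow> real \<Rightarrow> real" where
  "edge_bound s a b r =
     (let x0 = Re a; y0 = Im a; x1 = Re b; y1 = Im b;
          lo = clip_lo (s * x0 + y0) (s * x1 + y1) (clip_lo (s * x0 - y0) (s * x1 - y1) 0);
          hi = clip_hi (s * x0 + y0) (s * x1 + y1) (clip_hi (s * x0 - y0) (s * x1 - y1) 1)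
      in if lo < hi
         then min r (min (gauge x0 y0 x1 y1 lo) (min (gauge x0 y0 x1 y1 hi)
           (gauge x0 y0 x1 y1 (max lo (min hi (y0 / (y0 - y1)))))) / (1 + s))
         else r)"

text \<open>Between the two sides at the apex, lying in the kite of scale \<rho> means having gauge
  below \<open>\<rho> * (1 + s)\<close>, so the least gauge over the clipped edge decides. The
  equivalence for every \<rho> determines the value and lets the bounds of all edges be accumulated
  by induction.\<close>

lemma edge_bound:
  assumes s: "0 < s"
  shows "\<rho> \<le> edge_bound s a b r \<longleftrightarrow> \<rho> \<le> r \<and> closed_segment a b \<inter> kite0 s \<rho> = {}"
proof -
  define x0 y0 x1 y1 where xy: "x0 = Re a" "y0 = Im a" "x1 = Re b" "y1 = Im b"
  define lo1 hi1 where lh1: "lo1 = clip_lo (s * x0 - y0) (s * x1 - y1) 0" "hi1 = clip_hi (s * x0 - y0) (s * x1 - y1) 1"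
  define lo hi where lh: "lo = clip_lo (s * x0 + y0) (s * x1 + y1) lo1" "hi = clip_hi (s * x0 + y0) (s * x1 + y1) hi1"
  let ?h = "gauge x0 y0 x1 y1"
  define m where "m = min (?h lo) (min (?h hi) (?h (max lo (min hi (y0 / (y0 - y1))))))"
  have eb: "edge_bound s a b r = (if lo < hi then min r (m / (1 + s)) else r)"
    by (simp only: edge_bound_def Let_def xy lh1 lh m_def)
  have seg: "closed_segment a b \<inter> kite0 s \<rho> = {} \<longleftrightarrow>
      (\<forall>t. 0 \<le> t \<and> t \<le> 1 \<and> 0 < (s * x0 - y0) + t * ((s * x1 - y1) - (s * x0 - y0)) \<and>
        0 < (s * x0 + y0) + t * ((s * x1 + y1) - (s * x0 + y0)) \<longrightarrow> \<rho> * (1 + s) \<le> ?h t)"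
  proof -
    have "(1 - t) *\<^sub>R a + t *\<^sub>R b \<in> kite0 s \<rho> \<longleftrightarrow>
       0 < (s * x0 - y0) + t * ((s * x1 - y1) - (s * x0 - y0)) \<and>
        0 < (s * x0 + y0) + t * ((s * x1 + y1) - (s * x0 + y0)) \<and> ?h t < \<rho> * (1 + s)" for t
    proof -
      have e: "Re ((1 - t) *\<^sub>R a + t *\<^sub>R b) = x0 + t * (x1 - x0)" "Im ((1 - t) *\<^sub>R a + t *\<^sub>R b) = y0 + t * (y1 - y0)"
        by (simp_all add: xy algebra_simps)
      have p: "\<bar>Y\<bar> < s * X \<longleftrightarrow> 0 < s * X - Y \<and> 0 < s * X + Y" for X Y by auto
      have q: "s * (x0 + t * (x1 - x0)) - (y0 + t * (y1 - y0)) = (s * x0 - y0) + t * ((s * x1 - y1) - (s * x0 - y0))"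
        "s * (x0 + t * (x1 - x0)) + (y0 + t * (y1 - y0)) = (s * x0 + y0) + t * ((s * x1 + y1) - (s * x0 + y0))"
        by (simp_all add: algebra_simps)
      show ?thesis unfolding kite0_def mem_Collect_eq gauge_def e p q by (simp only: conj_assoc)
    qed
    note eq = this
    show ?thesis
    proof
      assume L: "closed_segment a b \<inter> kite0 s \<rho> = {}"
      show "\<forall>t. 0 \<le> t \<and> t \<le> 1 \<and> 0 < (s * x0 - y0) + t * ((s * x1 - y1) - (s * x0 - y0)) \<and>
        0 < (s * x0 + y0) + t * ((s * x1 + y1) - (s * x0 + y0)) \<longrightarrow> \<rho> * (1 + s) \<le> ?h t"
      proof (intro allI impI, elim conjE, rule ccontr)
        fix t assume t: "0 \<le> t" "t \<le> 1" "0 < (s * x0 - y0) + t * ((s * x1 - y1) - (s * x0 - y0))"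
          "0 < (s * x0 + y0) + t * ((s * x1 + y1) - (s * x0 + y0))" "\<not> \<rho> * (1 + s) \<le> ?h t"
        then have "(1 - t) *\<^sub>R a + t *\<^sub>R b \<in> kite0 s \<rho>" using eq[of t] by argo
        moreover have "(1 - t) *\<^sub>R a + t *\<^sub>R b \<in> closed_segment a b" using t by (auto simp: in_segment)
        ultimately show False using L by blast
      qed
    next
      assume R: "\<forall>t. 0 \<le> t \<and> t \<le> 1 \<and> 0 < (s * x0 - y0) + t * ((s * x1 - y1) - (s * x0 - y0)) \<and>
        0 < (s * x0 + y0) + t * ((s * x1 + y1) - (s * x0 + y0)) \<longrightarrow> \<rho> * (1 + s) \<le> ?h t"
      show "closed_segment a b \<inter> kite0 s \<rho> = {}"
      proof (rule ccontr)
        assume "closed_segment a b \<inter> kite0 s \<rho> \<noteq> {}"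
        then obtain t where t: "0 \<le> t" "t \<le> 1" "(1 - t) *\<^sub>R a + t *\<^sub>R b \<in> kite0 s \<rho>" by (auto simp: in_segment)
        then show False using R eq[of t] by (meson not_le)
      qed
    qed
  qed
  have "0 \<le> lo1" "hi1 \<le> 1" "0 \<le> hi1" using clip_mono clip_hi_nonneg unfolding lh1 by (metis zero_le_one)+
  note lh1_bounds = this
  have bounds: "0 \<le> lo" "lo1 \<le> lo" "hi \<le> hi1"
  proof -
    show "lo1 \<le> lo" "hi \<le> hi1" unfolding lh using clip_mono lh1_bounds(3) by auto
    then show "0 \<le> lo" using lh1_bounds(1) by linarith
  qed
  show ?thesis
  proof (cases "lo < hi")
    case False
    have "\<not> (0 \<le> t \<and> t \<le> 1 \<and> 0 < (s * x0 - y0) + t * ((s * x1 - y1) - (s * x0 - y0)) \<and>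
        0 < (s * x0 + y0) + t * ((s * x1 + y1) - (s * x0 + y0)))" for t
      using clip_complete[of t "s * x0 - y0" "s * x1 - y1" 0 1] clip_complete[of t "s * x0 + y0" "s * x1 + y1" lo1 hi1] False
      unfolding lh1[symmetric] lh[symmetric] by auto
    then show ?thesis using False unfolding eb seg by auto
  next
    case True
    have m: "m \<le> ?h t" if "lo \<le> t" "t \<le> hi" for t using gauge_min[OF that] unfolding m_def .
    have "\<rho> \<le> m / (1 + s) \<longleftrightarrow> \<rho> * (1 + s) \<le> m" using s by (simp add: pos_le_divide_eq)
    also have "\<dots> \<longleftrightarrow> closed_segment a b \<inter> kite0 s \<rho> = {}"
      unfolding seg
    proof (intro iffI allI impI)
      fix t assume le: "\<rho> * (1 + s) \<le> m" and t: "0 \<le> t \<and> t \<le> 1 \<and> 0 < (s * x0 - y0) + t * ((s * x1 - y1) - (s * x0 - y0)) \<and>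
        0 < (s * x0 + y0) + t * ((s * x1 + y1) - (s * x0 + y0))"
      have "lo1 \<le> t" "t \<le> hi1" "lo1 < hi1"
        using clip_complete[of t "s * x0 - y0" "s * x1 - y1" 0 1] t unfolding lh1 by auto
      then have "lo \<le> t" "t \<le> hi"
        using clip_complete[of t "s * x0 + y0" "s * x1 + y1" lo1 hi1] t unfolding lh by auto
      then show "\<rho> * (1 + s) \<le> ?h t" using m le by fastforce
    next
      assume all: "\<forall>t. 0 \<le> t \<and> t \<le> 1 \<and> 0 < (s * x0 - y0) + t * ((s * x1 - y1) - (s * x0 - y0)) \<and>
        0 < (s * x0 + y0) + t * ((s * x1 + y1) - (s * x0 + y0)) \<longrightarrow> \<rho> * (1 + s) \<le> ?h t"
      have int: "\<rho> * (1 + s) \<le> ?h t" if "lo < t" "t < hi" for t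
      proof -
        have "0 < (s * x0 + y0) + t * ((s * x1 + y1) - (s * x0 + y0))"
          using clip_sound[of lo1 hi1 "s * x0 + y0" "s * x1 + y1" t] that lh1_bounds unfolding lh by simp
        moreover have "0 < (s * x0 - y0) + t * ((s * x1 - y1) - (s * x0 - y0))"
          using clip_sound[of 0 1 "s * x0 - y0" "s * x1 - y1" t] that bounds unfolding lh1 by simp
        moreover have "0 \<le> t" "t \<le> 1" using that bounds lh1_bounds by auto
        ultimately show ?thesis using all by blast
      qed
      \<comment> \<open>The gauge inequality is a closed condition, so it extends from the open
        interval to the ends where the minimum is evaluated.\<close>
      have closed: "closed {t. \<rho> * (1 + s) \<le> ?h t}"
        unfolding gauge_def by (intro closed_Collect_le continuous_intros)
      have "{lo<..<hi} \<subseteq> {t. \<rho> * (1 + s) \<le> ?h t}" using int by auto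
      from closure_minimal[OF this closed] have "\<rho> * (1 + s) \<le> ?h t" if "lo \<le> t" "t \<le> hi" for t
        using that True by auto
      then show "\<rho> * (1 + s) \<le> m" unfolding m_def using True by auto
    qed
    finally show ?thesis using True unfolding eb by auto
  qed
qed

section \<open>The largest kite inside a domain, and the guard test\<close>

subsection \<open>The scale of a kite in a planar domain\<close>

text \<open>The interface between polygons and algorithm. The edges form one flat indexed family, as
  in the machine's arrays; which curve an edge belongs to no longer matters.\<close>

locale planar_domain =
  fixes P :: "complex set" and n :: nat and A B :: "nat \<Rightarrow> complex"
  assumes frontier_P: "frontier P \<subseteq> (\<Union>i<n. closed_segment (A i) (B i))"
    and edges_P: "\<And>i z. i < n \<Longrightarrow> z \<in> closed_segment (A i) (B i) \<Longrightarrow> z \<notin> interior P"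
    and parity: "\<And>z. (\<And>i. i < n \<Longrightarrow> z \<notin> closed_segment (A i) (B i)) \<Longrightarrow>
      z \<in> P \<longleftrightarrow> odd (card {i. i < n \<and> crosses z (A i) (B i)})"
    and P_subset: "\<And>K. convex K \<Longrightarrow> (\<And>i. i < n \<Longrightarrow> A i \<in> K) \<Longrightarrow> P \<subseteq> K"
begin

text \<open>An upper limit for scales that makes the minimum over the edges finite. It exceeds 1 and the
  distance from \<open>q\<close> to any point of \<open>P\<close>.\<close>

definition cap :: "complex \<Rightarrow> nat \<Rightarrow> real" where
  "cap q k = 1 + (\<Sum>i<k. \<bar>Re (A i) - Re q\<bar> + \<bar>Im (A i) - Im q\<bar>)"

primrec bound_upto :: "real \<Rightarrow> complex \<Rightarrow> complex \<Rightarrow> nat \<Rightarrow> real" where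
  "bound_upto s q v 0 = cap q n"
| "bound_upto s q v (Suc k) = edge_bound s ((A k - q) / v) ((B k - q) / v) (bound_upto s q v k)"

definition crossings_upto :: "complex \<Rightarrow> nat \<Rightarrow> nat" where
  "crossings_upto z k = card {i. i < k \<and> crosses z (A i) (B i)}"

text \<open>The value 0 means that there is no kite: either every positive scale runs into an edge,
  or the edge-free kite lies outside the domain.\<close>

definition scale :: "real \<Rightarrow> complex \<Rightarrow> complex \<Rightarrow> real" where
  "scale s q v =
     (let r = bound_upto s q v n
      in if 0 < r \<and> odd (crossings_upto (q + of_real (r / 2) * v) n) then r else 0)"

lemma P_in_cap: "P \<subseteq> cball q (cap q n)"
proof (rule P_subset)
  fix i assume i: "i < n"
  have "dist q (A i) \<le> \<bar>Re (A i) - Re q\<bar> + \<bar>Im (A i) - Im q\<bar>"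
    using cmod_le[of "A i - q"] by (simp add: dist_norm norm_minus_commute)
  also have "\<dots> \<le> (\<Sum>i<n. \<bar>Re (A i) - Re q\<bar> + \<bar>Im (A i) - Im q\<bar>)"
    using i by (intro member_le_sum) auto
  finally show "A i \<in> cball q (cap q n)" by (simp add: cap_def)
qed simp

lemma cap_ge_1: "1 \<le> cap q n"
  by (simp add: cap_def sum_nonneg)

lemma normalize_segment:
  assumes "v \<noteq> 0"
  shows "closed_segment ((a - q) / v) ((b - q) / v) \<inter> kite0 s r = {} \<longleftrightarrow> closed_segment a b \<inter> kite s q v r = {}"
proof -
  have "closed_segment ((a - q) / v) ((b - q) / v) = (\<lambda>x. (x - q) / v) ` closed_segment a b"
  proof -
    have "(\<lambda>x. (x - q) / v) ` closed_segment a b = (\<lambda>x. x / v) ` (\<lambda>x. - q + x) ` closed_segment a b"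
      by (simp add: image_image)
    also have "(\<lambda>x. - q + x) ` closed_segment a b = closed_segment (- q + a) (- q + b)"
      by (rule closed_segment_translation[symmetric])
    also have "(\<lambda>x. x / v) ` \<dots> = closed_segment ((- q + a) / v) ((- q + b) / v)"
      by (rule closed_segment_linear_image[symmetric]) (simp add: linear_iff add_divide_distrib scaleR_conv_of_real)
    finally show ?thesis by simp
  qed
  then show ?thesis using mem_kite[OF assms, of _ s q r] by auto
qed

lemma bound_upto:
  assumes "v \<noteq> 0" "0 < s"
  shows "\<rho> \<le> bound_upto s q v k \<longleftrightarrow> \<rho> \<le> cap q n \<and> (\<forall>i<k. closed_segment (A i) (B i) \<inter> kite s q v \<rho> = {})"
  by (induction k) (auto simp: edge_bound[OF assms(2)] normalize_segment[OF assms(1)] less_Suc_eq)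

lemma kite_frontier:
  assumes "v \<noteq> 0" "0 < s" "r \<le> bound_upto s q v n" "kite s q v r \<inter> P \<noteq> {}"
  shows "kite s q v r \<subseteq> P"
proof (rule connected_disjoint_frontier[OF connected_kite _ assms(4)])
  show "kite s q v r \<inter> frontier P = {}"
    using assms(3) frontier_P unfolding bound_upto[OF assms(1,2)] by blast
qed

text \<open>The sample point lies in the kite, hence off all edges, so parity decides whether it
  belongs to \<open>P\<close>. The kite is connected and misses the frontier, so the whole of it
  follows the sample.\<close>

lemma scale_sample:
  assumes "v \<noteq> 0" "0 < s" "0 < bound_upto s q v n"
  shows "odd (crossings_upto (q + of_real (bound_upto s q v n / 2) * v) n) \<longleftrightarrow> kite s q v (bound_upto s q v n) \<subseteq> P"
proof -
  let ?r = "bound_upto s q v n"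
  let ?z = "q + of_real (?r / 2) * v"
  have z: "?z \<in> kite s q v ?r" using kite_center[OF assms(2,3)] .
  have "\<forall>i<n. closed_segment (A i) (B i) \<inter> kite s q v ?r = {}"
    using bound_upto[OF assms(1,2), of ?r q n] by simp
  then have "?z \<in> P \<longleftrightarrow> odd (crossings_upto ?z n)"
    unfolding crossings_upto_def using z by (intro parity) blast
  then show ?thesis using kite_frontier[OF assms(1,2) order_refl, of q] z by blast
qed

lemma scale_kite:
  assumes "v \<noteq> 0" "0 < s" "0 < scale s q v"
  shows "kite s q v (scale s q v) \<subseteq> P"
  using assms scale_sample[OF assms(1,2)] by (auto simp: scale_def Let_def split: if_splits)

text \<open>An open kite within \<open>P\<close> lies in its interior, which no edge meets. Hence
  the largest edge-free kite is at least as large, so it meets \<open>P\<close> and therefore lies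
  in \<open>P\<close>. The bound by \<open>cap\<close> is there because the minimum over the edges
  starts at that value.\<close>

lemma scale_ge:
  assumes "v \<noteq> 0" "0 < s" "0 < \<rho>" "\<rho> \<le> cap q n" "kite s q v \<rho> \<subseteq> P"
  shows "\<rho> \<le> scale s q v"
proof -
  let ?r = "bound_upto s q v n"
  have "kite s q v \<rho> \<subseteq> interior P" using assms(5) open_kite[OF assms(1)] by (rule interior_maximal)
  then have r: "\<rho> \<le> ?r" unfolding bound_upto[OF assms(1,2)] using edges_P assms(4) by blast
  have "kite s q v \<rho> \<noteq> {}" using kite_center[OF assms(2,3)] by blast
  then have "kite s q v ?r \<inter> P \<noteq> {}" using kite_mono[OF assms(2) r, of q v] assms(5) by blast
  then have "kite s q v ?r \<subseteq> P" using kite_frontier[OF assms(1,2) order_refl] by blast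
  then show ?thesis using r scale_sample[OF assms(1,2), of q] assms(3) by (simp add: scale_def)
qed

text \<open>For \<open>g = q\<close> the kite degenerates, but the disk is then a single point and
  \<open>q\<close> guards itself.\<close>

definition guard_test :: "real \<Rightarrow> complex \<Rightarrow> complex \<Rightarrow> bool" where
  "guard_test \<alpha> q g \<longleftrightarrow> g = q \<or> 1 \<le> scale (3 / 4 * \<alpha>) q (g - q)"

lemma guard_test_sound:
  assumes "0 < \<alpha>" "\<alpha> \<le> 1" "q \<in> P" "guard_test \<alpha> q g"
  shows "robustly_guards_point P (\<alpha> / 2) g q"
proof (cases "g = q")
  case True
  then show ?thesis using assms by (simp add: robustly_guards_point_def sees_def)
next
  case False
  then have v: "g - q \<noteq> 0" "1 \<le> scale (3 / 4 * \<alpha>) q (g - q)" using assms by (auto simp: guard_test_def)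
  then have K: "kite (3 / 4 * \<alpha>) q (g - q) 1 \<subseteq> P"
    using scale_kite[OF v(1), of "3 / 4 * \<alpha>" q] kite_mono[of "3 / 4 * \<alpha>" 1] assms by fastforce
  have "q + of_real 1 * (g - q) \<in> kite (3 / 4 * \<alpha>) q (g - q) 1"
    unfolding kite_def using assms(1) by (intro image_eqI[of _ _ 1]) (auto simp: kite0_def)
  then have "q + (g - q) \<in> P" using K by auto
  from kite_guards[OF assms(1,2) K assms(3) this] show ?thesis by simp
qed

text \<open>The axis of the kite is at most 21 / 20 times as long as the distance to the guard, and
  \<open>3 / 4 * 21 / 20 + 1 / 20 < 1\<close> is what \<open>guard_kite\<close> asks for.\<close>

lemma guard_test_near_guard:
  assumes \<alpha>: "0 < \<alpha>" "\<alpha> \<le> 1" and g: "robustly_guards_point P \<alpha> g q"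
    and near: "dist g' g \<le> \<alpha> / 20 * dist q g"
  shows "guard_test \<alpha> q g'"
proof (cases "g' = q")
  case False
  then have v: "g' - q \<noteq> 0" by simp
  have E: "0 < dist q g"
  proof (rule ccontr)
    assume "\<not> 0 < dist q g"
    then show False using near False by simp
  qed
  have "norm (g' - q) \<le> dist g' g + dist q g" by (metis dist_commute dist_norm dist_triangle)
  also have "\<dots> \<le> 21 / 20 * dist q g"
    using near mult_right_mono[OF \<alpha>(2), of "dist q g"] by simp
  finally have "3 / 4 * \<alpha> * norm (g' - q) \<le> 3 / 4 * \<alpha> * (21 / 20 * dist q g)"
    using \<alpha> by (intro mult_left_mono) auto
  moreover have "norm (g' - q - (g - q)) \<le> \<alpha> / 20 * dist q g" using near by (simp add: dist_norm)
  moreover have "0 < \<alpha> * dist q g" using \<alpha> E by simp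
  ultimately have "3 / 4 * \<alpha> * norm (g' - q) + norm (g' - q - (g - q)) < \<alpha> * dist q g" by simp
  then have "kite (3 / 4 * \<alpha>) q (g' - q) 1 \<subseteq> P" using \<alpha> by (intro guard_kite[OF g]) auto
  then have "1 \<le> scale (3 / 4 * \<alpha>) q (g' - q)"
    using scale_ge[OF v, of "3 / 4 * \<alpha>" 1 q] \<alpha> cap_ge_1 by auto
  then show ?thesis by (simp add: guard_test_def)
qed (simp add: guard_test_def)

lemma guard_test_near_kite:
  assumes \<alpha>: "0 < \<alpha>" "\<alpha> \<le> 1" and w: "norm w = 1" and r: "0 < r" "r \<le> scale (9 / 10 * \<alpha>) q w"
    and near: "dist g' (q + of_real r * w) \<le> \<alpha> / 50 * r"
  shows "guard_test \<alpha> q g'"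
proof (cases "g' = q")
  case False
  then have v: "g' - q \<noteq> 0" by simp
  have w0: "w \<noteq> 0" using w by auto
  have "norm (g' - q - of_real r * w) \<le> \<alpha> / 50 * r" using near by (simp add: dist_norm algebra_simps)
  note kite_perturb[OF \<alpha> w r(1) this, of q]
  also have "kite (9 / 10 * \<alpha>) q w r \<subseteq> kite (9 / 10 * \<alpha>) q w (scale (9 / 10 * \<alpha>) q w)"
    using \<alpha> r by (intro kite_mono) auto
  also have "\<dots> \<subseteq> P" using scale_kite[OF w0, of "9 / 10 * \<alpha>" q] \<alpha> r by simp
  finally have "1 \<le> scale (3 / 4 * \<alpha>) q (g' - q)"
    using scale_ge[OF v, of "3 / 4 * \<alpha>" 1 q] \<alpha> cap_ge_1 by auto
  then show ?thesis by (simp add: guard_test_def)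
qed (simp add: guard_test_def)

text \<open>Here \<open>guard_kite\<close> has the margin \<open>9 / 10 + 3 / 100 < 1\<close>. The
  distance to \<open>g\<close> is below \<open>cap\<close> because \<open>g\<close> lies in
  \<open>P\<close>.\<close>

lemma scale_near_guard:
  assumes \<alpha>: "0 < \<alpha>" "\<alpha> \<le> 1" and g: "robustly_guards_point P \<alpha> g q" "g \<noteq> q"
    and w: "norm w = 1" and near: "norm (of_real (dist q g) * w - (g - q)) \<le> 3 / 100 * \<alpha> * dist q g"
  shows "dist q g \<le> scale (9 / 10 * \<alpha>) q w"
proof -
  let ?E = "dist q g"
  have E: "0 < ?E" using g(2) by simp
  have w0: "w \<noteq> 0" using w by auto
  have n: "norm (of_real ?E * w) = ?E" using w by (simp add: norm_mult)
  have "0 < \<alpha> * ?E" using \<alpha> E by simp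
  then have "9 / 10 * \<alpha> * norm (of_real ?E * w) + norm (of_real ?E * w - (g - q)) < \<alpha> * ?E"
    unfolding n using near by simp
  then have K: "kite (9 / 10 * \<alpha>) q (of_real ?E * w) 1 \<subseteq> P" using \<alpha> by (intro guard_kite[OF g(1)]) auto
  \<comment> \<open>The length of the axis moves from the scale into the direction vector.\<close>
  have "kite (9 / 10 * \<alpha>) q w ?E \<subseteq> kite (9 / 10 * \<alpha>) q (of_real ?E * w) 1"
  proof
    fix y assume "y \<in> kite (9 / 10 * \<alpha>) q w ?E"
    then obtain z where z: "z \<in> kite0 (9 / 10 * \<alpha>) ?E" "y = q + w * z" by (auto simp: kite_def)
    define u where "u = z / of_real ?E"
    have zu: "z = of_real ?E * u" using E by (simp add: u_def)
    have ri: "Re z = ?E * Re u" "Im z = ?E * Im u" unfolding zu by simp_all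
    have abs: "\<bar>Im z\<bar> = ?E * \<bar>Im u\<bar>" unfolding ri abs_mult by simp
    have "?E * \<bar>Im u\<bar> < ?E * (9 / 10 * \<alpha> * Re u)" "?E * (Re u + \<bar>Im u\<bar>) < ?E * (1 * (1 + 9 / 10 * \<alpha>))"
      using z(1) unfolding kite0_def mem_Collect_eq abs unfolding ri by (simp_all only: distrib_left mult_ac mult_1)
    then have "u \<in> kite0 (9 / 10 * \<alpha>) 1" using E unfolding kite0_def mem_Collect_eq by (simp only: mult_less_cancel_left_pos)
    moreover have "y = q + of_real ?E * w * u" using z(2) zu by simp
    ultimately show "y \<in> kite (9 / 10 * \<alpha>) q (of_real ?E * w) 1" unfolding kite_def by blast
  qed
  then have "kite (9 / 10 * \<alpha>) q w ?E \<subseteq> P" using K by blast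
  moreover have "?E \<le> cap q n"
    using P_in_cap[of q] g(1) by (auto simp: robustly_guards_point_def)
  ultimately show ?thesis using scale_ge[OF w0] \<alpha> E by simp
qed

end

section \<open>Lattice directions, lattice points and pairs of points with a common guard\<close>

subsection \<open>Directions and grids\<close>

text \<open>Lattice points of a square of half-side \<open>N\<close>, projected to the unit circle;
  a square root suffices for this. The centre would give 0 and is always left out.\<close>

definition dir :: "nat \<Rightarrow> nat \<Rightarrow> nat \<Rightarrow> complex" where
  "dir N i j = sgn (Complex (real i - real N) (real j - real N))"

text \<open>Spacing \<open>F / N\<close> on a square of half-side \<open>5 * F\<close>; the indices
  \<open>5 * N\<close> give \<open>p\<close> itself. No target in \<open>common_guard_grid\<close>
  is farther than \<open>3 * F\<close> from \<open>p\<close>.\<close>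

definition grid :: "complex \<Rightarrow> real \<Rightarrow> nat \<Rightarrow> nat \<Rightarrow> nat \<Rightarrow> complex" where
  "grid p F N i j = Complex (Re p + (real i - real (5 * N)) * F / real N) (Im p + (real j - real (5 * N)) * F / real N)"

lemma round_index:
  assumes "\<bar>x\<bar> \<le> real K"
  obtains i where "i < 2 * K + 1" "real i - real K \<le> x" "x < real i - real K + 1"
proof -
  define i where "i = nat (\<lfloor>x\<rfloor> + int K)"
  have "- int K \<le> \<lfloor>x\<rfloor>" "\<lfloor>x\<rfloor> \<le> int K" using assms by linarith+
  then have "i < 2 * K + 1" "real i = of_int \<lfloor>x\<rfloor> + real K" by (simp_all add: i_def)
  then show ?thesis by (intro that[of i]) linarith+
qed

text \<open>Rounding \<open>N * u\<close> to a lattice vector costs at most 3 / 2, and normalizing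
  at most doubles the error. For \<open>N \<ge> 2\<close> the rounded vector is not 0.\<close>

lemma dir_approx:
  assumes u: "norm u = 1" and N: "2 \<le> N"
  obtains i j where "i < 2 * N + 1" "j < 2 * N + 1" "\<not> (i = N \<and> j = N)" "norm (dir N i j - u) \<le> 3 / real N"
proof -
  have "\<bar>real N * Re u\<bar> \<le> real N" "\<bar>real N * Im u\<bar> \<le> real N"
    using abs_Re_le_cmod[of u] abs_Im_le_cmod[of u] u N by (auto simp: abs_mult)
  then obtain i j where ij: "i < 2 * N + 1" "real i - real N \<le> real N * Re u" "real N * Re u < real i - real N + 1"
    "j < 2 * N + 1" "real j - real N \<le> real N * Im u" "real N * Im u < real j - real N + 1"
    by (metis round_index)
  define w where "w = Complex (real i - real N) (real j - real N)"
  define d where "d = w - of_real (real N) * u"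
  have "\<bar>Re d\<bar> \<le> 1" "\<bar>Im d\<bar> \<le> 1" using ij by (auto simp: d_def w_def)
  then have "(norm d)\<^sup>2 \<le> 1 + 1" unfolding cmod_power2 by (intro add_mono) (auto simp: abs_square_le_1)
  also have "\<dots> \<le> (3 / 2)\<^sup>2" by (simp add: power2_eq_square)
  finally have d: "norm d \<le> 3 / 2" by (rule power2_le_imp_le) simp
  have Nu: "norm (of_real (real N) * u) = real N" using u by (simp add: norm_mult)
  have nw: "\<bar>norm w - real N\<bar> \<le> norm d"
    using norm_triangle_ineq3[of w "of_real (real N) * u"] unfolding Nu d_def .
  then have "norm w > 0" using d N by linarith
  then have w0: "w \<noteq> 0" by simp
  \<comment> \<open>The error is the rounding error \<open>d\<close> plus a correction of length,
    whose norm is at most \<open>norm d\<close> by \<open>nw\<close>.\<close>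
  have eq: "of_real (real N) * (sgn w - u) = d + (of_real (real N) - of_real (norm w)) * sgn w"
  proof -
    have "of_real (norm w) * sgn w = w" using w0 by (simp add: sgn_eq)
    then show ?thesis by (simp add: d_def algebra_simps)
  qed
  have "real N * norm (sgn w - u) = norm (of_real (real N) * (sgn w - u))" by (simp add: norm_mult)
  also have "\<dots> \<le> norm d + norm ((of_real (real N) - of_real (norm w)) * sgn w :: complex)"
    unfolding eq by (rule norm_triangle_ineq)
  also have "norm ((of_real (real N) - of_real (norm w)) * sgn w :: complex) = \<bar>norm w - real N\<bar>"
  proof -
    have "(of_real (real N) - of_real (norm w) :: complex) = of_real (real N - norm w)" by simp
    then show ?thesis using w0 by (simp only: norm_mult norm_of_real norm_sgn) (simp add: abs_minus_commute)
  qed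
  finally have "real N * norm (sgn w - u) \<le> 3" using nw d by linarith
  then have "norm (dir N i j - u) \<le> 3 / real N"
    using N unfolding dir_def w_def[symmetric] by (simp add: pos_le_divide_eq mult.commute)
  moreover have "\<not> (i = N \<and> j = N)" using w0 by (auto simp: w_def complex_eq_iff)
  ultimately show ?thesis using that ij by blast
qed

lemma norm_dir: "\<not> (i = N \<and> j = N) \<Longrightarrow> norm (dir N i j) = 1"
  by (auto simp: dir_def norm_sgn complex_eq_iff)

lemma grid_approx:
  assumes F: "0 < F" and N: "0 < N" and x: "norm (x - p) \<le> 5 * F"
  obtains i j where "i < 10 * N + 1" "j < 10 * N + 1" "dist (grid p F N i j) x \<le> 2 * F / real N"
proof -
  define \<delta> where "\<delta> = F / real N"
  have \<delta>: "0 < \<delta>" using F N by (simp add: \<delta>_def)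
  have b: "\<bar>y / \<delta>\<bar> \<le> real (5 * N)" if "\<bar>y\<bar> \<le> 5 * F" for y
    using that N F by (simp add: \<delta>_def abs_mult field_simps)
  have "\<bar>Re (x - p)\<bar> \<le> 5 * F" "\<bar>Im (x - p)\<bar> \<le> 5 * F"
    using x abs_Re_le_cmod[of "x - p"] abs_Im_le_cmod[of "x - p"] by linarith+
  note bb = this[THEN b]
  obtain i where i: "i < 2 * (5 * N) + 1" "real i - real (5 * N) \<le> Re (x - p) / \<delta>" "Re (x - p) / \<delta> < real i - real (5 * N) + 1"
    using round_index[OF bb(1)] by metis
  obtain j where j: "j < 2 * (5 * N) + 1" "real j - real (5 * N) \<le> Im (x - p) / \<delta>" "Im (x - p) / \<delta> < real j - real (5 * N) + 1"
    using round_index[OF bb(2)] by metis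
  have e: "\<bar>a * \<delta> - y\<bar> \<le> \<delta>" if "a \<le> y / \<delta>" "y / \<delta> < a + 1" for a y
    using that \<delta> by (simp add: field_simps abs_if)
  have g: "grid p F N i j - x = Complex ((real i - real (5 * N)) * \<delta> - Re (x - p)) ((real j - real (5 * N)) * \<delta> - Im (x - p))"
    by (simp add: grid_def \<delta>_def complex_eq_iff)
  have "dist (grid p F N i j) x \<le> \<delta> + \<delta>"
    unfolding dist_norm g
    by (rule order_trans[OF cmod_le add_mono]) (unfold complex.sel, rule e[OF i(2,3)], rule e[OF j(2,3)])
  then show ?thesis using that[of i j] i j by (simp add: \<delta>_def)
qed

context planar_domain
begin

text \<open>The upper bound limits how far away a guard can be. Attainment provides a kite at
  \<open>q\<close> of scale exactly \<open>F\<close>. The alternative \<open>F = 0\<close> covers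
  points without any kite.\<close>

definition reach :: "real \<Rightarrow> nat \<Rightarrow> complex \<Rightarrow> real \<Rightarrow> bool" where
  "reach \<alpha> N q F \<longleftrightarrow> 0 \<le> F \<and>
     (\<forall>i<2 * N + 1. \<forall>j<2 * N + 1. \<not> (i = N \<and> j = N) \<longrightarrow> scale (9 / 10 * \<alpha>) q (dir N i j) \<le> F) \<and>
     (F = 0 \<or> (\<exists>i j. \<not> (i = N \<and> j = N) \<and> F = scale (9 / 10 * \<alpha>) q (dir N i j)))"

lemma guard_within_reach:
  assumes \<alpha>: "0 < \<alpha>" "\<alpha> \<le> 1" and N: "100 \<le> real N * \<alpha>" and F: "reach \<alpha> N q F"
    and g: "robustly_guards_point P \<alpha> g q"
  shows "dist q g \<le> F"
proof (cases "g = q")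
  case True
  then show ?thesis using F by (simp add: reach_def)
next
  case False
  let ?E = "dist q g"
  have "real N * \<alpha> \<le> real N * 1" using \<alpha> by (intro mult_left_mono) auto
  then have N2: "2 \<le> N" using N by linarith
  \<comment> \<open>The resolution turns the rounding error of \<open>dir_approx\<close> into the
    tolerance of \<open>scale_near_guard\<close>.\<close>
  have n3: "3 / real N \<le> 3 / 100 * \<alpha>" using N N2 by (simp add: field_simps)
  have E: "0 < ?E" "norm (g - q) = ?E" using False by (auto simp: dist_norm norm_minus_commute)
  define u where "u = sgn (g - q)"
  have u: "norm u = 1" "of_real ?E * u = g - q"
  proof -
    show "norm u = 1" using False by (simp add: u_def norm_sgn)
    show "of_real ?E * u = g - q" using False E(2) by (simp add: u_def sgn_eq)
  qed
  obtain i j where ij: "i < 2 * N + 1" "j < 2 * N + 1" "\<not> (i = N \<and> j = N)" "norm (dir N i j - u) \<le> 3 / real N"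
    using dir_approx[OF u(1) N2] .
  have "norm (of_real ?E * dir N i j - (g - q)) = ?E * norm (dir N i j - u)"
    unfolding u(2)[symmetric] right_diff_distrib[symmetric] by (simp add: norm_mult)
  also have "\<dots> \<le> ?E * (3 / 100 * \<alpha>)" using ij(4) n3 by (intro mult_left_mono) auto
  finally have "norm (of_real ?E * dir N i j - (g - q)) \<le> 3 / 100 * \<alpha> * ?E" by (simp add: mult_ac)
  from scale_near_guard[OF \<alpha> g False norm_dir[OF ij(3)] this]
  have "?E \<le> scale (9 / 10 * \<alpha>) q (dir N i j)" .
  moreover have "scale (9 / 10 * \<alpha>) q (dir N i j) \<le> F" using F ij(1-3) unfolding reach_def by blast
  ultimately show ?thesis by linarith
qed

text \<open>If \<open>q\<close> is far from \<open>p\<close>, then a grid point close to the common guard will do; otherwise the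
  grid around \<open>p\<close> hits the kite at \<open>q\<close>, which is at least as large as the one at \<open>p\<close>.\<close>

lemma common_guard_grid:
  assumes \<alpha>: "0 < \<alpha>" "\<alpha> \<le> 1" and N: "100 \<le> real N * \<alpha>"
    and Fp: "reach \<alpha> N p F" and Fq: "reach \<alpha> N q F'" and le: "F \<le> F'"
    and gp: "robustly_guards_point P \<alpha> g p" and gq: "robustly_guards_point P \<alpha> g q"
  shows "\<exists>i<10 * N + 1. \<exists>j<10 * N + 1. guard_test \<alpha> q (grid p F N i j)"
proof (cases "F = 0")
  case True
  \<comment> \<open>With \<open>F = 0\<close> all grid points coincide with \<open>p\<close>, which
    is then the common guard.\<close>
  then have "g = p" using guard_within_reach[OF \<alpha> N Fp gp] by simp
  then have "dist (grid p F N 0 0) g \<le> \<alpha> / 20 * dist q g" using True \<alpha> by (simp add: grid_def)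
  from guard_test_near_guard[OF \<alpha> gq this] show ?thesis by auto
next
  case False
  then have F: "0 < F" using Fp by (simp add: reach_def)
  have N0: "0 < N" using N by (cases N) auto
  have small: "2 * F / real N \<le> \<alpha> / 50 * F" using N N0 F by (simp add: field_simps)
  have pg: "dist p g \<le> F" by (rule guard_within_reach[OF \<alpha> N Fp gp])
  show ?thesis
  proof (cases "F \<le> dist q g")
    case True
    have "norm (g - p) \<le> 5 * F" using pg F by (simp add: dist_norm norm_minus_commute)
    then obtain i j where ij: "i < 10 * N + 1" "j < 10 * N + 1" "dist (grid p F N i j) g \<le> 2 * F / real N"
      using grid_approx[OF F N0] by metis
    have "\<alpha> / 50 * F \<le> \<alpha> / 20 * dist q g" using True \<alpha> F by (intro mult_mono) auto
    then have "dist (grid p F N i j) g \<le> \<alpha> / 20 * dist q g" using ij small by linarith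
    from guard_test_near_guard[OF \<alpha> gq this] ij show ?thesis by blast
  next
    case False
    \<comment> \<open>Since \<open>F'\<close> is positive, it is the scale of a kite at
      \<open>q\<close>. Its axis passes through \<open>?h\<close> at distance
      \<open>F \<le> F'\<close>. The way from \<open>p\<close> over \<open>g\<close> and
      \<open>q\<close> to \<open>?h\<close> has three legs of length at most \<open>F\<close>, so
      \<open>?h\<close> is in the range of the grid.\<close>
    obtain k l where kl: "\<not> (k = N \<and> l = N)" "F' = scale (9 / 10 * \<alpha>) q (dir N k l)"
      using Fq F le by (auto simp: reach_def)
    let ?h = "q + of_real F * dir N k l"
    have "norm (?h - p) \<le> dist p g + dist q g + norm (of_real F * dir N k l)"
    proof -
      have tri: "norm (a + b + c) \<le> norm a + norm b + norm c" for a b c :: complex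
        by (meson add_right_mono norm_triangle_ineq order_trans)
      have "?h - p = (g - p) + (q - g) + of_real F * dir N k l" by simp
      then have "norm (?h - p) \<le> norm (g - p) + norm (q - g) + norm (of_real F * dir N k l)"
        using tri by metis
      then show ?thesis by (simp add: dist_norm norm_minus_commute)
    qed
    also have "\<dots> \<le> 5 * F" using pg False F norm_dir[OF kl(1)] by (simp add: norm_mult)
    finally obtain i j where ij: "i < 10 * N + 1" "j < 10 * N + 1" "dist (grid p F N i j) ?h \<le> 2 * F / real N"
      using grid_approx[OF F N0] by metis
    have "dist (grid p F N i j) ?h \<le> \<alpha> / 50 * F" using ij small by linarith
    from guard_test_near_kite[OF \<alpha> norm_dir[OF kl(1)] F _ this] le kl(2) ij show ?thesis by blast
  qed
qed

end

section \<open>A loop language with functional semantics and polynomial time bounds\<close>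

subsection \<open>Programs with bounded loops\<close>

text \<open>In \<open>FFor x y c\<close> the counter \<open>x\<close> runs from 0 to the value of \<open>y\<close>, which \<open>c\<close> must not change.
  Such programs have a functional semantics and a syntactic time bound.\<close>

datatype fcom =
    FSkip
  | FNSet string nexp nexp
  | FRSet string nexp rexp
  | FSeq fcom fcom  (infixr \<open>;;;\<close> 60)
  | FCond bexp fcom fcom
  | FFor string string fcom

abbreviation N0 :: "string \<Rightarrow> nexp" where "N0 x \<equiv> NGet x (NConst 0)"
abbreviation R0 :: "string \<Rightarrow> rexp" where "R0 x \<equiv> RGet x (NConst 0)"
abbreviation setn :: "string \<Rightarrow> nexp \<Rightarrow> fcom" where "setn x \<equiv> FNSet x (NConst 0)"
abbreviation setr :: "string \<Rightarrow> rexp \<Rightarrow> fcom" where "setr x \<equiv> FRSet x (NConst 0)"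

fun compile :: "fcom \<Rightarrow> com" where
  "compile FSkip = Skip"
| "compile (FNSet x i e) = NSet x i e"
| "compile (FRSet x i e) = RSet x i e"
| "compile (c1 ;;; c2) = Seq (compile c1) (compile c2)"
| "compile (FCond b c1 c2) = Cond b (compile c1) (compile c2)"
| "compile (FFor x y c) = Seq (NSet x (NConst 0) (NConst 0))
     (While (NLess (N0 x) (N0 y)) (Seq (compile c) (NSet x (NConst 0) (NAdd (N0 x) (NConst 1)))))"

fun run :: "fcom \<Rightarrow> state \<Rightarrow> state" where
  "run FSkip s = s"
| "run (FNSet x i e) s = nupd x (nval i s) (nval e s) s"
| "run (FRSet x i e) s = rupd x (nval i s) (rval e s) s"
| "run (c1 ;;; c2) s = run c2 (run c1 s)"
| "run (FCond b c1 c2) s = (if bval b s then run c1 s else run c2 s)"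
| "run (FFor x y c) s = ((\<lambda>s. nupd x 0 (Suc (nmem s x 0)) (run c s)) ^^ nmem s y 0) (nupd x 0 0 s)"

fun nmod :: "fcom \<Rightarrow> string set" where
  "nmod FSkip = {}"
| "nmod (FNSet x i e) = {x}"
| "nmod (FRSet x i e) = {}"
| "nmod (c1 ;;; c2) = nmod c1 \<union> nmod c2"
| "nmod (FCond b c1 c2) = nmod c1 \<union> nmod c2"
| "nmod (FFor x y c) = insert x (nmod c)"

fun rmod :: "fcom \<Rightarrow> string set" where
  "rmod FSkip = {}"
| "rmod (FNSet x i e) = {}"
| "rmod (FRSet x i e) = {x}"
| "rmod (c1 ;;; c2) = rmod c1 \<union> rmod c2"
| "rmod (FCond b c1 c2) = rmod c1 \<union> rmod c2"
| "rmod (FFor x y c) = rmod c"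

fun bounds :: "fcom \<Rightarrow> string set" where
  "bounds (c1 ;;; c2) = bounds c1 \<union> bounds c2"
| "bounds (FCond b c1 c2) = bounds c1 \<union> bounds c2"
| "bounds (FFor x y c) = insert y (bounds c)"
| "bounds _ = {}"

fun counters_ok :: "fcom \<Rightarrow> bool" where
  "counters_ok (c1 ;;; c2) = (counters_ok c1 \<and> counters_ok c2)"
| "counters_ok (FCond b c1 c2) = (counters_ok c1 \<and> counters_ok c2)"
| "counters_ok (FFor x y c) = (x \<noteq> y \<and> x \<notin> nmod c \<and> counters_ok c)"
| "counters_ok _ = True"

text \<open>\<open>M\<close> bounds the iterations of every loop. An iteration pays for its test and
  its increment; the initial assignment and the last, failing test make up the 2. Both branches of a
  conditional are added instead of maximized, which keeps the bound a sum.\<close>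

fun cost :: "nat \<Rightarrow> fcom \<Rightarrow> nat" where
  "cost M (c1 ;;; c2) = cost M c1 + cost M c2"
| "cost M (FCond b c1 c2) = 1 + cost M c1 + cost M c2"
| "cost M (FFor x y c) = 2 + M * (cost M c + 2)"
| "cost M _ = 1"

lemma nmem_upd [simp]:
  "nmem (rupd x i r s) = nmem s" "rmem (nupd x i k s) = rmem s"
  "nmem (nupd x i k s) y j = (if x = y \<and> i = j then k else nmem s y j)"
  "rmem (rupd x i r s) y j = (if x = y \<and> i = j then r else rmem s y j)"
  "x \<noteq> y \<Longrightarrow> nmem (nupd x i k s) y = nmem s y"
  "x \<noteq> y \<Longrightarrow> rmem (rupd x i r s) y = rmem s y"
  "y \<noteq> x \<Longrightarrow> nmem (nupd x i k s) y = nmem s y"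
  "y \<noteq> x \<Longrightarrow> rmem (rupd x i r s) y = rmem s y"
  by (simp_all add: nupd_def rupd_def)

lemma run_frame:
  "x \<notin> nmod c \<Longrightarrow> nmem (run c s) x = nmem s x"
  "x \<notin> rmod c \<Longrightarrow> rmem (run c s) x = rmem s x"
proof (induction c arbitrary: s)
  case (FFor z y c)
  have "nmem (((\<lambda>s. nupd z 0 (Suc (nmem s z 0)) (run c s)) ^^ k) s) x = nmem s x" if "x \<notin> nmod (FFor z y c)" for k s
    using that FFor.IH(1) by (induction k) auto
  moreover have "rmem (((\<lambda>s. nupd z 0 (Suc (nmem s z 0)) (run c s)) ^^ k) s) x = rmem s x" if "x \<notin> rmod c" for k s
    using that FFor.IH(2) by (induction k) auto
  ultimately have "(x \<notin> nmod (FFor z y c) \<longrightarrow> nmem (run (FFor z y c) s) x = nmem s x) \<and>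
    (x \<notin> rmod (FFor z y c) \<longrightarrow> rmem (run (FFor z y c) s) x = rmem s x)" for s by auto
  then show "x \<notin> nmod (FFor z y c) \<Longrightarrow> nmem (run (FFor z y c) s) x = nmem s x"
    "x \<notin> rmod (FFor z y c) \<Longrightarrow> rmem (run (FFor z y c) s) x = rmem s x" for s by blast+
qed auto

text \<open>No loop bound is ever assigned, so all keep their initial values and a single
  \<open>M\<close> controls every loop, however deeply nested. A program that computes some of its
  bounds must therefore be cut into phases.\<close>

lemma compile_exec:
  assumes "counters_ok c" "bounds c \<inter> nmod c = {}" "\<And>y. y \<in> bounds c \<Longrightarrow> nmem s y 0 \<le> M"
  shows "\<exists>t\<le>cost M c. exec (compile c) s t (run c s)"
  using assms
proof (induction c arbitrary: s)
  case (FSeq c1 c2)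
  obtain t1 where t1: "t1 \<le> cost M c1" "exec (compile c1) s t1 (run c1 s)"
    using FSeq.IH(1)[of s] FSeq.prems by auto
  have "nmem (run c1 s) y 0 \<le> M" if "y \<in> bounds c2" for y
  proof -
    have "y \<notin> nmod c1" "nmem s y 0 \<le> M" using that FSeq.prems by auto
    then show ?thesis using run_frame(1)[of y c1 s] by simp
  qed
  then obtain t2 where t2: "t2 \<le> cost M c2" "exec (compile c2) (run c1 s) t2 (run c2 (run c1 s))"
    using FSeq.IH(2)[of "run c1 s"] FSeq.prems by auto
  show ?case using exec.Seq[OF t1(2) t2(2)] t1(1) t2(1) by (auto intro!: exI[of _ "t1 + t2"])
next
  case (FCond b c1 c2)
  show ?case
  proof (cases "bval b s")
    case True
    obtain t1 where t1: "t1 \<le> cost M c1" "exec (compile c1) s t1 (run c1 s)"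
      using FCond.IH(1)[of s] FCond.prems by auto
    show ?thesis using exec.CondTrue[OF True t1(2)] t1(1) True by (auto intro!: exI[of _ "1 + t1"])
  next
    case False
    obtain t1 where t1: "t1 \<le> cost M c2" "exec (compile c2) s t1 (run c2 s)"
      using FCond.IH(2)[of s] FCond.prems by auto
    show ?thesis using exec.CondFalse[OF False t1(2)] t1(1) False by (auto intro!: exI[of _ "1 + t1"])
  qed
next
  case (FFor x y c)
  let ?f = "\<lambda>s. nupd x 0 (Suc (nmem s x 0)) (run c s)"
  let ?B = "Seq (compile c) (NSet x (NConst 0) (NAdd (N0 x) (NConst 1)))"
  have xy: "x \<noteq> y" "x \<notin> nmod c" "y \<notin> nmod c" and y: "nmem s y 0 \<le> M" using FFor.prems by auto
  \<comment> \<open>Here \<open>k\<close> counts the iterations still to come.\<close>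
  have loop: "\<exists>t\<le>k * (cost M c + 2) + 1. exec (While (NLess (N0 x) (N0 y)) ?B) s' t ((?f ^^ k) s')"
    if "nmem s' y = nmem s y" "nmem s' x 0 + k = nmem s y 0" "\<And>z. z \<in> bounds c \<Longrightarrow> nmem s' z 0 \<le> M" for k s'
    using that
  proof (induction k arbitrary: s')
    case 0
    then show ?case using exec.WhileFalse[of "NLess (N0 x) (N0 y)" s'] by (auto intro!: exI[of _ 1])
  next
    case (Suc k)
    obtain t1 where t1: "t1 \<le> cost M c" "exec (compile c) s' t1 (run c s')"
      using FFor.IH[of s'] FFor.prems Suc.prems by auto
    have fx: "nmem (run c s') x = nmem s' x" using run_frame(1)[OF xy(2)] .
    have B: "exec ?B s' (t1 + 1) (?f s')"
      using exec.Seq[OF t1(2) exec.NSet[of x "NConst 0" "NAdd (N0 x) (NConst 1)" "run c s'"]] fx by simp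
    have "nmem (?f s') z 0 \<le> M" if "z \<in> bounds c" for z
    proof -
      have "z \<notin> nmod c" "z \<noteq> x" "nmem s' z 0 \<le> M" using that Suc.prems(3)[of z] FFor.prems(2) by auto
      then show ?thesis using run_frame(1)[of z c s'] by simp
    qed
    then obtain t2 where t2: "t2 \<le> k * (cost M c + 2) + 1"
      "exec (While (NLess (N0 x) (N0 y)) ?B) (?f s') t2 ((?f ^^ k) (?f s'))"
      using Suc.IH[of "?f s'"] Suc.prems fx xy run_frame(1)[OF xy(3), of s'] by auto
    have "bval (NLess (N0 x) (N0 y)) s'" using Suc.prems by simp
    from exec.WhileTrue[OF this B t2(2)]
    have "exec (While (NLess (N0 x) (N0 y)) ?B) s' (1 + (t1 + 1) + t2) ((?f ^^ Suc k) s')"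
      by (simp only: funpow_Suc_right o_apply)
    moreover have "1 + (t1 + 1) + t2 \<le> Suc k * (cost M c + 2) + 1" using t1(1) t2(1) by simp
    ultimately show ?case by blast
  qed
  let ?s = "nupd x 0 0 s"
  have "nmem ?s z 0 \<le> M" if "z \<in> bounds c" for z using that FFor.prems by auto
  then obtain t where t: "t \<le> nmem s y 0 * (cost M c + 2) + 1"
    "exec (While (NLess (N0 x) (N0 y)) ?B) ?s t ((?f ^^ nmem s y 0) ?s)"
    using loop[of ?s "nmem s y 0"] xy by auto
  have "exec (compile (FFor x y c)) s (1 + t) (run (FFor x y c) s)"
    using exec.Seq[OF exec.NSet[of x "NConst 0" "NConst 0" s]] t(2) by simp
  moreover have "nmem s y 0 * (cost M c + 2) \<le> M * (cost M c + 2)" using y by (rule mult_right_mono) simp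
  then have "1 + t \<le> cost M (FFor x y c)" using t(1) by simp
  ultimately show ?case by blast
qed (auto intro!: exI[of _ 1] exec.Skip exec.NSet[unfolded One_nat_def] exec.RSet[unfolded One_nat_def] exec.Skip[unfolded One_nat_def])

text \<open>For a fixed program the cost is built from constants by sums and by factors
  \<open>M\<close>. The premise \<open>M \<ge> 1\<close> allows degrees to be raised to a common
  value.\<close>

lemma cost_polynomial: "\<exists>a d. \<forall>M\<ge>1. cost M c \<le> a * M ^ d"
proof -
  have add: "\<exists>a d. \<forall>M\<ge>1. f M + g M \<le> a * M ^ d"
    if fg: "\<exists>a d. \<forall>M\<ge>1. f M \<le> a * M ^ d" "\<exists>a d. \<forall>M\<ge>1. g M \<le> a * M ^ d" for f g :: "nat \<Rightarrow> nat"
  proof -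
    obtain a d a' d' where "\<forall>M\<ge>1. f M \<le> a * M ^ d" "\<forall>M\<ge>1. g M \<le> a' * M ^ d'" using fg by blast
    moreover have "(a::nat) * M ^ d \<le> a * M ^ (d + d')" "a' * M ^ d' \<le> a' * M ^ (d + d')" if "1 \<le> M" for M
      using that by (auto intro!: mult_left_mono power_increasing)
    ultimately have "\<forall>M\<ge>1. f M + g M \<le> (a + a') * M ^ (d + d')"
      unfolding distrib_right by (meson add_mono order_trans)
    then show ?thesis by blast
  qed
  have const: "\<exists>a d. \<forall>M\<ge>1. (k::nat) \<le> a * M ^ d" for k
    by (rule exI[of _ k], rule exI[of _ 0]) simp
  show ?thesis
  proof (induction c)
    case (FFor x y c)
    obtain a d where "\<forall>M\<ge>1. cost M c + 2 \<le> a * M ^ d" using add[OF FFor const] by blast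
    then have "\<forall>M\<ge>1. M * (cost M c + 2) \<le> a * M ^ Suc d"
      by (metis mult.left_commute mult_le_mono2 power_Suc)
    then have "\<exists>a d. \<forall>M\<ge>1. M * (cost M c + 2) \<le> a * M ^ d" by blast
    from add[OF const[of 2] this] show ?case by simp
  next
    case (FCond b c1 c2)
    from add[OF add[OF const[of 1] FCond(1)] FCond(2)] show ?case by simp
  next
    case (FSeq c1 c2)
    from add[OF FSeq] show ?case by simp
  qed (use const[of 1] in auto)
qed

text \<open>The invariant rule. Its step may also use the value of the counter and the initial
  contents of everything the loop does not modify, so that invariants mention only what
  changes.\<close>

lemma run_For:
  assumes ok: "counters_ok (FFor x y c)" and init: "I 0 (nupd x 0 0 s)"
    and step: "\<And>k s'. \<lbrakk>k < nmem s y 0; nmem s' x 0 = k; I k s';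
        \<And>z. z \<notin> nmod (FFor x y c) \<Longrightarrow> nmem s' z = nmem s z; \<And>z. z \<notin> rmod c \<Longrightarrow> rmem s' z = rmem s z\<rbrakk>
      \<Longrightarrow> I (Suc k) (nupd x 0 (Suc k) (run c s'))"
  shows "I (nmem s y 0) (run (FFor x y c) s)"
proof -
  let ?f = "\<lambda>s. nupd x 0 (Suc (nmem s x 0)) (run c s)"
  have "nmem ((?f ^^ k) (nupd x 0 0 s)) x 0 = k \<and> I k ((?f ^^ k) (nupd x 0 0 s)) \<and>
      (\<forall>z. z \<notin> nmod (FFor x y c) \<longrightarrow> nmem ((?f ^^ k) (nupd x 0 0 s)) z = nmem s z) \<and>
      (\<forall>z. z \<notin> rmod c \<longrightarrow> rmem ((?f ^^ k) (nupd x 0 0 s)) z = rmem s z)" if "k \<le> nmem s y 0" for k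
    using that
  proof (induction k)
    case 0
    then show ?case using init by auto
  next
    case (Suc k)
    let ?s = "(?f ^^ k) (nupd x 0 0 s)"
    have IH: "nmem ?s x 0 = k" "I k ?s" "\<And>z. z \<notin> nmod (FFor x y c) \<Longrightarrow> nmem ?s z = nmem s z"
      "\<And>z. z \<notin> rmod c \<Longrightarrow> rmem ?s z = rmem s z" using Suc by auto
    have "(?f ^^ Suc k) (nupd x 0 0 s) = nupd x 0 (Suc k) (run c ?s)" using IH(1) by simp
    moreover have "I (Suc k) (nupd x 0 (Suc k) (run c ?s))"
      by (rule step) (use IH Suc.prems in auto)
    ultimately show ?case using IH run_frame[of _ c ?s] by auto
  qed
  then show ?thesis by auto
qed

section \<open>The program for the scale of a kite\<close>

subsection \<open>Computing scales\<close>

text \<open>Real expressions have no conditionals, so the absolute value is a root of a square, and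
  minimum and maximum are derived from it.\<close>

definition rabs :: "rexp \<Rightarrow> rexp" where "rabs e = RSqrt (RMul e e)"
definition rmin :: "rexp \<Rightarrow> rexp \<Rightarrow> rexp" where
  "rmin e f = RDiv (RSub (RAdd e f) (rabs (RSub e f))) (RNat (NConst 2))"
definition rmax :: "rexp \<Rightarrow> rexp \<Rightarrow> rexp" where
  "rmax e f = RDiv (RAdd (RAdd e f) (rabs (RSub e f))) (RNat (NConst 2))"

abbreviation RZero :: rexp where "RZero \<equiv> RNat (NConst 0)"

lemma rval_minmax [simp]:
  "rval (rabs e) s = \<bar>rval e s\<bar>"
  "rval (rmin e f) s = min (rval e s) (rval f s)"
  "rval (rmax e f) s = max (rval e s) (rval f s)"
  by (auto simp: rabs_def rmin_def rmax_def)

definition clip_prog :: fcom where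
  "clip_prog =
     FCond (BAnd (RLess (R0 ''l0'') RZero) (RLess RZero (R0 ''l1'')))
       (setr ''lo'' (rmax (R0 ''lo'') (RDiv (R0 ''l0'') (RSub (R0 ''l0'') (R0 ''l1''))))) FSkip ;;;
     FCond (BAnd (BNot (RLess RZero (R0 ''l0''))) (BNot (RLess RZero (R0 ''l1''))))
       (setr ''hi'' RZero)
       (FCond (RLess (R0 ''l1'') RZero)
         (setr ''hi'' (rmin (R0 ''hi'') (RDiv (R0 ''l0'') (RSub (R0 ''l0'') (R0 ''l1''))))) FSkip)"

lemma run_clip:
  "nmem (run clip_prog s) = nmem s"
  "rmem (run clip_prog s) ''lo'' 0 = clip_lo (rmem s ''l0'' 0) (rmem s ''l1'' 0) (rmem s ''lo'' 0)"
  "rmem (run clip_prog s) ''hi'' 0 = clip_hi (rmem s ''l0'' 0) (rmem s ''l1'' 0) (rmem s ''hi'' 0)"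
  "x \<noteq> ''lo'' \<Longrightarrow> x \<noteq> ''hi'' \<Longrightarrow> rmem (run clip_prog s) x = rmem s x"
  by (auto simp: clip_prog_def clip_lo_def clip_hi_def)

definition rgauge :: "rexp \<Rightarrow> rexp" where
  "rgauge t = RAdd (RAdd (R0 ''x0'') (RMul t (RSub (R0 ''x1'') (R0 ''x0''))))
     (rabs (RAdd (R0 ''y0'') (RMul t (RSub (R0 ''y1'') (R0 ''y0'')))))"

lemma rval_rgauge [simp]:
  "rval (rgauge t) s = gauge (rmem s ''x0'' 0) (rmem s ''y0'' 0) (rmem s ''x1'' 0) (rmem s ''y1'' 0) (rval t s)"
  by (simp add: rgauge_def gauge_def)

abbreviation ex :: rexp where "ex \<equiv> RGet ''px'' (N0 ''e'')"
abbreviation ey :: rexp where "ey \<equiv> RGet ''py'' (N0 ''e'')"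
abbreviation ex' :: rexp where "ex' \<equiv> RGet ''px'' (NGet ''nx'' (N0 ''e''))"
abbreviation ey' :: rexp where "ey' \<equiv> RGet ''py'' (NGet ''nx'' (N0 ''e''))"

text \<open>With \<open>im_quot\<close>, the coordinates of the complex quotient
  \<open>(z - q) / v\<close>, which takes the apex to 0 and the axis to the positive real
  axis.\<close>

definition re_quot :: "rexp \<Rightarrow> rexp \<Rightarrow> rexp" where
  "re_quot x y = RDiv (RAdd (RMul (RSub x (R0 ''qx'')) (R0 ''vx'')) (RMul (RSub y (R0 ''qy'')) (R0 ''vy'')))
     (RAdd (RMul (R0 ''vx'') (R0 ''vx'')) (RMul (R0 ''vy'') (R0 ''vy'')))"

definition im_quot :: "rexp \<Rightarrow> rexp \<Rightarrow> rexp" where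
  "im_quot x y = RDiv (RSub (RMul (RSub y (R0 ''qy'')) (R0 ''vx'')) (RMul (RSub x (R0 ''qx'')) (R0 ''vy'')))
     (RAdd (RMul (R0 ''vx'') (R0 ''vx'')) (RMul (R0 ''vy'') (R0 ''vy'')))"

definition cell :: "state \<Rightarrow> string \<Rightarrow> string \<Rightarrow> nat \<Rightarrow> complex" where
  "cell s x y i = Complex (rmem s x i) (rmem s y i)"

lemma cell_sel [simp]: "Re (cell s x y i) = rmem s x i" "Im (cell s x y i) = rmem s y i"
  by (simp_all add: cell_def)

lemma rval_quot [simp]:
  "rval (re_quot x y) s = Re ((Complex (rval x s) (rval y s) - cell s ''qx'' ''qy'' 0) / cell s ''vx'' ''vy'' 0)"
  "rval (im_quot x y) s = Im ((Complex (rval x s) (rval y s) - cell s ''qx'' ''qy'' 0) / cell s ''vx'' ''vy'' 0)"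
  by (simp_all add: re_quot_def im_quot_def Re_divide Im_divide power2_eq_square)

definition edge_clip :: fcom where
  "edge_clip =
     setr ''lo'' RZero ;;; setr ''hi'' (RNat (NConst 1)) ;;;
     setr ''l0'' (RSub (RMul (R0 ''s'') (R0 ''x0'')) (R0 ''y0'')) ;;;
     setr ''l1'' (RSub (RMul (R0 ''s'') (R0 ''x1'')) (R0 ''y1'')) ;;;
     clip_prog ;;;
     setr ''l0'' (RAdd (RMul (R0 ''s'') (R0 ''x0'')) (R0 ''y0'')) ;;;
     setr ''l1'' (RAdd (RMul (R0 ''s'') (R0 ''x1'')) (R0 ''y1'')) ;;;
     clip_prog"

definition edge_min :: fcom where
  "edge_min =
     setr ''tc'' (rmax (R0 ''lo'') (rmin (R0 ''hi'') (RDiv (R0 ''y0'') (RSub (R0 ''y0'') (R0 ''y1''))))) ;;;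
     FCond (RLess (R0 ''lo'') (R0 ''hi''))
       (setr ''r'' (rmin (R0 ''r'') (RDiv
          (rmin (rgauge (R0 ''lo'')) (rmin (rgauge (R0 ''hi'')) (rgauge (R0 ''tc''))))
          (RAdd (RNat (NConst 1)) (R0 ''s''))))) FSkip"

definition edge_prog :: fcom where
  "edge_prog =
     setr ''x0'' (re_quot ex ey) ;;; setr ''y0'' (im_quot ex ey) ;;;
     setr ''x1'' (re_quot ex' ey') ;;; setr ''y1'' (im_quot ex' ey') ;;;
     edge_clip ;;; edge_min"

lemma run_edge_clip:
  "rmem (run edge_clip s) ''lo'' 0 =
     clip_lo (rmem s ''s'' 0 * rmem s ''x0'' 0 + rmem s ''y0'' 0) (rmem s ''s'' 0 * rmem s ''x1'' 0 + rmem s ''y1'' 0)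
       (clip_lo (rmem s ''s'' 0 * rmem s ''x0'' 0 - rmem s ''y0'' 0) (rmem s ''s'' 0 * rmem s ''x1'' 0 - rmem s ''y1'' 0) 0)"
  "rmem (run edge_clip s) ''hi'' 0 =
     clip_hi (rmem s ''s'' 0 * rmem s ''x0'' 0 + rmem s ''y0'' 0) (rmem s ''s'' 0 * rmem s ''x1'' 0 + rmem s ''y1'' 0)
       (clip_hi (rmem s ''s'' 0 * rmem s ''x0'' 0 - rmem s ''y0'' 0) (rmem s ''s'' 0 * rmem s ''x1'' 0 - rmem s ''y1'' 0) 1)"
  by (simp_all add: edge_clip_def run_clip)

lemma edge_clip_mod:
  "nmod edge_clip = {}" "rmod edge_clip = {''lo'', ''hi'', ''l0'', ''l1''}"
  by (auto simp: edge_clip_def clip_prog_def)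

lemma run_edge_min:
  "rmem (run edge_min s) ''r'' 0 =
     (let x0 = rmem s ''x0'' 0; y0 = rmem s ''y0'' 0; x1 = rmem s ''x1'' 0; y1 = rmem s ''y1'' 0;
          lo = rmem s ''lo'' 0; hi = rmem s ''hi'' 0
      in if lo < hi then min (rmem s ''r'' 0) (min (gauge x0 y0 x1 y1 lo) (min (gauge x0 y0 x1 y1 hi)
           (gauge x0 y0 x1 y1 (max lo (min hi (y0 / (y0 - y1)))))) / (1 + rmem s ''s'' 0)) else rmem s ''r'' 0)"
proof -
  define c where "c = max (rmem s ''lo'' 0) (min (rmem s ''hi'' 0) (rmem s ''y0'' 0 / (rmem s ''y0'' 0 - rmem s ''y1'' 0)))"
  define s' where "s' = rupd ''tc'' 0 c s"
  have s': "rmem s' ''lo'' 0 = rmem s ''lo'' 0" "rmem s' ''hi'' 0 = rmem s ''hi'' 0" "rmem s' ''s'' 0 = rmem s ''s'' 0"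
    "rmem s' ''r'' 0 = rmem s ''r'' 0" "rmem s' ''tc'' 0 = c" "rmem s' ''x0'' 0 = rmem s ''x0'' 0"
    "rmem s' ''y0'' 0 = rmem s ''y0'' 0" "rmem s' ''x1'' 0 = rmem s ''x1'' 0" "rmem s' ''y1'' 0 = rmem s ''y1'' 0"
    by (simp_all add: s'_def)
  have "run (setr ''tc'' (rmax (R0 ''lo'') (rmin (R0 ''hi'') (RDiv (R0 ''y0'') (RSub (R0 ''y0'') (R0 ''y1'')))))) s = s'"
    by (simp add: s'_def c_def)
  then show ?thesis
    unfolding edge_min_def Let_def c_def[symmetric]
    by (simp only: run.simps bval.simps rval.simps nval.simps rval_minmax rval_rgauge s' nmem_upd
        if_distrib[of "\<lambda>t. rmem t ''r'' 0"] of_nat_1 conj_absorb simp_thms if_True)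
qed

lemma run_edge:
  "rmem (run edge_prog s) ''r'' 0 = edge_bound (rmem s ''s'' 0)
     ((cell s ''px'' ''py'' (nmem s ''e'' 0) - cell s ''qx'' ''qy'' 0) / cell s ''vx'' ''vy'' 0)
     ((cell s ''px'' ''py'' (nmem s ''nx'' (nmem s ''e'' 0)) - cell s ''qx'' ''qy'' 0) / cell s ''vx'' ''vy'' 0)
     (rmem s ''r'' 0)" (is "_ = edge_bound _ ?a ?b _")
proof -
  let ?s = "rupd ''y1'' 0 (Im ?b) (rupd ''x1'' 0 (Re ?b) (rupd ''y0'' 0 (Im ?a) (rupd ''x0'' 0 (Re ?a) s)))"
  have cells: "cell (rupd x i r s') y z j = cell s' y z j" if "x \<noteq> y" "x \<noteq> z" for x y z i j r s'
    using that by (simp add: cell_def)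
  have "run edge_prog s = run edge_min (run edge_clip ?s)"
    by (simp add: edge_prog_def cells cell_def[symmetric])
  moreover have fr: "rmem (run edge_clip ?s) x = rmem ?s x" if "x \<notin> {''lo'', ''hi'', ''l0'', ''l1''}" for x
    by (rule run_frame(2)) (unfold edge_clip_mod, rule that)
  moreover have "rmem (run edge_clip ?s) ''x0'' 0 = Re ?a" "rmem (run edge_clip ?s) ''y0'' 0 = Im ?a"
    "rmem (run edge_clip ?s) ''x1'' 0 = Re ?b" "rmem (run edge_clip ?s) ''y1'' 0 = Im ?b"
    "rmem (run edge_clip ?s) ''r'' 0 = rmem s ''r'' 0" "rmem (run edge_clip ?s) ''s'' 0 = rmem s ''s'' 0"
    "rmem ?s ''s'' 0 = rmem s ''s'' 0" "rmem ?s ''x0'' 0 = Re ?a" "rmem ?s ''y0'' 0 = Im ?a"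
    "rmem ?s ''x1'' 0 = Re ?b" "rmem ?s ''y1'' 0 = Im ?b"
    by (simp_all add: fr)
  ultimately show ?thesis
    unfolding edge_bound_def by (simp only: run_edge_min run_edge_clip Let_def)
qed

text \<open>The exclusive disjunction in \<open>crosses\<close> is spelled out as neither both end
  points to the right nor both not to the right. The parity is a bit flipped by
  \<open>1 - par\<close>.\<close>

definition cross_prog :: fcom where
  "cross_prog =
     FCond (BAnd (BAnd (BNot (BAnd (RLess (R0 ''zx'') ex) (RLess (R0 ''zx'') ex')))
                       (BNot (BAnd (BNot (RLess (R0 ''zx'') ex)) (BNot (RLess (R0 ''zx'') ex')))))
                 (RLess (R0 ''zy'') (RAdd ey (RMul (RDiv (RSub (R0 ''zx'') ex) (RSub ex' ex)) (RSub ey' ey)))))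
       (setn ''par'' (NSub (NConst 1) (N0 ''par''))) FSkip"

lemma run_cross:
  "nmem (run cross_prog s) ''par'' 0 =
     (if crosses (cell s ''zx'' ''zy'' 0) (cell s ''px'' ''py'' (nmem s ''e'' 0))
           (cell s ''px'' ''py'' (nmem s ''nx'' (nmem s ''e'' 0)))
      then 1 - nmem s ''par'' 0 else nmem s ''par'' 0)"
  by (auto simp: cross_prog_def crosses_def height_def)

definition scale_prog :: fcom where
  "scale_prog =
     setr ''r'' (RNat (NConst 1)) ;;;
     FFor ''e'' ''n'' (setr ''r'' (RAdd (R0 ''r'') (RAdd (rabs (RSub ex (R0 ''qx''))) (rabs (RSub ey (R0 ''qy'')))))) ;;;
     FFor ''e'' ''n'' edge_prog ;;;
     setr ''zx'' (RAdd (R0 ''qx'') (RMul (RDiv (R0 ''r'') (RNat (NConst 2))) (R0 ''vx''))) ;;;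
     setr ''zy'' (RAdd (R0 ''qy'') (RMul (RDiv (R0 ''r'') (RNat (NConst 2))) (R0 ''vy''))) ;;;
     setn ''par'' (NConst 0) ;;;
     FFor ''e'' ''n'' cross_prog ;;;
     FCond (BAnd (RLess RZero (R0 ''r'')) (NLess (NConst 0) (N0 ''par''))) FSkip (setr ''r'' RZero)"

lemma edge_mod [simp]:
  "nmod edge_prog = {}" "rmod edge_prog = {''x0'', ''y0'', ''x1'', ''y1'', ''lo'', ''hi'', ''l0'', ''l1'', ''tc'', ''r''}"
  "counters_ok edge_prog" "bounds edge_prog = {}"
  by (auto simp: edge_prog_def edge_clip_def edge_min_def clip_prog_def)

lemma cross_mod [simp]:
  "nmod cross_prog = {''par''}" "rmod cross_prog = {}" "counters_ok cross_prog" "bounds cross_prog = {}"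
  by (auto simp: cross_prog_def)

lemma scale_mod [simp]:
  "nmod scale_prog = {''e'', ''par''}"
  "rmod scale_prog = {''x0'', ''y0'', ''x1'', ''y1'', ''lo'', ''hi'', ''l0'', ''l1'', ''tc'', ''r'', ''zx'', ''zy''}"
  "counters_ok scale_prog" "bounds scale_prog = {''n''}"
  by (auto simp: scale_prog_def)

context planar_domain
begin

definition edges_in :: "state \<Rightarrow> bool" where
  "edges_in s \<longleftrightarrow> nmem s ''n'' 0 = n \<and>
     (\<forall>i<n. cell s ''px'' ''py'' i = A i \<and> cell s ''px'' ''py'' (nmem s ''nx'' i) = B i)"

lemma crossings_upto_Suc:
  "crossings_upto z (Suc k) = crossings_upto z k + (if crosses z (A k) (B k) then 1 else 0)"
proof -
  have "{i. i < Suc k \<and> crosses z (A i) (B i)} =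
      (if crosses z (A k) (B k) then insert k else id) {i. i < k \<and> crosses z (A i) (B i)}"
    by (auto simp: less_Suc_eq)
  then show ?thesis by (simp add: crossings_upto_def)
qed

text \<open>The three loops compute \<open>cap\<close>, \<open>bound_upto\<close> and
  \<open>crossings_upto\<close> modulo 2, one edge at a time, and each invariant is the
  corresponding function stopped at the counter. The states in between are named so that untouched
  cells are treated once per state.\<close>

lemma run_scale:
  assumes "edges_in s"
  shows "rmem (run scale_prog s) ''r'' 0 = scale (rmem s ''s'' 0) (cell s ''qx'' ''qy'' 0) (cell s ''vx'' ''vy'' 0)"
proof -
  let ?q = "cell s ''qx'' ''qy'' 0" and ?v = "cell s ''vx'' ''vy'' 0" and ?s = "rmem s ''s'' 0"
  define s1 where "s1 = run (FFor ''e'' ''n'' (setr ''r'' (RAdd (R0 ''r'') (RAdd (rabs (RSub ex (R0 ''qx''))) (rabs (RSub ey (R0 ''qy''))))))) (rupd ''r'' 0 1 s)"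
  define s2 where "s2 = run (FFor ''e'' ''n'' edge_prog) s1"
  define z where "z = ?q + of_real (rmem s2 ''r'' 0 / 2) * ?v"
  define s3 where "s3 = nupd ''par'' 0 0 (rupd ''zy'' 0 (Im z) (rupd ''zx'' 0 (Re z) s2))"
  define s4 where "s4 = run (FFor ''e'' ''n'' cross_prog) s3"
  have n: "nmem s ''n'' 0 = n" and AB: "\<And>i. i < n \<Longrightarrow> cell s ''px'' ''py'' i = A i"
    "\<And>i. i < n \<Longrightarrow> cell s ''px'' ''py'' (nmem s ''nx'' i) = B i"
    using assms by (auto simp: edges_in_def)
  have f1: "x \<noteq> ''e'' \<Longrightarrow> nmem s1 x = nmem s x" "x \<noteq> ''r'' \<Longrightarrow> rmem s1 x = rmem s x" for x
    unfolding s1_def by (simp_all add: run_frame del: run.simps)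
  have f2: "x \<noteq> ''e'' \<Longrightarrow> nmem s2 x = nmem s x" "x \<notin> rmod edge_prog \<Longrightarrow> rmem s2 x = rmem s x" for x
    unfolding s2_def by (auto simp add: run_frame f1 simp del: run.simps)
  have f3: "x \<noteq> ''e'' \<Longrightarrow> x \<noteq> ''par'' \<Longrightarrow> nmem s3 x = nmem s x" "x \<notin> rmod scale_prog \<Longrightarrow> rmem s3 x = rmem s x" for x
    unfolding s3_def by (simp_all add: f2)
  have "rmem s1 ''r'' 0 = cap ?q (nmem (rupd ''r'' 0 1 s) ''n'' 0)"
    unfolding s1_def
  proof (rule run_For[where I = "\<lambda>k s'. rmem s' ''r'' 0 = cap ?q k"])
    fix k and s' :: state assume s': "k < nmem (rupd ''r'' 0 1 s) ''n'' 0" "nmem s' ''e'' 0 = k" "rmem s' ''r'' 0 = cap ?q k"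
      "\<And>z. z \<notin> rmod (setr ''r'' (RAdd (R0 ''r'') (RAdd (rabs (RSub ex (R0 ''qx''))) (rabs (RSub ey (R0 ''qy'')))))) \<Longrightarrow>
        rmem s' z = rmem (rupd ''r'' 0 1 s) z"
    then have "rmem s' ''px'' k = Re (A k)" "rmem s' ''py'' k = Im (A k)" using AB(1)[of k] n by (auto simp: cell_def complex_eq_iff)
    then show "rmem (nupd ''e'' 0 (Suc k) (run (setr ''r'' (RAdd (R0 ''r'') (RAdd (rabs (RSub ex (R0 ''qx''))) (rabs (RSub ey (R0 ''qy'')))))) s')) ''r'' 0 = cap ?q (Suc k)"
      using s' by (simp add: cap_def)
  qed (auto simp: cap_def)
  then have r1: "rmem s1 ''r'' 0 = cap ?q n" using n by simp
  have "rmem s2 ''r'' 0 = bound_upto ?s ?q ?v (nmem s1 ''n'' 0)"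
    unfolding s2_def
  proof (rule run_For[where I = "\<lambda>k s'. rmem s' ''r'' 0 = bound_upto ?s ?q ?v k"])
    fix k and s' :: state assume s': "k < nmem s1 ''n'' 0" "nmem s' ''e'' 0 = k" "rmem s' ''r'' 0 = bound_upto ?s ?q ?v k"
      "\<And>z. z \<notin> nmod (FFor ''e'' ''n'' edge_prog) \<Longrightarrow> nmem s' z = nmem s1 z"
      "\<And>z. z \<notin> rmod edge_prog \<Longrightarrow> rmem s' z = rmem s1 z"
    have k: "k < n" using s'(1) n f1 by simp
    have "cell s' ''px'' ''py'' k = A k" "cell s' ''px'' ''py'' (nmem s' ''nx'' k) = B k"
      "cell s' ''qx'' ''qy'' 0 = ?q" "cell s' ''vx'' ''vy'' 0 = ?v" "rmem s' ''s'' 0 = ?s"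
      using AB[OF k] s'(4,5) f1 by (auto simp: cell_def)
    then show "rmem (nupd ''e'' 0 (Suc k) (run edge_prog s')) ''r'' 0 = bound_upto ?s ?q ?v (Suc k)"
      using s'(2,3) by (simp add: run_edge)
  qed (auto simp: r1)
  then have r2: "rmem s2 ''r'' 0 = bound_upto ?s ?q ?v n" using n f1 by simp
  have "nmem s4 ''par'' 0 = crossings_upto z (nmem s3 ''n'' 0) mod 2"
    unfolding s4_def
  proof (rule run_For[where I = "\<lambda>k s'. nmem s' ''par'' 0 = crossings_upto z k mod 2"])
    fix k and s' :: state assume s': "k < nmem s3 ''n'' 0" "nmem s' ''e'' 0 = k" "nmem s' ''par'' 0 = crossings_upto z k mod 2"
      "\<And>z. z \<notin> nmod (FFor ''e'' ''n'' cross_prog) \<Longrightarrow> nmem s' z = nmem s3 z"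
      "\<And>z. z \<notin> rmod cross_prog \<Longrightarrow> rmem s' z = rmem s3 z"
    have k: "k < n" using s'(1) n f3 by simp
    have "rmem s3 ''zx'' 0 = Re z" "rmem s3 ''zy'' 0 = Im z" by (simp_all add: s3_def)
    then have "cell s' ''px'' ''py'' k = A k" "cell s' ''px'' ''py'' (nmem s' ''nx'' k) = B k" "cell s' ''zx'' ''zy'' 0 = z"
      using AB[OF k] s'(4,5) f3 by (auto simp: cell_def)
    then show "nmem (nupd ''e'' 0 (Suc k) (run cross_prog s')) ''par'' 0 = crossings_upto z (Suc k) mod 2"
      using s'(2,3) by (simp add: run_cross crossings_upto_Suc) presburger
  qed (auto simp: s3_def crossings_upto_def)
  then have par: "nmem s4 ''par'' 0 = crossings_upto z n mod 2" using n f3 by simp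
  have r4: "rmem s4 ''r'' 0 = rmem s2 ''r'' 0" unfolding s4_def by (simp add: run_frame s3_def del: run.simps)
  have "run (setr ''zx'' (RAdd (R0 ''qx'') (RMul (RDiv (R0 ''r'') (RNat (NConst 2))) (R0 ''vx''))) ;;;
     setr ''zy'' (RAdd (R0 ''qy'') (RMul (RDiv (R0 ''r'') (RNat (NConst 2))) (R0 ''vy''))) ;;;
     setn ''par'' (NConst 0)) s2 = s3"
    using f2 by (simp add: s3_def z_def)
  then have "run scale_prog s = run (FCond (BAnd (RLess RZero (R0 ''r'')) (NLess (NConst 0) (N0 ''par''))) FSkip (setr ''r'' RZero)) s4"
    unfolding scale_prog_def s4_def s2_def s1_def by simp
  then show ?thesis using r4 r2 par unfolding scale_def Let_def z_def
    by (auto simp: odd_iff_mod_2_eq_one)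
qed

end

section \<open>The program for the reach of every point of the input\<close>

subsection \<open>Computing reaches\<close>

text \<open>The machine has no multiplication of naturals. A fixed multiple is expanded into a sum
  when the program is written.\<close>

primrec nmul :: "nat \<Rightarrow> nexp \<Rightarrow> nexp" where
  "nmul 0 e = NConst 0"
| "nmul (Suc k) e = NAdd e (nmul k e)"

lemma nval_nmul [simp]: "nval (nmul k e) s = k * nval e s"
  by (induction k) auto

definition NEq :: "nexp \<Rightarrow> nexp \<Rightarrow> bexp" where "NEq e f = BAnd (BNot (NLess e f)) (BNot (NLess f e))"
definition REq :: "rexp \<Rightarrow> rexp \<Rightarrow> bexp" where "REq e f = BAnd (BNot (RLess e f)) (BNot (RLess f e))"

lemma bval_eq [simp]:
  "bval (NEq e f) s \<longleftrightarrow> nval e s = nval f s" "bval (REq e' f') s \<longleftrightarrow> rval e' s = rval f' s"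
  by (auto simp: NEq_def REq_def)

definition set_dir :: fcom where
  "set_dir =
     setr ''vx'' (RSub (RNat (N0 ''i'')) (RNat (N0 ''N''))) ;;;
     setr ''vy'' (RSub (RNat (N0 ''j'')) (RNat (N0 ''N''))) ;;;
     setr ''d'' (RSqrt (RAdd (RMul (R0 ''vx'') (R0 ''vx'')) (RMul (R0 ''vy'') (R0 ''vy'')))) ;;;
     setr ''vx'' (RDiv (R0 ''vx'') (R0 ''d'')) ;;; setr ''vy'' (RDiv (R0 ''vy'') (R0 ''d''))"

definition reach_cell :: fcom where
  "reach_cell =
     FCond (BAnd (NEq (N0 ''i'') (N0 ''N'')) (NEq (N0 ''j'') (N0 ''N''))) FSkip
      (set_dir ;;; scale_prog ;;; FRSet ''F'' (N0 ''q'') (rmax (RGet ''F'' (N0 ''q'')) (R0 ''r'')))"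

definition set_point :: fcom where
  "set_point = setr ''qx'' (RGet ''sx'' (N0 ''q'')) ;;; setr ''qy'' (RGet ''sy'' (N0 ''q''))"

definition reach_prog :: fcom where
  "reach_prog =
     setr ''s'' (RMul (RDiv (RNat (NConst 9)) (RNat (NConst 10))) (R0 ''alpha'')) ;;;
     FFor ''q'' ''m'' (set_point ;;; FRSet ''F'' (N0 ''q'') RZero ;;; FFor ''i'' ''N2'' (FFor ''j'' ''N2'' reach_cell))"

lemma set_dir_mod [simp]: "nmod set_dir = {}" "rmod set_dir = {''vx'', ''vy'', ''d''}"
  "counters_ok set_dir" "bounds set_dir = {}"
  by (auto simp: set_dir_def)

lemma set_point_mod [simp]: "nmod set_point = {}" "rmod set_point = {''qx'', ''qy''}"
  "counters_ok set_point" "bounds set_point = {}"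
  by (auto simp: set_point_def)

lemma reach_cell_mod [simp]:
  "nmod reach_cell = {''e'', ''par''}"
  "rmod reach_cell = {''vx'', ''vy'', ''d'', ''F''} \<union> rmod scale_prog"
  "counters_ok reach_cell" "bounds reach_cell = {''n''}"
  by (auto simp: reach_cell_def)

lemma reach_mod [simp]:
  "nmod reach_prog = {''q'', ''i'', ''j'', ''e'', ''par''}"
  "rmod reach_prog = {''s'', ''qx'', ''qy'', ''vx'', ''vy'', ''d'', ''F''} \<union> rmod scale_prog"
  "counters_ok reach_prog" "bounds reach_prog = {''n'', ''m'', ''N2''}"
  by (auto simp: reach_prog_def)

lemma run_set_dir: "cell (run set_dir s) ''vx'' ''vy'' 0 = dir (nmem s ''N'' 0) (nmem s ''i'' 0) (nmem s ''j'' 0)"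
  by (simp add: set_dir_def dir_def cell_def sgn_eq complex_eq_iff cmod_def power2_eq_square)

lemma run_set_point: "cell (run set_point s) ''qx'' ''qy'' 0 = cell s ''sx'' ''sy'' (nmem s ''q'' 0)"
  by (simp add: set_point_def cell_def)

locale guard_input = planar_domain +
  fixes \<alpha> :: real and m :: nat and Q :: "nat \<Rightarrow> complex" and N :: nat
  assumes \<alpha>: "0 < \<alpha>" "\<alpha> \<le> 1" and Q: "\<And>q. q < m \<Longrightarrow> Q q \<in> P"
begin

definition inputs :: "state \<Rightarrow> bool" where
  "inputs s \<longleftrightarrow> edges_in s \<and> nmem s ''m'' 0 = m \<and> nmem s ''N'' 0 = N \<and>
     nmem s ''N2'' 0 = 2 * N + 1 \<and> nmem s ''N10'' 0 = 10 * N + 1 \<and> rmem s ''alpha'' 0 = \<alpha> \<and>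
     (\<forall>q<m. cell s ''sx'' ''sy'' q = Q q)"

definition input_nvars :: "string set" where "input_nvars = {''n'', ''nx'', ''m'', ''N'', ''N2'', ''N10''}"
definition input_rvars :: "string set" where "input_rvars = {''px'', ''py'', ''alpha'', ''sx'', ''sy''}"

lemma inputs_cong:
  assumes "\<And>x. x \<in> input_nvars \<Longrightarrow> nmem s' x = nmem s x" "\<And>x. x \<in> input_rvars \<Longrightarrow> rmem s' x = rmem s x"
  shows "inputs s' \<longleftrightarrow> inputs s"
  using assms by (simp add: inputs_def edges_in_def cell_def input_nvars_def input_rvars_def)

lemma inputs_run:
  assumes "nmod c \<inter> input_nvars = {}" "rmod c \<inter> input_rvars = {}"
  shows "inputs (run c s) \<longleftrightarrow> inputs s"
  by (rule inputs_cong; rule run_frame) (use assms in blast)+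

lemma run_reach_cell:
  assumes "inputs s"
  shows "rmem (run reach_cell s) ''F'' q =
     (if nmem s ''q'' 0 = q \<and> \<not> (nmem s ''i'' 0 = N \<and> nmem s ''j'' 0 = N)
      then max (rmem s ''F'' q) (scale (rmem s ''s'' 0) (cell s ''qx'' ''qy'' 0) (dir N (nmem s ''i'' 0) (nmem s ''j'' 0)))
      else rmem s ''F'' q)"
proof -
  let ?s = "run set_dir s"
  have "inputs ?s" using assms by (subst inputs_run) (auto simp: input_nvars_def input_rvars_def)
  then have e: "edges_in ?s" by (simp add: inputs_def)
  have N: "nmem s ''N'' 0 = N" using assms by (simp add: inputs_def)
  have c: "cell ?s ''qx'' ''qy'' 0 = cell s ''qx'' ''qy'' 0" "rmem ?s ''s'' 0 = rmem s ''s'' 0"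
    by (simp_all add: cell_def run_frame)
  have "rmem (run scale_prog ?s) ''r'' 0 =
      scale (rmem s ''s'' 0) (cell s ''qx'' ''qy'' 0) (dir N (nmem s ''i'' 0) (nmem s ''j'' 0))"
    using run_scale[OF e] run_set_dir[of s] N c by simp
  moreover have "rmem (run scale_prog ?s) ''F'' = rmem s ''F''" "nmem (run scale_prog ?s) ''q'' = nmem s ''q''"
    by (simp_all add: run_frame)
  ultimately show ?thesis using N by (auto simp: reach_cell_def)
qed

text \<open>The properties of \<open>reach\<close> restricted to the directions before
  \<open>(i, j)\<close> in lexicographic order; it serves as invariant of both nested loops.\<close>

definition preach :: "nat \<Rightarrow> nat \<Rightarrow> nat \<Rightarrow> real \<Rightarrow> bool" where
  "preach q i j F \<longleftrightarrow> 0 \<le> F \<and>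
     (\<forall>i'<2 * N + 1. \<forall>j'<2 * N + 1. (i' < i \<or> i' = i \<and> j' < j) \<longrightarrow> \<not> (i' = N \<and> j' = N) \<longrightarrow>
        scale (9 / 10 * \<alpha>) (Q q) (dir N i' j') \<le> F) \<and>
     (F = 0 \<or> (\<exists>i j. \<not> (i = N \<and> j = N) \<and> F = scale (9 / 10 * \<alpha>) (Q q) (dir N i j)))"

lemma preach_step:
  assumes "preach q i j F"
  shows "preach q i (Suc j) (if i = N \<and> j = N then F else max F (scale (9 / 10 * \<alpha>) (Q q) (dir N i j)))"
proof (cases "i = N \<and> j = N")
  case True
  then show ?thesis using assms by (auto simp: preach_def less_Suc_eq)
next
  case False
  let ?S = "\<lambda>i j. scale (9 / 10 * \<alpha>) (Q q) (dir N i j)"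
  have "0 \<le> max F (?S i j)" using assms by (auto simp: preach_def)
  moreover have "?S i' j' \<le> max F (?S i j)"
    if "i' < 2 * N + 1" "j' < 2 * N + 1" "i' < i \<or> i' = i \<and> j' < Suc j" "\<not> (i' = N \<and> j' = N)" for i' j'
  proof (cases "i' = i \<and> j' = j")
    case False
    then have "?S i' j' \<le> F" using that assms unfolding preach_def by (metis less_Suc_eq)
    then show ?thesis by simp
  qed simp
  moreover have "max F (?S i j) = 0 \<or> (\<exists>k l. \<not> (k = N \<and> l = N) \<and> max F (?S i j) = ?S k l)"
    using False assms unfolding preach_def by (metis max_def)
  ultimately have "preach q i (Suc j) (max F (?S i j))" unfolding preach_def by blast
  then show ?thesis using False by (simp only: if_False)
qed

lemma run_reach_point:
  assumes s: "inputs s" "q < m" "nmem s ''q'' 0 = q" "rmem s ''s'' 0 = 9 / 10 * \<alpha>" "cell s ''qx'' ''qy'' 0 = Q q"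
    and F: "rmem s ''F'' q = 0"
  defines "s' \<equiv> run (FFor ''i'' ''N2'' (FFor ''j'' ''N2'' reach_cell)) s"
  shows "reach \<alpha> N (Q q) (rmem s' ''F'' q)" "q' \<noteq> q \<Longrightarrow> rmem s' ''F'' q' = rmem s ''F'' q'"
proof -
  have N2: "nmem s ''N2'' 0 = 2 * N + 1" using s by (simp add: inputs_def)
  \<comment> \<open>The reaches of other points must survive, since the surrounding loop collects
    them all.\<close>
  define other where "other t \<longleftrightarrow> (\<forall>q'. q' \<noteq> q \<longrightarrow> rmem t ''F'' q' = rmem s ''F'' q')" for t :: state
  define J where "J i j t \<longleftrightarrow> preach q i j (rmem t ''F'' q) \<and> other t" for i j and t :: state
  have J_nupd: "J i j (nupd x y z t) \<longleftrightarrow> J i j t" for i j x y z and t :: state by (simp add: J_def other_def)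
  \<comment> \<open>The end of one row is the beginning of the next, which links the inner invariant
    to the outer one.\<close>
  have next_row: "J i (2 * N + 1) t \<Longrightarrow> J (Suc i) 0 t" for i t
    by (auto simp: J_def preach_def less_Suc_eq)
  have "J (nmem s ''N2'' 0) 0 s'"
    unfolding s'_def
  proof (rule run_For[where I = "\<lambda>i. J i 0"])
    fix i and t :: state
    assume t: "i < nmem s ''N2'' 0" "nmem t ''i'' 0 = i" "J i 0 t"
      "\<And>z. z \<notin> nmod (FFor ''i'' ''N2'' (FFor ''j'' ''N2'' reach_cell)) \<Longrightarrow> nmem t z = nmem s z"
      "\<And>z. z \<notin> rmod (FFor ''j'' ''N2'' reach_cell) \<Longrightarrow> rmem t z = rmem s z"
    have "J i (nmem t ''N2'' 0) (run (FFor ''j'' ''N2'' reach_cell) t)"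
    proof (rule run_For[where I = "J i"])
      fix j and u :: state
      assume u: "j < nmem t ''N2'' 0" "nmem u ''j'' 0 = j" "J i j u"
        "\<And>z. z \<notin> nmod (FFor ''j'' ''N2'' reach_cell) \<Longrightarrow> nmem u z = nmem t z"
        "\<And>z. z \<notin> rmod reach_cell \<Longrightarrow> rmem u z = rmem t z"
      have fn: "nmem u z = nmem s z" if "z \<notin> {''i'', ''j'', ''e'', ''par''}" for z using u(4)[of z] t(4)[of z] that by simp
      have fr: "rmem u z = rmem s z" if "z \<notin> rmod reach_cell" for z using u(5)[of z] t(5)[of z] that by simp
      have "inputs u" using s(1) by (subst inputs_cong[of u s]) (auto simp: input_nvars_def input_rvars_def fn fr)
      note R = run_reach_cell[OF this]
      have v: "nmem u ''q'' 0 = q" "nmem u ''i'' 0 = i" "rmem u ''s'' 0 = 9 / 10 * \<alpha>" "cell u ''qx'' ''qy'' 0 = Q q"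
        using s t(2) u(4)[of "''i''"] by (simp_all add: fn fr cell_def)
      have "rmem (run reach_cell u) ''F'' q =
          (if i = N \<and> j = N then rmem u ''F'' q else max (rmem u ''F'' q) (scale (9 / 10 * \<alpha>) (Q q) (dir N i j)))"
        "\<And>q'. q' \<noteq> q \<Longrightarrow> rmem (run reach_cell u) ''F'' q' = rmem u ''F'' q'"
        unfolding R v u(2) by auto
      then show "J i (Suc j) (nupd ''j'' 0 (Suc j) (run reach_cell u))"
        using u(3) preach_step[of q i j "rmem u ''F'' q"] unfolding J_nupd by (simp only: J_def other_def) auto
    qed (use t(3) in \<open>simp_all add: J_nupd\<close>)
    moreover have "nmem t ''N2'' 0 = 2 * N + 1" using t(4)[of "''N2''"] N2 by simp
    ultimately show "J (Suc i) 0 (nupd ''i'' 0 (Suc i) (run (FFor ''j'' ''N2'' reach_cell) t))"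
      unfolding J_nupd using next_row by simp
  qed (auto simp: J_def preach_def other_def F)
  then have J: "J (2 * N + 1) 0 s'" using N2 by simp
  then show "reach \<alpha> N (Q q) (rmem s' ''F'' q)" by (auto simp: J_def preach_def reach_def)
  show "q' \<noteq> q \<Longrightarrow> rmem s' ''F'' q' = rmem s ''F'' q'" using J by (simp add: J_def other_def)
qed

lemma run_reach:
  assumes "inputs s"
  shows "\<forall>q<m. reach \<alpha> N (Q q) (rmem (run reach_prog s) ''F'' q)"
proof -
  let ?c = "set_point ;;; FRSet ''F'' (N0 ''q'') RZero ;;; FFor ''i'' ''N2'' (FFor ''j'' ''N2'' reach_cell)"
  define s1 where "s1 = rupd ''s'' 0 (9 / 10 * \<alpha>) s"
  have a: "rmem s ''alpha'' 0 = \<alpha>" using assms by (simp add: inputs_def)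
  have in1: "inputs s1" using assms by (subst inputs_cong[of s1 s]) (auto simp: input_nvars_def input_rvars_def s1_def)
  have "\<forall>q<nmem s1 ''m'' 0. reach \<alpha> N (Q q) (rmem (run (FFor ''q'' ''m'' ?c) s1) ''F'' q)"
  proof (rule run_For[where I = "\<lambda>k s'. \<forall>q<k. reach \<alpha> N (Q q) (rmem s' ''F'' q)"])
    fix k and t :: state
    assume t: "k < nmem s1 ''m'' 0" "nmem t ''q'' 0 = k" "\<forall>q<k. reach \<alpha> N (Q q) (rmem t ''F'' q)"
      "\<And>z. z \<notin> nmod (FFor ''q'' ''m'' ?c) \<Longrightarrow> nmem t z = nmem s1 z"
      "\<And>z. z \<notin> rmod ?c \<Longrightarrow> rmem t z = rmem s1 z"
    define u where "u = rupd ''F'' k 0 (run set_point t)"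
    have k: "k < m" using t(1) in1 by (simp add: inputs_def)
    have int: "inputs t" using in1 by (subst inputs_cong[of t s1]) (auto simp: input_nvars_def input_rvars_def t(4,5))
    then have inu: "inputs u" by (subst inputs_cong[of u t]) (auto simp: input_nvars_def input_rvars_def u_def run_frame)
    have "cell (run set_point t) ''qx'' ''qy'' 0 = Q k"
      using run_set_point[of t] t(2) int k by (simp add: inputs_def)
    then have u: "nmem u ''q'' 0 = k" "rmem u ''s'' 0 = 9 / 10 * \<alpha>" "cell u ''qx'' ''qy'' 0 = Q k" "rmem u ''F'' k = 0"
      "\<And>q. q \<noteq> k \<Longrightarrow> rmem u ''F'' q = rmem t ''F'' q"
      using t(2) t(5)[of "''s''"] by (simp_all add: u_def run_frame cell_def s1_def)
    have "run ?c t = run (FFor ''i'' ''N2'' (FFor ''j'' ''N2'' reach_cell)) u"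
      using t(2) by (simp add: u_def run_frame)
    then have "reach \<alpha> N (Q k) (rmem (run ?c t) ''F'' k)" "\<And>q. q \<noteq> k \<Longrightarrow> rmem (run ?c t) ''F'' q = rmem t ''F'' q"
      using run_reach_point[OF inu k u(1-4)] u(5) by auto
    then show "\<forall>q<Suc k. reach \<alpha> N (Q q) (rmem (nupd ''q'' 0 (Suc k) (run ?c t)) ''F'' q)"
      using t(3) by (auto simp: less_Suc_eq simp del: run.simps)
  qed simp_all
  moreover have "run reach_prog s = run (FFor ''q'' ''m'' ?c) s1" using a by (simp add: reach_prog_def s1_def)
  ultimately show ?thesis using in1 by (simp add: inputs_def)
qed

end

section \<open>The greedy rounds and the accounting against an optimal solution\<close>

subsection \<open>The greedy algorithm\<close>

text \<open>The value \<open>m\<close> of \<open>sel\<close> stands for no unmarked point found so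
  far.\<close>

definition select_prog :: fcom where
  "select_prog =
     setn ''sel'' (N0 ''m'') ;;;
     FFor ''q'' ''m''
       (FCond (BAnd (NEq (NGet ''done'' (N0 ''q'')) (NConst 0))
           (BNot (BAnd (NLess (N0 ''sel'') (N0 ''m'')) (BNot (RLess (RGet ''F'' (N0 ''q'')) (RGet ''F'' (N0 ''sel'')))))))
         (setn ''sel'' (N0 ''q'')) FSkip)"

definition set_diff :: fcom where
  "set_diff = setr ''vx'' (RSub (R0 ''cx'') (R0 ''qx'')) ;;; setr ''vy'' (RSub (R0 ''cy'') (R0 ''qy''))"

text \<open>If the candidate coincides with the point, \<open>r\<close> is set to 1, so that passing
  the test always reads \<open>1 \<le> r\<close>.\<close>

definition test_prog :: fcom where
  "test_prog =
     set_point ;;; set_diff ;;;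
     FCond (BAnd (REq (R0 ''vx'') RZero) (REq (R0 ''vy'') RZero)) (setr ''r'' (RNat (NConst 1))) scale_prog"

definition try_prog :: fcom where
  "try_prog =
     FCond (NEq (NGet ''done'' (N0 ''q'')) (NConst 0))
       (test_prog ;;;
        FCond (RLess (R0 ''r'') (RNat (NConst 1))) FSkip
          (FNSet ''done'' (N0 ''q'') (NConst 1) ;;; setn ''used'' (NConst 1)))
       FSkip"

definition grid_coord :: "string \<Rightarrow> string \<Rightarrow> rexp" where
  "grid_coord sc i = RAdd (RGet sc (N0 ''sel'')) (RDiv (RMul (RSub (RNat (N0 i)) (RNat (nmul 5 (N0 ''N''))))
     (RGet ''F'' (N0 ''sel''))) (RNat (N0 ''N'')))"

definition output_prog :: fcom where
  "output_prog = FRSet ''gx'' (N0 ''k'') (R0 ''cx'') ;;; FRSet ''gy'' (N0 ''k'') (R0 ''cy'') ;;;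
     setn ''k'' (NAdd (N0 ''k'') (NConst 1))"

definition grid_cell :: fcom where
  "grid_cell =
     setr ''cx'' (grid_coord ''sx'' ''i'') ;;; setr ''cy'' (grid_coord ''sy'' ''j'') ;;; setn ''used'' (NConst 0) ;;;
     FFor ''q'' ''m'' try_prog ;;;
     FCond (NEq (N0 ''used'') (NConst 0)) FSkip output_prog"

text \<open>The number of rounds is not known beforehand, but \<open>m\<close> rounds suffice, since
  each marks at least the point it selects. Surplus rounds find nothing to select and do
  nothing.\<close>

definition greedy_prog :: fcom where
  "greedy_prog =
     setr ''s'' (RMul (RDiv (RNat (NConst 3)) (RNat (NConst 4))) (R0 ''alpha'')) ;;;
     FFor ''it'' ''m''
       (select_prog ;;;
        FCond (NLess (N0 ''sel'') (N0 ''m'')) (FFor ''i'' ''N10'' (FFor ''j'' ''N10'' grid_cell)) FSkip)"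

lemma select_mod [simp]: "nmod select_prog = {''sel'', ''q''}" "rmod select_prog = {}"
  "counters_ok select_prog" "bounds select_prog = {''m''}"
  by (auto simp: select_prog_def)

lemma test_mod [simp]: "nmod test_prog = {''e'', ''par''}"
  "rmod test_prog = {''qx'', ''qy'', ''vx'', ''vy''} \<union> rmod scale_prog"
  "counters_ok test_prog" "bounds test_prog = {''n''}"
  by (auto simp: test_prog_def set_diff_def)

lemma try_mod [simp]: "nmod try_prog = {''e'', ''par'', ''done'', ''used''}" "rmod try_prog = rmod test_prog"
  "counters_ok try_prog" "bounds try_prog = {''n''}"
  by (auto simp: try_prog_def)

lemma grid_cell_mod [simp]: "nmod grid_cell = {''q'', ''e'', ''par'', ''done'', ''used'', ''k''}"
  "rmod grid_cell = {''cx'', ''cy'', ''gx'', ''gy''} \<union> rmod test_prog"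
  "counters_ok grid_cell" "bounds grid_cell = {''n'', ''m''}"
  by (auto simp: grid_cell_def output_prog_def)

lemma greedy_mod [simp]:
  "nmod greedy_prog = {''it'', ''sel'', ''q'', ''i'', ''j'', ''e'', ''par'', ''done'', ''used'', ''k''}"
  "rmod greedy_prog = {''s''} \<union> rmod grid_cell"
  "counters_ok greedy_prog" "bounds greedy_prog = {''m'', ''n'', ''N10''}"
  by (auto simp: greedy_prog_def)

lemma output_points_cell: "output_points s = cell s ''gx'' ''gy'' ` {..<nmem s ''k'' 0}"
  by (auto simp: output_points_def cell_def)

context guard_input
begin

definition marked :: "state \<Rightarrow> nat set" where "marked s = {q. q < m \<and> nmem s ''done'' q \<noteq> 0}"

lemma finite_marked [simp]: "finite (marked s)" and marked_subset: "marked s \<subseteq> {..<m}"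
  by (auto simp: marked_def)

lemma marked_nupd: "x \<noteq> ''done'' \<Longrightarrow> marked (nupd x i k s) = marked s"
  by (simp add: marked_def)

lemma run_select:
  assumes s: "inputs s"
  shows "nmem (run select_prog s) ''sel'' 0 = m \<and> marked s = {..<m} \<or>
    nmem (run select_prog s) ''sel'' 0 < m \<and> nmem (run select_prog s) ''sel'' 0 \<notin> marked s \<and>
      (\<forall>q<m. q \<notin> marked s \<longrightarrow> rmem s ''F'' (nmem (run select_prog s) ''sel'' 0) \<le> rmem s ''F'' q)"
proof -
  let ?c = "FCond (BAnd (NEq (NGet ''done'' (N0 ''q'')) (NConst 0))
           (BNot (BAnd (NLess (N0 ''sel'') (N0 ''m'')) (BNot (RLess (RGet ''F'' (N0 ''q'')) (RGet ''F'' (N0 ''sel'')))))))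
         (setn ''sel'' (N0 ''q'')) FSkip"
  define s1 where "s1 = nupd ''sel'' 0 m s"
  define I where "I k sel \<longleftrightarrow> sel = m \<and> (\<forall>q<k. q < m \<longrightarrow> q \<in> marked s) \<or>
      sel < m \<and> sel \<notin> marked s \<and> (\<forall>q<k. q < m \<longrightarrow> q \<notin> marked s \<longrightarrow> rmem s ''F'' sel \<le> rmem s ''F'' q)" for k sel
  have m: "nmem s ''m'' 0 = m" "nmem s1 ''m'' 0 = m" using s by (auto simp: inputs_def s1_def)
  have "I (nmem s1 ''m'' 0) (nmem (run (FFor ''q'' ''m'' ?c) s1) ''sel'' 0)"
  proof (rule run_For[where I = "\<lambda>k t. I k (nmem t ''sel'' 0)"])
    fix k and t :: state
    assume t: "k < nmem s1 ''m'' 0" "nmem t ''q'' 0 = k" "I k (nmem t ''sel'' 0)"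
      "\<And>z. z \<notin> nmod (FFor ''q'' ''m'' ?c) \<Longrightarrow> nmem t z = nmem s1 z" "\<And>z. z \<notin> rmod ?c \<Longrightarrow> rmem t z = rmem s1 z"
    have f: "nmem t ''done'' = nmem s ''done''" "nmem t ''m'' 0 = m" "rmem t ''F'' = rmem s ''F''"
      using t(4)[of "''done''"] t(4)[of "''m''"] t(5)[of "''F''"] m by (auto simp: s1_def)
    have d: "nmem s ''done'' k = 0 \<longleftrightarrow> k \<notin> marked s" using t(1) m by (auto simp: marked_def)
    have "nmem (run ?c t) ''sel'' 0 = (if k \<notin> marked s \<and> \<not> (nmem t ''sel'' 0 < m \<and> rmem s ''F'' (nmem t ''sel'' 0) \<le> rmem s ''F'' k)
       then k else nmem t ''sel'' 0)"
      using t(2) f d by (auto simp: not_less)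
    moreover have "I (Suc k) (if k \<notin> marked s \<and> \<not> (nmem t ''sel'' 0 < m \<and> rmem s ''F'' (nmem t ''sel'' 0) \<le> rmem s ''F'' k)
       then k else nmem t ''sel'' 0)"
      using t(1,3) m unfolding I_def by (auto simp: less_Suc_eq intro: order_trans less_imp_le)
    ultimately show "I (Suc k) (nmem (nupd ''q'' 0 (Suc k) (run ?c t)) ''sel'' 0)"
      by (simp del: run.simps)
  qed (auto simp: I_def s1_def)
  moreover have "run select_prog s = run (FFor ''q'' ''m'' ?c) s1" using m by (simp add: select_prog_def s1_def)
  ultimately show ?thesis using m marked_subset[of s] by (auto simp: I_def)
qed

lemma run_test:
  assumes s: "inputs s" "rmem s ''s'' 0 = 3 / 4 * \<alpha>" and q: "nmem s ''q'' 0 < m"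
  shows "1 \<le> rmem (run test_prog s) ''r'' 0 \<longleftrightarrow> guard_test \<alpha> (Q (nmem s ''q'' 0)) (cell s ''cx'' ''cy'' 0)"
proof -
  let ?q = "Q (nmem s ''q'' 0)" and ?g = "cell s ''cx'' ''cy'' 0"
  define u where "u = run set_diff (run set_point s)"
  have "cell (run set_point s) ''qx'' ''qy'' 0 = ?q" using run_set_point[of s] s(1) q by (simp add: inputs_def)
  then have u: "cell u ''qx'' ''qy'' 0 = ?q" "cell u ''vx'' ''vy'' 0 = ?g - ?q" "rmem u ''s'' 0 = 3 / 4 * \<alpha>"
    using s(2) by (auto simp: u_def set_diff_def cell_def run_frame complex_eq_iff)
  have fr: "nmem u x = nmem s x" "x \<in> input_rvars \<Longrightarrow> rmem u x = rmem s x" for x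
    by (auto simp: u_def set_diff_def run_frame input_rvars_def)
  have "inputs u" using s(1) by (subst inputs_cong[of u s]) (auto simp: fr)
  then have e: "edges_in u" by (simp add: inputs_def)
  have v: "rmem u ''vx'' 0 = 0 \<and> rmem u ''vy'' 0 = 0 \<longleftrightarrow> ?g = ?q"
    using u(2) by (simp add: cell_def complex_eq_iff)
  have "rmem (run test_prog s) ''r'' 0 = (if ?g = ?q then 1 else scale (3 / 4 * \<alpha>) ?q (?g - ?q))"
    using run_scale[OF e] u v by (auto simp: test_prog_def u_def[symmetric])
  then show ?thesis by (auto simp: guard_test_def)
qed

lemma run_try:
  assumes s: "inputs s" "rmem s ''s'' 0 = 3 / 4 * \<alpha>" and q: "nmem s ''q'' 0 = q" "q < m"
  shows "marked (run try_prog s) = (if guard_test \<alpha> (Q q) (cell s ''cx'' ''cy'' 0) then insert q (marked s) else marked s)"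
    "nmem (run try_prog s) ''used'' 0 =
      (if q \<notin> marked s \<and> guard_test \<alpha> (Q q) (cell s ''cx'' ''cy'' 0) then 1 else nmem s ''used'' 0)"
proof -
  note T = run_test[OF s, unfolded q(1), OF q(2)]
  have d: "nmem s ''done'' q = 0 \<longleftrightarrow> q \<notin> marked s" using q by (simp add: marked_def)
  have f: "nmem (run test_prog s) ''done'' = nmem s ''done''" "nmem (run test_prog s) ''q'' = nmem s ''q''"
    "nmem (run test_prog s) ''used'' = nmem s ''used''" by (simp_all add: run_frame)
  show "marked (run try_prog s) = (if guard_test \<alpha> (Q q) (cell s ''cx'' ''cy'' 0) then insert q (marked s) else marked s)"
  proof (cases "q \<in> marked s")
    case True
    then show ?thesis using d q by (auto simp: try_prog_def)
  next
    case False
    have r: "run try_prog s = (if rmem (run test_prog s) ''r'' 0 < 1 then run test_prog s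
        else nupd ''used'' 0 1 (nupd ''done'' q 1 (run test_prog s)))"
      using d False q f by (simp add: try_prog_def)
    have "marked (run test_prog s) = marked s" by (simp add: marked_def f)
    moreover have "marked (nupd ''used'' 0 1 (nupd ''done'' q 1 t)) = insert q (marked t)" for t
      using q by (auto simp: marked_def)
    ultimately show ?thesis unfolding r using T by (cases "guard_test \<alpha> (Q q) (cell s ''cx'' ''cy'' 0)") simp_all
  qed
  show "nmem (run try_prog s) ''used'' 0 =
      (if q \<notin> marked s \<and> guard_test \<alpha> (Q q) (cell s ''cx'' ''cy'' 0) then 1 else nmem s ''used'' 0)"
    using d q T f by (auto simp: try_prog_def not_less)
qed

text \<open>Every output point marks a new point, hence the bound on \<open>k\<close>. It yields at
  most \<open>m\<close> guards even where the resolution is too coarse for the comparison with the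
  optimum.\<close>

definition correct :: "state \<Rightarrow> bool" where
  "correct s \<longleftrightarrow> nmem s ''k'' 0 \<le> card (marked s) \<and> output_points s \<subseteq> P \<and>
     (\<forall>q\<in>marked s. \<exists>g\<in>output_points s. robustly_guards_point P (\<alpha> / 2) g (Q q))"

lemma correct_nupd: "x \<noteq> ''k'' \<Longrightarrow> x \<noteq> ''done'' \<Longrightarrow> correct (nupd x i k s) = correct s"
  by (simp add: correct_def marked_nupd output_points_def)

lemma run_grid_cell:
  assumes s: "inputs s" "rmem s ''s'' 0 = 3 / 4 * \<alpha>" and c: "correct s"
  defines "g \<equiv> grid (Q (nmem s ''sel'' 0)) (rmem s ''F'' (nmem s ''sel'' 0)) N (nmem s ''i'' 0) (nmem s ''j'' 0)"
  assumes sel: "nmem s ''sel'' 0 < m"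
  shows "correct (run grid_cell s)" "marked (run grid_cell s) = marked s \<union> {q. q < m \<and> guard_test \<alpha> (Q q) g}"
    "nmem (run grid_cell s) ''k'' 0 \<le> Suc (nmem s ''k'' 0)"
proof -
  define s1 where "s1 = nupd ''used'' 0 0 (rupd ''cy'' 0 (Im g) (rupd ''cx'' 0 (Re g) s))"
  define s2 where "s2 = run (FFor ''q'' ''m'' try_prog) s1"
  have N: "nmem s ''N'' 0 = N" and m: "nmem s ''m'' 0 = m" using s by (simp_all add: inputs_def)
  have Qs: "rmem s ''sx'' (nmem s ''sel'' 0) = Re (Q (nmem s ''sel'' 0))" "rmem s ''sy'' (nmem s ''sel'' 0) = Im (Q (nmem s ''sel'' 0))"
    using s sel by (auto simp: inputs_def cell_def complex_eq_iff)
  have fin: "run grid_cell s = (if nmem s2 ''used'' 0 = 0 then s2 else run output_prog s2)"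
    using N Qs by (simp add: grid_cell_def grid_coord_def g_def grid_def s2_def s1_def del: run.simps(6))
  have fn1: "nmem s1 x = nmem s x" if "x \<noteq> ''used''" for x using that by (simp add: s1_def)
  have fr1: "rmem s1 x = rmem s x" if "x \<noteq> ''cx''" "x \<noteq> ''cy''" for x using that by (simp add: s1_def)
  have in1: "inputs s1" using s(1) by (subst inputs_cong[of s1 s]) (auto simp: input_nvars_def input_rvars_def fn1 fr1)
  have m1: "marked s1 = marked s" by (simp add: marked_def fn1)
  \<comment> \<open>The flag \<open>used\<close> tells whether the marked set has grown strictly;
    only then may \<open>k\<close> increase without violating \<open>correct\<close>.\<close>
  define I where "I k t \<longleftrightarrow> marked t = marked s \<union> {q. q < k \<and> guard_test \<alpha> (Q q) g} \<and>
      (if nmem t ''used'' 0 = 0 then marked t = marked s else marked s \<subset> marked t)" for k and t :: state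
  have "I (nmem s1 ''m'' 0) s2"
    unfolding s2_def
  proof (rule run_For[where I = I])
    fix k and t :: state
    assume t: "k < nmem s1 ''m'' 0" "nmem t ''q'' 0 = k" "I k t"
      "\<And>z. z \<notin> nmod (FFor ''q'' ''m'' try_prog) \<Longrightarrow> nmem t z = nmem s1 z" "\<And>z. z \<notin> rmod try_prog \<Longrightarrow> rmem t z = rmem s1 z"
    have k: "k < m" using t(1) m by (simp add: fn1)
    have int: "inputs t" using in1 by (subst inputs_cong[of t s1]) (auto simp: input_nvars_def input_rvars_def t(4,5))
    have rs: "rmem t ''s'' 0 = 3 / 4 * \<alpha>" using t(5)[of "''s''"] s(2) by (simp add: fr1)
    have cg: "cell t ''cx'' ''cy'' 0 = g" using t(5)[of "''cx''"] t(5)[of "''cy''"] by (simp add: cell_def s1_def)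
    note R = run_try[OF int rs t(2) k, unfolded cg]
    have "I (Suc k) (run try_prog t)"
    proof (cases "guard_test \<alpha> (Q k) g")
      case True
      have "marked (run try_prog t) = marked s \<union> {q. q < Suc k \<and> guard_test \<alpha> (Q q) g}"
        using R(1) True t(3) by (auto simp: I_def less_Suc_eq)
      moreover have "if nmem (run try_prog t) ''used'' 0 = 0 then marked (run try_prog t) = marked s else marked s \<subset> marked (run try_prog t)"
        using R True t(3) by (auto simp: I_def insert_absorb split: if_splits)
      ultimately show ?thesis unfolding I_def by blast
    next
      case False
      have e: "{q. q < Suc k \<and> guard_test \<alpha> (Q q) g} = {q. q < k \<and> guard_test \<alpha> (Q q) g}"
        using False by (auto simp: less_Suc_eq)
      have "marked (run try_prog t) = marked t" "nmem (run try_prog t) ''used'' 0 = nmem t ''used'' 0"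
        using R False by simp_all
      then show ?thesis using t(3) unfolding I_def e by metis
    qed
    moreover have "marked (nupd ''q'' 0 (Suc k) (run try_prog t)) = marked (run try_prog t)"
      "nmem (nupd ''q'' 0 (Suc k) (run try_prog t)) ''used'' 0 = nmem (run try_prog t) ''used'' 0"
      by (simp_all add: marked_nupd)
    ultimately show "I (Suc k) (nupd ''q'' 0 (Suc k) (run try_prog t))" unfolding I_def by metis
  qed (auto simp: I_def m1 s1_def marked_def)
  then have I2: "I m s2" using m by (simp add: fn1)
  have fn2: "nmem s2 x = nmem s x" if "x \<notin> {''q'', ''used'', ''e'', ''par'', ''done''}" for x
    using that fn1 by (simp add: s2_def run_frame del: run.simps)
  have fr2: "rmem s2 x = rmem s1 x" if "x \<notin> rmod try_prog" for x
    using that by (simp add: s2_def run_frame del: run.simps)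
  have cg2: "rmem s2 ''cx'' 0 = Re g" "rmem s2 ''cy'' 0 = Im g" by (simp_all add: fr2 s1_def)
  have out2: "output_points s2 = output_points s" by (simp add: output_points_def fn2 fr2 fr1)
  have guards: "robustly_guards_point P (\<alpha> / 2) g (Q q)" if "q < m" "guard_test \<alpha> (Q q) g" for q
    by (rule guard_test_sound[OF \<alpha> Q[OF that(1)] that(2)])
  have "correct (run grid_cell s) \<and> marked (run grid_cell s) = marked s2 \<and> nmem (run grid_cell s) ''k'' 0 \<le> Suc (nmem s ''k'' 0)"
  proof (cases "nmem s2 ''used'' 0 = 0")
    case True
    from I2 have "if nmem s2 ''used'' 0 = 0 then marked s2 = marked s else marked s \<subset> marked s2"
      unfolding I_def by blast
    then have "marked s2 = marked s" by (simp only: True simp_thms if_True)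
    then show ?thesis using c True out2 fn2[of "''k''"] by (simp add: fin correct_def)
  next
    case False
    then have sub: "marked s \<subset> marked s2" and m2: "marked s2 = marked s \<union> {q. q < m \<and> guard_test \<alpha> (Q q) g}"
      using I2 by (auto simp: I_def)
    let ?s = "run output_prog s2"
    have k: "nmem ?s ''k'' 0 = Suc (nmem s ''k'' 0)" using fn2[of "''k''"] by (simp add: output_prog_def)
    have m3: "marked ?s = marked s2" by (simp add: marked_def output_prog_def)
    have cells: "cell ?s ''gx'' ''gy'' i = (if i = nmem s ''k'' 0 then g else cell s2 ''gx'' ''gy'' i)" for i
      using cg2 fn2[of "''k''"] by (simp add: output_prog_def cell_def)
    have "output_points ?s = insert g (output_points s)"
      unfolding out2[symmetric] using k fn2[of "''k''"] by (auto simp: output_points_cell cells lessThan_Suc)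
    moreover have "g \<in> P" using sub m2 guards by (auto simp: robustly_guards_point_def)
    moreover have "card (marked s) < card (marked s2)" using sub by (intro psubset_card_mono) auto
    ultimately show ?thesis using c k False m2 m3 guards by (auto simp: fin correct_def)
  qed
  then show "correct (run grid_cell s)" "marked (run grid_cell s) = marked s \<union> {q. q < m \<and> guard_test \<alpha> (Q q) g}"
    "nmem (run grid_cell s) ''k'' 0 \<le> Suc (nmem s ''k'' 0)"
    using I2 by (auto simp: I_def)
qed

text \<open>The cells are visited in lexicographic order. Each outputs at most one point, which
  limits the price of a round.\<close>

lemma run_grid:
  assumes s: "inputs s" "rmem s ''s'' 0 = 3 / 4 * \<alpha>" and c: "correct s" and sel: "nmem s ''sel'' 0 = p" "p < m"
  defines "s' \<equiv> run (FFor ''i'' ''N10'' (FFor ''j'' ''N10'' grid_cell)) s"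
  shows "correct s'" "marked s' = marked s \<union>
      {q. q < m \<and> (\<exists>i<10 * N + 1. \<exists>j<10 * N + 1. guard_test \<alpha> (Q q) (grid (Q p) (rmem s ''F'' p) N i j))}"
    "nmem s' ''k'' 0 \<le> nmem s ''k'' 0 + (10 * N + 1) * (10 * N + 1)"
proof -
  let ?T = "\<lambda>q i j. guard_test \<alpha> (Q q) (grid (Q p) (rmem s ''F'' p) N i j)"
  let ?L = "10 * N + 1"
  define J where "J i j t \<longleftrightarrow> correct t \<and> marked t = marked s \<union> {q. q < m \<and> (\<exists>i'<?L. \<exists>j'<?L. (i' < i \<or> i' = i \<and> j' < j) \<and> ?T q i' j')}
      \<and> nmem t ''k'' 0 \<le> nmem s ''k'' 0 + i * ?L + j" for i j and t :: state
  have J_nupd: "J i j (nupd x y z t) \<longleftrightarrow> J i j t" if "x = ''i'' \<or> x = ''j''" for i j x y z and t :: state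
    using that by (elim disjE) (simp_all add: J_def correct_nupd marked_nupd)
  have next_row: "J i ?L t \<Longrightarrow> J (Suc i) 0 t" for i t
  proof -
    have "{q. q < m \<and> (\<exists>i'<?L. \<exists>j'<?L. (i' < i \<or> i' = i \<and> j' < ?L) \<and> ?T q i' j')} =
      {q. q < m \<and> (\<exists>i'<?L. \<exists>j'<?L. (i' < Suc i \<or> i' = Suc i \<and> j' < 0) \<and> ?T q i' j')}"
      by (auto simp: less_Suc_eq)
    then show "J i ?L t \<Longrightarrow> J (Suc i) 0 t" by (simp add: J_def)
  qed
  have N10: "nmem s ''N10'' 0 = ?L" using s by (simp add: inputs_def)
  have "J (nmem s ''N10'' 0) 0 s'"
    unfolding s'_def
  proof (rule run_For[where I = "\<lambda>i. J i 0"])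
    fix i and t :: state
    assume t: "i < nmem s ''N10'' 0" "nmem t ''i'' 0 = i" "J i 0 t"
      "\<And>z. z \<notin> nmod (FFor ''i'' ''N10'' (FFor ''j'' ''N10'' grid_cell)) \<Longrightarrow> nmem t z = nmem s z"
      "\<And>z. z \<notin> rmod (FFor ''j'' ''N10'' grid_cell) \<Longrightarrow> rmem t z = rmem s z"
    have tN: "nmem t ''N10'' 0 = ?L" using t(4)[of "''N10''"] N10 by simp
    have "J i (nmem t ''N10'' 0) (run (FFor ''j'' ''N10'' grid_cell) t)"
    proof (rule run_For[where I = "J i"])
      fix j and u :: state
      assume u: "j < nmem t ''N10'' 0" "nmem u ''j'' 0 = j" "J i j u"
        "\<And>z. z \<notin> nmod (FFor ''j'' ''N10'' grid_cell) \<Longrightarrow> nmem u z = nmem t z"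
        "\<And>z. z \<notin> rmod grid_cell \<Longrightarrow> rmem u z = rmem t z"
      have fn: "nmem u z = nmem s z" if "z \<notin> insert ''i'' (insert ''j'' (nmod grid_cell))" for z using u(4)[of z] t(4)[of z] that by simp
      have fr: "rmem u z = rmem s z" if "z \<notin> rmod grid_cell" for z using u(5)[of z] t(5)[of z] that by simp
      have inu: "inputs u" using s(1) by (subst inputs_cong[of u s]) (auto simp: input_nvars_def input_rvars_def fn fr)
      have v: "nmem u ''sel'' 0 = p" "nmem u ''i'' 0 = i" "rmem u ''s'' 0 = 3 / 4 * \<alpha>" "rmem u ''F'' = rmem s ''F''"
        using s sel t(2) u(4)[of "''i''"] by (simp_all add: fn fr)
      have cu: "correct u" using u(3) by (simp add: J_def)
      note R = run_grid_cell[OF inu v(3) cu, unfolded v u(2), OF sel(2)]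
      have ij: "i < ?L" "j < ?L" using t(1) u(1) N10 tN by simp_all
      have "{q. q < m \<and> (\<exists>i'<?L. \<exists>j'<?L. (i' < i \<or> i' = i \<and> j' < Suc j) \<and> ?T q i' j')} =
        {q. q < m \<and> (\<exists>i'<?L. \<exists>j'<?L. (i' < i \<or> i' = i \<and> j' < j) \<and> ?T q i' j')} \<union> {q. q < m \<and> ?T q i j}"
        using ij by (auto simp: less_Suc_eq)
      then have "J i (Suc j) (run grid_cell u)" using R u(3) by (simp add: J_def Un_assoc)
      then show "J i (Suc j) (nupd ''j'' 0 (Suc j) (run grid_cell u))" by (simp add: J_nupd)
    qed (use t(3) in \<open>simp_all add: J_nupd\<close>)
    then show "J (Suc i) 0 (nupd ''i'' 0 (Suc i) (run (FFor ''j'' ''N10'' grid_cell) t))"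
      using next_row tN by (simp add: J_nupd)
  qed (use c in \<open>simp_all add: J_nupd, simp add: J_def\<close>)
  then have J: "J ?L 0 s'" using N10 by simp
  then show "correct s'" "nmem s' ''k'' 0 \<le> nmem s ''k'' 0 + ?L * ?L" by (simp_all add: J_def)
  have "(\<exists>i'<?L. \<exists>j'<?L. (i' < ?L \<or> i' = ?L \<and> j' < 0) \<and> ?T q i' j') \<longleftrightarrow> (\<exists>i<?L. \<exists>j<?L. ?T q i j)" for q
    by auto
  then show "marked s' = marked s \<union> {q. q < m \<and> (\<exists>i<?L. \<exists>j<?L. ?T q i j)}" using J unfolding J_def by simp
qed

text \<open>Points chosen in different rounds have no common guard, so each guard of an optimal solution
  pays for at most one round.\<close>

definition separated :: "nat set \<Rightarrow> state \<Rightarrow> bool" where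
  "separated Sel s \<longleftrightarrow> Sel \<subseteq> marked s \<and> nmem s ''k'' 0 \<le> card Sel * ((10 * N + 1) * (10 * N + 1)) \<and>
     (\<forall>p\<in>Sel. \<forall>q<m. q \<noteq> p \<longrightarrow> q \<in> Sel \<or> q \<notin> marked s \<longrightarrow>
        (\<forall>g. \<not> (robustly_guards_point P \<alpha> g (Q p) \<and> robustly_guards_point P \<alpha> g (Q q))))"

text \<open>By the minimality of \<open>F p\<close>, an unmarked point sharing a guard with
  \<open>p\<close> is marked in this round by \<open>common_guard_grid\<close>, so \<open>p\<close>
  is separated from all that remain. It is separated from earlier selections because it was unmarked
  until now.\<close>

lemma separated_grid:
  assumes N: "100 \<le> real N * \<alpha>" and sep: "separated Sel s" and p: "p < m" "p \<notin> marked s"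
    and F: "\<And>q. q < m \<Longrightarrow> reach \<alpha> N (Q q) (F q)"
    and min: "\<And>q. q < m \<Longrightarrow> q \<notin> marked s \<Longrightarrow> F p \<le> F q"
    and s': "marked s' = marked s \<union>
      {q. q < m \<and> (\<exists>i<10 * N + 1. \<exists>j<10 * N + 1. guard_test \<alpha> (Q q) (grid (Q p) (F p) N i j))}"
    "nmem s' ''k'' 0 \<le> nmem s ''k'' 0 + (10 * N + 1) * (10 * N + 1)" "p \<in> marked s'"
  shows "separated (insert p Sel) s'"
proof -
  have pS: "p \<notin> Sel" and fS: "finite Sel" using sep p finite_subset[OF _ finite_marked[of s]] by (auto simp: separated_def)
  have k: "nmem s' ''k'' 0 \<le> card (insert p Sel) * ((10 * N + 1) * (10 * N + 1))"
    using sep s'(2) pS fS by (simp add: separated_def)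
  have new: "\<not> (robustly_guards_point P \<alpha> g (Q p) \<and> robustly_guards_point P \<alpha> g (Q q))"
    if "q < m" "q \<notin> marked s'" for q g
  proof
    assume g: "robustly_guards_point P \<alpha> g (Q p) \<and> robustly_guards_point P \<alpha> g (Q q)"
    have "q \<notin> marked s" using that s'(1) by auto
    then have "\<exists>i<10 * N + 1. \<exists>j<10 * N + 1. guard_test \<alpha> (Q q) (grid (Q p) (F p) N i j)"
      using common_guard_grid[OF \<alpha> N F[OF p(1)] F[OF that(1)] min[OF that(1)]] g by blast
    then show False using that s'(1) by auto
  qed
  have old: "\<not> (robustly_guards_point P \<alpha> g (Q a) \<and> robustly_guards_point P \<alpha> g (Q b))"
    if "a \<in> Sel" "b < m" "b \<noteq> a" "b \<in> Sel \<or> b \<notin> marked s" for a b g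
    using sep that unfolding separated_def by blast
  have sub: "marked s \<subseteq> marked s'" "Sel \<subseteq> marked s" "Sel \<subseteq> {..<m}"
    using s'(1) sep marked_subset[of s] by (auto simp: separated_def)
  have "\<not> (robustly_guards_point P \<alpha> g (Q a) \<and> robustly_guards_point P \<alpha> g (Q b))"
    if a: "a \<in> insert p Sel" and b: "b < m" "b \<noteq> a" "b \<in> insert p Sel \<or> b \<notin> marked s'" for a b g
  proof (cases "a = p")
    case True
    then show ?thesis using b new[OF b(1)] old[of b p g] p pS sub by blast
  next
    case False
    then show ?thesis using a b old[of a b g] p sub by blast
  qed
  then show ?thesis using k s'(3) sub unfolding separated_def by blast
qed

lemma separated_card:
  assumes sep: "separated Sel s" and G: "finite G" "\<And>q. q < m \<Longrightarrow> \<exists>g\<in>G. robustly_guards_point P \<alpha> g (Q q)"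
  shows "card Sel \<le> card G"
proof -
  have "\<forall>q. \<exists>g. q < m \<longrightarrow> g \<in> G \<and> robustly_guards_point P \<alpha> g (Q q)" using G(2) by blast
  then obtain f where f: "\<And>q. q < m \<Longrightarrow> f q \<in> G \<and> robustly_guards_point P \<alpha> (f q) (Q q)" by metis
  have sub: "Sel \<subseteq> {..<m}" using sep marked_subset[of s] by (auto simp: separated_def)
  have "inj_on f Sel"
  proof (rule inj_onI, rule ccontr)
    fix a b assume ab: "a \<in> Sel" "b \<in> Sel" "f a = f b" "a \<noteq> b"
    then show False using sep f[of a] f[of b] sub unfolding separated_def by (metis lessThan_iff subsetD)
  qed
  moreover have "f ` Sel \<subseteq> G" using f sub by auto
  ultimately show ?thesis using G(1) by (rule card_inj_on_le)
qed

text \<open>After \<open>k\<close> rounds at least \<open>k\<close> points are marked, unless all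
  are; so \<open>m\<close> rounds mark all of them. Correctness holds at every resolution,
  separation at a sufficiently fine one.\<close>

lemma run_greedy:
  assumes s: "inputs s" and F: "\<And>q. q < m \<Longrightarrow> reach \<alpha> N (Q q) (rmem s ''F'' q)"
    and init: "nmem s ''k'' 0 = 0" "\<And>q. nmem s ''done'' q = 0"
  defines "s' \<equiv> run greedy_prog s"
  shows "correct s'" "marked s' = {..<m}" "100 \<le> real N * \<alpha> \<Longrightarrow> \<exists>Sel. separated Sel s'"
proof -
  let ?grid = "FFor ''i'' ''N10'' (FFor ''j'' ''N10'' grid_cell)"
  let ?c = "select_prog ;;; FCond (NLess (N0 ''sel'') (N0 ''m'')) ?grid FSkip"
  define s1 where "s1 = rupd ''s'' 0 (3 / 4 * \<alpha>) s"
  have run_s1: "s' = run (FFor ''it'' ''m'' ?c) s1" using s by (simp add: s'_def greedy_prog_def s1_def inputs_def)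
  have in1: "inputs s1" using s by (subst inputs_cong[of s1 s]) (auto simp: input_nvars_def input_rvars_def s1_def)
  have m: "nmem s1 ''m'' 0 = m" using in1 by (simp add: inputs_def)
  define I where "I k t \<longleftrightarrow> correct t \<and> (k \<le> card (marked t) \<or> marked t = {..<m}) \<and>
    (100 \<le> real N * \<alpha> \<longrightarrow> (\<exists>Sel. separated Sel t))" for k :: nat and t :: state
  have mk0: "marked s1 = {}" using init by (auto simp: marked_def s1_def)
  have "I (nmem s1 ''m'' 0) s'"
    unfolding run_s1
  proof (rule run_For[where I = I])
    have "correct (nupd ''it'' 0 0 s1)" "separated {} (nupd ''it'' 0 0 s1)"
      using mk0 init by (auto simp: correct_def separated_def output_points_def marked_def s1_def)
    then show "I 0 (nupd ''it'' 0 0 s1)" unfolding I_def by auto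
    fix k and t :: state
    assume t: "k < nmem s1 ''m'' 0" "nmem t ''it'' 0 = k" "I k t"
      "\<And>z. z \<notin> nmod (FFor ''it'' ''m'' ?c) \<Longrightarrow> nmem t z = nmem s1 z" "\<And>z. z \<notin> rmod ?c \<Longrightarrow> rmem t z = rmem s1 z"
    define u where "u = run select_prog t"
    have int: "inputs t" using in1 by (subst inputs_cong[of t s1]) (auto simp: input_nvars_def input_rvars_def t(4,5))
    then have inu: "inputs u" by (simp add: u_def inputs_run input_nvars_def)
    have um: "nmem u ''m'' 0 = m" using inu by (simp add: inputs_def)
    have frame: "nmem u ''done'' = nmem t ''done''" "nmem u ''k'' = nmem t ''k''" "rmem u = rmem t"
      by (simp_all add: u_def run_frame fun_eq_iff)
    have same: "correct u = correct t" "marked u = marked t" "separated Sel u = separated Sel t" for Sel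
      by (simp_all add: correct_def marked_def separated_def output_points_def frame)
    have rs: "rmem u ''s'' 0 = 3 / 4 * \<alpha>" using t(5)[of "''s''"] by (simp add: frame s1_def)
    have rF: "rmem t ''F'' = rmem s ''F''" using t(5)[of "''F''"] by (simp add: s1_def)
    have "I (Suc k) (run ?c t)"
    proof (cases "nmem u ''sel'' 0 < m")
      case False
      then have "marked t = {..<m}" using run_select[OF int] by (simp add: u_def)
      then show ?thesis using t(3) False um by (simp add: u_def[symmetric] I_def same)
    next
      case True
      define p where "p = nmem u ''sel'' 0"
      have p: "p < m" "p \<notin> marked t" "\<And>q. q < m \<Longrightarrow> q \<notin> marked t \<Longrightarrow> rmem s ''F'' p \<le> rmem s ''F'' q"
        using run_select[OF int] True by (auto simp: u_def[symmetric] p_def rF)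
      define w where "w = run ?grid u"
      have cu: "correct u" using t(3) by (simp add: same I_def)
      note G = run_grid[OF inu rs cu p_def[symmetric] p(1), folded w_def, unfolded same frame rF]
      \<comment> \<open>The central grid point is \<open>p\<close> itself, so the selected point is
        marked whatever its reach and the resolution.\<close>
      have "grid (Q p) (rmem s ''F'' p) N (5 * N) (5 * N) = Q p" by (simp add: grid_def)
      then have "guard_test \<alpha> (Q p) (grid (Q p) (rmem s ''F'' p) N (5 * N) (5 * N))" by (simp add: guard_test_def)
      moreover have "5 * N < 10 * N + 1" by simp
      ultimately have pw: "p \<in> marked w" unfolding G(2) using p(1) by blast
      have "insert p (marked t) \<subseteq> marked w" using pw unfolding G(2) by blast
      then have "card (insert p (marked t)) \<le> card (marked w)" by (intro card_mono) auto
      then have "Suc k \<le> card (marked w) \<or> marked w = {..<m}"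
        using t(3) p(1,2) G(2) marked_subset[of w] by (auto simp: I_def)
      moreover have "\<exists>Sel. separated Sel w" if "100 \<le> real N * \<alpha>"
        using t(3) that separated_grid[OF that _ p(1,2) F p(3) G(2,3) pw] unfolding I_def by blast
      ultimately have "I (Suc k) w" using G(1) by (simp add: I_def)
      moreover have "run ?c t = w" using True um by (simp add: u_def[symmetric] w_def del: run.simps(6))
      ultimately show ?thesis by (simp only:)
    qed
    then show "I (Suc k) (nupd ''it'' 0 (Suc k) (run ?c t))"
      by (simp add: I_def correct_def marked_def separated_def output_points_def del: run.simps)
  qed simp
  then have I: "I m s'" using m by simp
  then show "correct s'" "100 \<le> real N * \<alpha> \<Longrightarrow> \<exists>Sel. separated Sel s'" by (auto simp: I_def)
  show "marked s' = {..<m}"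
    using I card_subset_eq[OF _ marked_subset[of s']] card_mono[OF _ marked_subset[of s']] by (auto simp: I_def)
qed

end

section \<open>From a list of cyclic lists to a flat array of edges\<close>

subsection \<open>Successor indices\<close>

text \<open>Concatenation forgets where curves end; this function recovers the cyclic successor
  within each curve.\<close>

fun succ_index :: "complex list list \<Rightarrow> nat \<Rightarrow> nat" where
  "succ_index [] i = 0"
| "succ_index (c # cs) i =
     (if i < length c then (if Suc i < length c then Suc i else 0) else length c + succ_index cs (i - length c))"

lemma succ_index_append:
  "j < length c \<Longrightarrow> succ_index (pre @ c # cs) (length (concat pre) + j) =
     length (concat pre) + (if Suc j < length c then Suc j else 0)"
  by (induction pre) auto

lemma succ_index_vertex:
  assumes "i < length c"
  shows "concat (c # cs) ! succ_index (c # cs) i = succ_vertex c i"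
proof (cases "Suc i < length c")
  case False
  then have "Suc i = length c" using assms by simp
  then have "Suc i mod length c = 0" by simp
  moreover have "0 < length c" using assms by linarith
  ultimately show ?thesis using assms False by (simp add: succ_vertex_def nth_append del: length_greater_0_conv)
qed (use assms in \<open>simp add: succ_vertex_def nth_append\<close>)

text \<open>The relation \<open>R\<close> is arbitrary so that one decomposition serves both the
  count of crossings and the union of the edges.\<close>

lemma concat_edges:
  "{i. i < length (concat (c # cs)) \<and> R (concat (c # cs) ! i) (concat (c # cs) ! succ_index (c # cs) i)} =
   {i. i < length c \<and> R (c ! i) (succ_vertex c i)} \<union>
   (\<lambda>i. length c + i) ` {i. i < length (concat cs) \<and> R (concat cs ! i) (concat cs ! succ_index cs i)}"
  (is "?L = ?A \<union> ?B")
proof -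
  have "i \<in> ?L \<longleftrightarrow> i \<in> ?A \<union> ?B" for i
  proof (cases "i < length c")
    case True
    then show ?thesis using succ_index_vertex[OF True, of cs] by (auto simp: nth_append simp del: succ_index.simps)
  next
    case False
    then obtain k where "i = length c + k" using le_Suc_ex not_less by blast
    then show ?thesis by (auto simp: nth_append)
  qed
  then show ?thesis by blast
qed

lemma card_concat_edges:
  "card {i. i < length (concat cs) \<and> R (concat cs ! i) (concat cs ! succ_index cs i)} =
   (\<Sum>c\<leftarrow>cs. card {i. i < length c \<and> R (c ! i) (succ_vertex c i)})"
proof (induction cs)
  case (Cons c cs)
  have "card {i. i < length (concat (c # cs)) \<and> R (concat (c # cs) ! i) (concat (c # cs) ! succ_index (c # cs) i)} =
    card {i. i < length c \<and> R (c ! i) (succ_vertex c i)} +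
    card ((\<lambda>i. length c + i) ` {i. i < length (concat cs) \<and> R (concat cs ! i) (concat cs ! succ_index cs i)})"
    unfolding concat_edges by (rule card_Un_disjoint) auto
  also have "card ((\<lambda>i. length c + i) ` {i. i < length (concat cs) \<and> R (concat cs ! i) (concat cs ! succ_index cs i)}) =
    card {i. i < length (concat cs) \<and> R (concat cs ! i) (concat cs ! succ_index cs i)}"
    by (rule card_image) simp
  finally show ?case using Cons by (simp only: list.map sum_list.Cons)
qed simp

lemma Un_concat_edges:
  "(\<Union>i<length (concat cs). closed_segment (concat cs ! i) (concat cs ! succ_index cs i)) = (\<Union>c\<in>set cs. curve c)"
proof -
  have "(\<exists>i<length (concat cs). R (concat cs ! i) (concat cs ! succ_index cs i)) \<longleftrightarrow>
    (\<exists>c\<in>set cs. \<exists>i<length c. R (c ! i) (succ_vertex c i))" for R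
  proof (induction cs)
    case (Cons c cs)
    have "(\<exists>i<length (concat (c # cs)). R (concat (c # cs) ! i) (concat (c # cs) ! succ_index (c # cs) i)) \<longleftrightarrow>
      {i. i < length (concat (c # cs)) \<and> R (concat (c # cs) ! i) (concat (c # cs) ! succ_index (c # cs) i)} \<noteq> {}" by blast
    also have "\<dots> \<longleftrightarrow> (\<exists>i<length c. R (c ! i) (succ_vertex c i)) \<or>
      (\<exists>i<length (concat cs). R (concat cs ! i) (concat cs ! succ_index cs i))"
      unfolding concat_edges by blast
    finally show ?case using Cons by simp
  qed simp
  note E = this
  show ?thesis
  proof (rule set_eqI)
    fix x
    show "x \<in> (\<Union>i<length (concat cs). closed_segment (concat cs ! i) (concat cs ! succ_index cs i)) \<longleftrightarrow>
        x \<in> (\<Union>c\<in>set cs. curve c)"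
      using E[of "\<lambda>a b. x \<in> closed_segment a b"]
      unfolding UN_iff curve_def edge_def Bex_def lessThan_iff .
  qed
qed

lemma planar_domain_polygonal:
  assumes pd: "polygonal_domain outer holes"
  defines "V \<equiv> concat (outer # holes)"
  shows "planar_domain (domain_set outer holes) (length V) (\<lambda>i. V ! i) (\<lambda>i. V ! succ_index (outer # holes) i)"
proof
  have Un: "(\<Union>i<length V. closed_segment (V ! i) (V ! succ_index (outer # holes) i)) = domain_curves outer holes"
    unfolding V_def domain_curves_def by (rule Un_concat_edges)
  show "frontier (domain_set outer holes) \<subseteq> (\<Union>i<length V. closed_segment (V ! i) (V ! succ_index (outer # holes) i))"
    unfolding Un by (rule frontier_domain_set[OF pd])
  show "z \<notin> interior (domain_set outer holes)"
    if "i < length V" "z \<in> closed_segment (V ! i) (V ! succ_index (outer # holes) i)" for i z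
    using that Un by (intro domain_closure_complement[OF pd]) blast
  show "z \<in> domain_set outer holes \<longleftrightarrow> odd (card {i. i < length V \<and> crosses z (V ! i) (V ! succ_index (outer # holes) i)})"
    if "\<And>i. i < length V \<Longrightarrow> z \<notin> closed_segment (V ! i) (V ! succ_index (outer # holes) i)" for z
  proof -
    have "z \<notin> domain_curves outer holes" unfolding Un[symmetric] using that by blast
    from domain_parity[OF pd this] show ?thesis
      unfolding V_def card_concat_edges crossing_number_def .
  qed
  show "domain_set outer holes \<subseteq> K" if "convex K" "\<And>i. i < length V \<Longrightarrow> V ! i \<in> K" for K
  proof (rule domain_set_bounded_by[OF pd that(1)])
    show "set outer \<subseteq> K"
    proof
      fix x assume "x \<in> set outer"
      then have "x \<in> set V" by (simp add: V_def)
      then show "x \<in> K" using that(2) by (auto simp: in_set_conv_nth)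
    qed
  qed
qed

text \<open>\<open>st\<close> is the index at which the current curve starts and \<open>cv\<close>
  its number. At the last vertex of a curve the successor wraps back to \<open>st\<close>.\<close>

definition next_prog :: fcom where
  "next_prog =
     FFor ''i'' ''n''
       (FCond (NLess (NSub (NAdd (N0 ''i'') (NConst 1)) (N0 ''st'')) (NGet ''len'' (N0 ''cv'')))
         (FNSet ''nx'' (N0 ''i'') (NAdd (N0 ''i'') (NConst 1)))
         (FNSet ''nx'' (N0 ''i'') (N0 ''st'') ;;; setn ''st'' (NAdd (N0 ''i'') (NConst 1)) ;;;
          setn ''cv'' (NAdd (N0 ''cv'') (NConst 1))))"

lemma run_next:
  assumes n: "nmem s ''n'' 0 = length (concat cs)" and len: "nmem s ''len'' = nth_default 0 (map length cs)"
    and init: "nmem s ''st'' 0 = 0" "nmem s ''cv'' 0 = 0" and ne: "[] \<notin> set cs"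
  shows "\<forall>i<length (concat cs). nmem (run next_prog s) ''nx'' i = succ_index cs i"
proof -
  \<comment> \<open>The list is split into finished curves and the rest, and \<open>i\<close> lies
    within the first curve of the rest. An empty curve would break this, hence the assumption
    \<open>ne\<close>.\<close>
  define I where "I i t \<longleftrightarrow> (\<exists>pre suf. cs = pre @ suf \<and> nmem t ''cv'' 0 = length pre \<and>
      nmem t ''st'' 0 = length (concat pre) \<and> length (concat pre) \<le> i \<and>
      (\<forall>c suf'. suf = c # suf' \<longrightarrow> i < length (concat pre) + length c)) \<and>
      (\<forall>i'<i. nmem t ''nx'' i' = succ_index cs i')" for i and t :: state
  have "I (nmem s ''n'' 0) (run next_prog s)"
    unfolding next_prog_def
  proof (rule run_For[where I = I])
    have "I 0 s" unfolding I_def using init ne by (intro conjI exI[of _ "[]"] exI[of _ cs]) auto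
    then show "I 0 (nupd ''i'' 0 0 s)" by (simp add: I_def)
    fix i and t :: state
    let ?c = "FCond (NLess (NSub (NAdd (N0 ''i'') (NConst 1)) (N0 ''st'')) (NGet ''len'' (N0 ''cv'')))
         (FNSet ''nx'' (N0 ''i'') (NAdd (N0 ''i'') (NConst 1)))
         (FNSet ''nx'' (N0 ''i'') (N0 ''st'') ;;; setn ''st'' (NAdd (N0 ''i'') (NConst 1)) ;;;
          setn ''cv'' (NAdd (N0 ''cv'') (NConst 1)))"
    assume t: "i < nmem s ''n'' 0" "nmem t ''i'' 0 = i" "I i t"
      "\<And>z. z \<notin> nmod (FFor ''i'' ''n'' ?c) \<Longrightarrow> nmem t z = nmem s z"
    have lt: "nmem t ''len'' = nth_default 0 (map length cs)" using t(4)[of "''len''"] len by simp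
    obtain pre suf where ps: "cs = pre @ suf" "nmem t ''cv'' 0 = length pre" "nmem t ''st'' 0 = length (concat pre)"
      "length (concat pre) \<le> i" "\<And>c suf'. suf = c # suf' \<Longrightarrow> i < length (concat pre) + length c"
      and nx: "\<And>i'. i' < i \<Longrightarrow> nmem t ''nx'' i' = succ_index cs i'"
      using t(3) unfolding I_def by blast
    have "suf \<noteq> []" using t(1) ps(1,4) n by auto
    then obtain c suf' where suf: "suf = c # suf'" by (cases suf) auto
    define j where "j = i - length (concat pre)"
    have j: "i = length (concat pre) + j" "j < length c" using ps(4) ps(5)[OF suf] by (auto simp: j_def)
    have lc: "nth_default 0 (map length cs) (length pre) = length c"
      using ps(1) suf by (simp add: nth_default_def nth_append)
    have si: "succ_index cs i = length (concat pre) + (if Suc j < length c then Suc j else 0)"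
      unfolding ps(1) suf j(1) by (rule succ_index_append[OF j(2)])
    have Sj: "Suc i - length (concat pre) = Suc j" using j by simp
    have "I (Suc i) (run ?c t)"
    proof (cases "Suc j < length c")
      case True
      have r: "run ?c t = nupd ''nx'' i (Suc i) t" using True t(2) ps(2,3) lt lc Sj by simp
      have "nmem (run ?c t) ''nx'' i' = succ_index cs i'" if "i' < Suc i" for i'
        using that nx si True j(1) unfolding r by (auto simp: less_Suc_eq)
      moreover have "\<exists>pre suf. cs = pre @ suf \<and> nmem (run ?c t) ''cv'' 0 = length pre \<and>
        nmem (run ?c t) ''st'' 0 = length (concat pre) \<and> length (concat pre) \<le> Suc i \<and>
        (\<forall>c suf'. suf = c # suf' \<longrightarrow> Suc i < length (concat pre) + length c)"
        using ps(1-4) suf True j unfolding r by (intro exI[of _ pre] exI[of _ suf]) simp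
      ultimately show ?thesis unfolding I_def by blast
    next
      case False
      have r: "run ?c t = nupd ''cv'' 0 (Suc (length pre)) (nupd ''st'' 0 (Suc i) (nupd ''nx'' i (length (concat pre)) t))"
        using False t(2) ps(2,3) lt lc Sj by simp
      have Si: "Suc i = length (concat (pre @ [c]))" using False j by simp
      have "nmem (run ?c t) ''nx'' i' = succ_index cs i'" if "i' < Suc i" for i'
        using that nx si False unfolding r by (auto simp: less_Suc_eq)
      moreover have "\<exists>pre suf. cs = pre @ suf \<and> nmem (run ?c t) ''cv'' 0 = length pre \<and>
        nmem (run ?c t) ''st'' 0 = length (concat pre) \<and> length (concat pre) \<le> Suc i \<and>
        (\<forall>c suf'. suf = c # suf' \<longrightarrow> Suc i < length (concat pre) + length c)"
        using ps(1) suf ne unfolding r Si by (intro exI[of _ "pre @ [c]"] exI[of _ suf']) auto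
      ultimately show ?thesis unfolding I_def by blast
    qed
    then show "I (Suc i) (nupd ''i'' 0 (Suc i) (run ?c t))" by (simp add: I_def del: run.simps)
  qed simp
  then show ?thesis using n by (simp add: I_def)
qed

text \<open>Reals cannot be converted to naturals, so the least \<open>N\<close> with
  \<open>real N * \<alpha> \<ge> 100\<close> is found by counting up to the limit \<open>h\<close>.
  The last conclusion of \<open>run_count\<close> expresses minimality.\<close>

definition count_prog :: fcom where
  "count_prog =
     FFor ''i'' ''h''
       (FCond (RLess (RMul (RNat (N0 ''N'')) (R0 ''alpha'')) (RNat (NConst 100)))
         (setn ''N'' (NAdd (N0 ''N'') (NConst 1))) FSkip)"

lemma run_count:
  fixes s
  assumes \<alpha>: "rmem s ''alpha'' 0 = \<alpha>" and init: "nmem s ''N'' 0 = 0"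
  defines "N \<equiv> nmem (run count_prog s) ''N'' 0"
  shows "N \<le> nmem s ''h'' 0" "N < nmem s ''h'' 0 \<Longrightarrow> 100 \<le> real N * \<alpha>" "N = 0 \<or> real (N - 1) * \<alpha> < 100"
proof -
  let ?c = "FCond (RLess (RMul (RNat (N0 ''N'')) (R0 ''alpha'')) (RNat (NConst 100)))
         (setn ''N'' (NAdd (N0 ''N'') (NConst 1))) FSkip"
  define I where "I k N \<longleftrightarrow> N \<le> k \<and> (N < k \<longrightarrow> 100 \<le> real N * \<alpha>) \<and> (N = 0 \<or> real (N - 1) * \<alpha> < 100)" for k N
  have "I (nmem s ''h'' 0) (nmem (run count_prog s) ''N'' 0)"
    unfolding count_prog_def
  proof (rule run_For[where I = "\<lambda>k t. I k (nmem t ''N'' 0)"])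
    fix k and t :: state
    assume t: "k < nmem s ''h'' 0" "nmem t ''i'' 0 = k" "I k (nmem t ''N'' 0)" "\<And>z. z \<notin> rmod ?c \<Longrightarrow> rmem t z = rmem s z"
    then have "rmem t ''alpha'' 0 = \<alpha>" using \<alpha> by simp
    then have "nmem (run ?c t) ''N'' 0 = (if real (nmem t ''N'' 0) * \<alpha> < 100 then Suc (nmem t ''N'' 0) else nmem t ''N'' 0)" by simp
    moreover have "I (Suc k) (if real (nmem t ''N'' 0) * \<alpha> < 100 then Suc (nmem t ''N'' 0) else nmem t ''N'' 0)"
      using t(3) unfolding I_def by (auto simp: not_less)
    ultimately show "I (Suc k) (nmem (nupd ''i'' 0 (Suc k) (run ?c t)) ''N'' 0)" by (simp del: run.simps)
  qed (use init in \<open>simp_all add: I_def\<close>)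
  then show "N \<le> nmem s ''h'' 0" "N < nmem s ''h'' 0 \<Longrightarrow> 100 \<le> real N * \<alpha>" "N = 0 \<or> real (N - 1) * \<alpha> < 100"
    by (simp_all add: I_def N_def)
qed

section \<open>Assembly, running time and approximation ratio\<close>

subsection \<open>The complete program\<close>

text \<open>Four phases, because \<open>h\<close>, \<open>N2\<close> and \<open>N10\<close> are
  computed and later bound loops, whereas within one phase \<open>compile_exec\<close> admits no
  assignment to a loop bound.\<close>

definition setup1 :: fcom where "setup1 = setn ''h'' (nmul 100 (N0 ''m''))"
definition setup2 :: fcom where "setup2 = next_prog ;;; count_prog"
definition setup3 :: fcom where
  "setup3 = setn ''N2'' (NAdd (nmul 2 (N0 ''N'')) (NConst 1)) ;;; setn ''N10'' (NAdd (nmul 10 (N0 ''N'')) (NConst 1))"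
definition main :: fcom where "main = reach_prog ;;; greedy_prog"

definition guard_prog :: com where
  "guard_prog = Seq (compile setup1) (Seq (compile setup2) (Seq (compile setup3) (compile main)))"

lemma setup_mod:
  "nmod setup1 = {''h''}" "rmod setup1 = {}" "counters_ok setup1" "bounds setup1 = {}"
  "nmod setup2 = {''i'', ''nx'', ''st'', ''cv'', ''N''}" "rmod setup2 = {}" "counters_ok setup2" "bounds setup2 = {''n'', ''h''}"
  "nmod setup3 = {''N2'', ''N10''}" "rmod setup3 = {}" "counters_ok setup3" "bounds setup3 = {}"
  "counters_ok main" "bounds main = {''n'', ''m'', ''N2'', ''N10''}"
  "nmod main = nmod reach_prog \<union> nmod greedy_prog"
  by (auto simp: setup1_def setup2_def setup3_def main_def next_prog_def count_prog_def)

lemma guard_prog_time: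
  fixes s0 :: state
  defines "s1 \<equiv> run setup1 s0" and "s2 \<equiv> run setup2 (run setup1 s0)" and "s3 \<equiv> run setup3 (run setup2 (run setup1 s0))"
  assumes "nmem s1 ''n'' 0 \<le> M" "nmem s1 ''h'' 0 \<le> M"
    "nmem s3 ''n'' 0 \<le> M" "nmem s3 ''m'' 0 \<le> M" "nmem s3 ''N2'' 0 \<le> M" "nmem s3 ''N10'' 0 \<le> M"
  shows "\<exists>t\<le>cost M (setup1 ;;; setup2 ;;; setup3 ;;; main). exec guard_prog s0 t (run main s3)"
proof -
  obtain t1 where t1: "t1 \<le> cost M setup1" "exec (compile setup1) s0 t1 s1"
    using compile_exec[of setup1 s0 M] by (auto simp: setup_mod s1_def)
  obtain t2 where t2: "t2 \<le> cost M setup2" "exec (compile setup2) s1 t2 s2"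
    using compile_exec[of setup2 s1 M] assms(4,5) by (auto simp: setup_mod s1_def s2_def)
  obtain t3 where t3: "t3 \<le> cost M setup3" "exec (compile setup3) s2 t3 s3"
    using compile_exec[of setup3 s2 M] by (auto simp: setup_mod s2_def s3_def)
  obtain t4 where t4: "t4 \<le> cost M main" "exec (compile main) s3 t4 (run main s3)"
    using compile_exec[of main s3 M] assms(6-9) by (auto simp: setup_mod)
  have "exec guard_prog s0 (t1 + (t2 + (t3 + t4))) (run main s3)"
    unfolding guard_prog_def by (intro exec.Seq) (use t1 t2 t3 t4 in auto)
  moreover have "t1 + (t2 + (t3 + t4)) \<le> cost M (setup1 ;;; setup2 ;;; setup3 ;;; main)"
    using t1 t2 t3 t4 by simp
  ultimately show ?thesis by blast
qed

text \<open>The premise gives \<open>real N * \<alpha> < 100 + \<alpha>\<close>, hence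
  \<open>(10 * real N + 1) * \<alpha> \<le> 1011\<close>, and the square of 1011 is below
  1100000.\<close>

lemma guard_count_bound:
  fixes \<alpha> :: real
  assumes \<alpha>: "0 < \<alpha>" "\<alpha> \<le> 1" and N: "1 \<le> N" "real (N - 1) * \<alpha> < 100"
  shows "real ((10 * N + 1) * (10 * N + 1)) \<le> 1100000 / \<alpha>\<^sup>2"
proof -
  have "(real N - 1) * \<alpha> < 100" using N by (simp add: of_nat_diff)
  then have "(10 * real N + 1) * \<alpha> \<le> 1011" using \<alpha> by (simp add: algebra_simps)
  then have "((10 * real N + 1) * \<alpha>)\<^sup>2 \<le> 1011\<^sup>2" using \<alpha> by (intro power_mono) auto
  then have "(10 * real N + 1)\<^sup>2 * \<alpha>\<^sup>2 \<le> 1100000" by (simp add: power_mult_distrib)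
  then have "(10 * real N + 1)\<^sup>2 \<le> 1100000 / \<alpha>\<^sup>2" using \<alpha> by (simp add: pos_le_divide_eq)
  then show ?thesis by (simp add: power2_eq_square algebra_simps)
qed

lemma guard_prog_correct:
  fixes outer holes ps \<alpha>
  defines "P \<equiv> domain_set outer holes" and "n \<equiv> num_vertices outer holes" and "m \<equiv> length ps"
  assumes pd: "polygonal_domain outer holes" and \<alpha>: "0 < \<alpha>" "\<alpha> \<le> 1" and S: "set ps \<subseteq> P"
    and OPT: "finite OPT" "robustly_guards P \<alpha> OPT (set ps)"
  shows "\<exists>t s. exec guard_prog (input_state outer holes ps \<alpha>) t s \<and>
    t \<le> cost (1001 * (n + m)) (setup1 ;;; setup2 ;;; setup3 ;;; main) \<and>
    robustly_guards P (\<alpha> / 2) (output_points s) (set ps) \<and>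
    real (card (output_points s)) \<le> 1100000 / \<alpha>\<^sup>2 * real (card OPT)"
proof -
  let ?cs = "outer # holes"
  let ?V = "concat ?cs"
  define s0 where "s0 = input_state outer holes ps \<alpha>"
  define s1 where "s1 = run setup1 s0"
  define s2 where "s2 = run setup2 s1"
  define s3 where "s3 = run setup3 s2"
  define N where "N = nmem s2 ''N'' 0"
  have n: "n = length ?V" by (simp add: n_def num_vertices_def)
  have sp: "simple_polygon c" if "c \<in> set ?cs" for c using polygonal_domain_simple[OF pd that] .
  have ne: "[] \<notin> set ?cs"
  proof
    assume "[] \<in> set ?cs"
    from sp[OF this] show False by (simp add: simple_polygon_def)
  qed
  have n1: "1 \<le> n" using sp[of outer] by (simp add: n simple_polygon_def)
  have i0: "nmem s0 ''n'' 0 = n" "nmem s0 ''m'' 0 = m" "nmem s0 ''len'' = nth_default 0 (map length ?cs)"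
    "nmem s0 ''st'' 0 = 0" "nmem s0 ''cv'' 0 = 0" "nmem s0 ''N'' 0 = 0" "nmem s0 ''k'' 0 = 0" "\<And>q. nmem s0 ''done'' q = 0"
    "rmem s0 ''alpha'' 0 = \<alpha>" "rmem s0 ''px'' = nth_default 0 (map Re ?V)" "rmem s0 ''py'' = nth_default 0 (map Im ?V)"
    "rmem s0 ''sx'' = nth_default 0 (map Re ps)" "rmem s0 ''sy'' = nth_default 0 (map Im ps)"
    by (simp_all add: s0_def input_state_def n_def m_def)
  have f1: "x \<noteq> ''h'' \<Longrightarrow> nmem s1 x = nmem s0 x" "rmem s1 y = rmem s0 y" for x y
    by (simp_all add: s1_def run_frame setup_mod)
  have h: "nmem s1 ''h'' 0 = 100 * m" using i0 by (simp add: s1_def setup1_def)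
  have f2: "x \<notin> {''i'', ''nx'', ''st'', ''cv'', ''N''} \<Longrightarrow> nmem s2 x = nmem s1 x" "rmem s2 y = rmem s1 y" for x y
    by (simp_all add: s2_def run_frame setup_mod)
  have f3: "x \<noteq> ''N2'' \<Longrightarrow> x \<noteq> ''N10'' \<Longrightarrow> nmem s3 x = nmem s2 x" "rmem s3 y = rmem s2 y" for x y
    by (simp_all add: s3_def run_frame setup_mod)
  have N3: "nmem s3 ''N2'' 0 = 2 * N + 1" "nmem s3 ''N10'' 0 = 10 * N + 1" "nmem s3 ''N'' 0 = N"
    by (simp_all add: s3_def setup3_def N_def)
  define t1 where "t1 = run next_prog s1"
  have t1: "nmem t1 ''h'' 0 = 100 * m" "nmem t1 ''N'' 0 = 0" "rmem t1 ''alpha'' 0 = \<alpha>"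
    using h i0 f1 by (simp_all add: t1_def next_prog_def run_frame del: run.simps)
  have s2: "s2 = run count_prog t1" by (simp add: s2_def setup2_def t1_def)
  note C = run_count[OF t1(3,2), folded s2, folded N_def, unfolded t1(1)]
  have "\<forall>i<n. nmem t1 ''nx'' i = succ_index ?cs i"
    unfolding t1_def n by (rule run_next) (use i0 f1 ne n in simp_all)
  moreover have "nmem s2 ''nx'' = nmem t1 ''nx''" unfolding s2 by (simp add: count_prog_def run_frame del: run.simps)
  ultimately have nx: "nmem s3 ''nx'' i = succ_index ?cs i" if "i < n" for i using that f3 by simp
  interpret pd: planar_domain P n "\<lambda>i. ?V ! i" "\<lambda>i. ?V ! succ_index ?cs i"
    unfolding P_def n by (rule planar_domain_polygonal[OF pd])
  interpret G: guard_input P n "\<lambda>i. ?V ! i" "\<lambda>i. ?V ! succ_index ?cs i" \<alpha> m "\<lambda>q. ps ! q" N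
    using \<alpha> S by unfold_locales (auto simp: m_def)
  have si: "succ_index cs i < length (concat cs)" if "i < length (concat cs)" for cs i
    using that by (induction cs i rule: succ_index.induct) auto
  have nd: "nth_default 0 (map f xs) i = f (xs ! i)" if "i < length xs" for f :: "complex \<Rightarrow> real" and xs i
    using that by (simp add: nth_default_def)
  have px: "cell s3 ''px'' ''py'' i = ?V ! i" if "i < n" for i
    using that unfolding cell_def f3 f2 f1 i0 n by (simp only: nd complex_surj)
  have in3: "G.inputs s3"
    unfolding G.inputs_def pd.edges_in_def
  proof (intro conjI allI impI)
    show "cell s3 ''px'' ''py'' (nmem s3 ''nx'' i) = ?V ! succ_index ?cs i" if "i < n" for i
      using px[of "succ_index ?cs i"] si[of i ?cs] that nx n by simp
    show "cell s3 ''sx'' ''sy'' q = ps ! q" if "q < m" for q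
      using that unfolding cell_def f3 f2 f1 i0 m_def by (simp only: nd complex_surj)
  qed (use px N3 f1 f2 f3 i0 in auto)
  define s4 where "s4 = run reach_prog s3"
  define s5 where "s5 = run greedy_prog s4"
  have in4: "G.inputs s4" unfolding s4_def
    using in3 by (subst G.inputs_run) (auto simp: G.input_nvars_def G.input_rvars_def)
  have init4: "nmem s4 ''k'' 0 = 0" "\<And>q. nmem s4 ''done'' q = 0"
    using i0 f1 f2 f3 by (simp_all add: s4_def run_frame)
  have F: "pd.reach \<alpha> N (ps ! q) (rmem s4 ''F'' q)" if "q < m" for q
    using G.run_reach[OF in3] that by (simp add: s4_def)
  note R = G.run_greedy[OF in4 F init4, folded s5_def]
  have main: "run main s3 = s5" by (simp add: main_def s4_def s5_def)
  \<comment> \<open>Since \<open>N \<le> 100 * m\<close> and \<open>n \<ge> 1\<close>, one number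
    dominates all loop bounds.\<close>
  have NM: "10 * N + 1 \<le> 1001 * (n + m)" "2 * N + 1 \<le> 1001 * (n + m)" using C(1) n1 unfolding distrib_left by linarith+
  obtain t where t: "t \<le> cost (1001 * (n + m)) (setup1 ;;; setup2 ;;; setup3 ;;; main)" "exec guard_prog s0 t s5"
    using guard_prog_time[of s0 "1001 * (n + m)", folded s1_def, folded s2_def, folded s3_def] main h N3 NM f1 f2 f3 i0
    by auto
  have guards: "robustly_guards P (\<alpha> / 2) (output_points s5) (set ps)"
    unfolding robustly_guards_def
  proof (intro conjI ballI S)
    show "output_points s5 \<subseteq> P" using R(1) by (simp add: G.correct_def)
    fix p assume "p \<in> set ps"
    then obtain q where "q < m" "p = ps ! q" by (auto simp: in_set_conv_nth m_def)
    then show "\<exists>g\<in>output_points s5. robustly_guards_point P (\<alpha> / 2) g p"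
      using R(1,2) by (auto simp: G.correct_def)
  qed
  have km: "nmem s5 ''k'' 0 \<le> m" using R(1,2) by (simp add: G.correct_def)
  have card_k: "card (output_points s5) \<le> nmem s5 ''k'' 0"
    unfolding output_points_cell using card_image_le[of "{..<nmem s5 ''k'' 0}" "cell s5 ''gx'' ''gy''"] by simp
  have Gq: "\<exists>g\<in>OPT. robustly_guards_point P \<alpha> g (ps ! q)" if "q < m" for q
    using OPT(2) that by (simp add: robustly_guards_def m_def)
  have "real (card (output_points s5)) \<le> 1100000 / \<alpha>\<^sup>2 * real (card OPT)"
  proof (cases "m = 0")
    case True
    then show ?thesis using km card_k by simp
  next
    case False
    then have OPT1: "1 \<le> card OPT" using Gq[of 0] OPT(1) by (auto simp: Suc_le_eq card_gt_0_iff)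
    show ?thesis
    proof (cases "100 \<le> real N * \<alpha>")
      case True
      then have N1: "1 \<le> N" by (cases N) auto
      obtain Sel where Sel: "G.separated Sel s5" using R(3) True by blast
      have "card Sel \<le> card OPT" by (rule G.separated_card[OF Sel OPT(1) Gq])
      then have "card (output_points s5) \<le> card OPT * ((10 * N + 1) * (10 * N + 1))"
        using Sel card_k mult_right_mono[of "card Sel" "card OPT" "(10 * N + 1) * (10 * N + 1)"]
        unfolding G.separated_def by linarith
      then have "real (card (output_points s5)) \<le> real (card OPT) * real ((10 * N + 1) * (10 * N + 1))"
        unfolding of_nat_mult[symmetric] of_nat_le_iff .
      also have "\<dots> \<le> real (card OPT) * (1100000 / \<alpha>\<^sup>2)"
        using guard_count_bound[OF \<alpha> N1] C(3) N1 by (intro mult_left_mono) (simp_all del: of_nat_mult of_nat_add)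
      finally show ?thesis by (simp add: mult.commute)
    next
      case False
      \<comment> \<open>A smaller \<open>N\<close> would satisfy the resolution condition by
        \<open>C(2)\<close>, so the search stopped at its limit.\<close>
      then have "N = 100 * m" using C(1,2) by linarith
      then have "real m * \<alpha> < 1" using False by simp
      then have "(real m * \<alpha>)\<^sup>2 \<le> 1" using \<alpha> by (simp add: power_le_one)
      then have "(real m)\<^sup>2 \<le> 1 / \<alpha>\<^sup>2" using \<alpha> by (simp add: power_mult_distrib pos_le_divide_eq)
      moreover have "real m \<le> (real m)\<^sup>2" using \<open>m \<noteq> 0\<close> by (simp add: power2_eq_square)
      moreover have "1 / \<alpha>\<^sup>2 \<le> 1100000 / \<alpha>\<^sup>2 * real (card OPT)"
      proof -
        have "1 / \<alpha>\<^sup>2 * 1 \<le> 1100000 / \<alpha>\<^sup>2 * real (card OPT)"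
          using OPT1 by (intro mult_mono divide_right_mono) auto
        then show ?thesis by simp
      qed
      ultimately show ?thesis using card_k km by linarith
    qed
  qed
  then show ?thesis using t guards unfolding s0_def by blast
qed

theorem theorem14:
  "\<exists>(prog :: com) (C :: real) (a :: nat) (d :: nat).
     \<forall>(outer :: complex list) (holes :: complex list list) (P :: complex set) (n :: nat)
      (\<phi> :: real) (\<alpha> :: real) (S :: complex set) (ps :: complex list) (m :: nat)
      (OPT :: complex set).
       polygonal_domain outer holes \<longrightarrow>
       P = domain_set outer holes \<longrightarrow>
       n = num_vertices outer holes \<longrightarrow>
       \<phi> = min_internal_angle outer holes \<longrightarrow>
       0 < \<alpha> \<longrightarrow> \<alpha> \<le> sin (\<phi> / 2) \<longrightarrow>
       S \<subseteq> P \<longrightarrow> finite S \<longrightarrow> card S = m \<longrightarrow>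
       distinct ps \<longrightarrow> set ps = S \<longrightarrow>
       min_guard_set P \<alpha> S OPT \<longrightarrow>
       (\<exists>t s. exec prog (input_state outer holes ps \<alpha>) t s \<and>
          t \<le> a * (n + m) ^ d \<and>
          robustly_guards P (\<alpha> / 2) (output_points s) S \<and>
          real (card (output_points s)) \<le> C / \<alpha>\<^sup>2 * real (card OPT))"
proof -
  obtain a d where ad: "\<forall>M\<ge>1. cost M (setup1 ;;; setup2 ;;; setup3 ;;; main) \<le> a * M ^ d"
    using cost_polynomial by blast
  show ?thesis
  \<comment> \<open>The factor 1001 in the loop bound is raised to the power \<open>d\<close> and
    moved into the coefficient.\<close>
  proof (rule exI[of _ guard_prog], rule exI[of _ 1100000], rule exI[of _ "a * 1001 ^ d"], rule exI[of _ d],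
      intro allI impI)
    fix outer holes P n \<phi> \<alpha> S ps m OPT
    assume pd: "polygonal_domain outer holes" and P: "P = domain_set outer holes" and n: "n = num_vertices outer holes"
      and \<alpha>: "0 < \<alpha>" "\<alpha> \<le> sin (\<phi> / 2)" and S: "S \<subseteq> P" "card S = m" and ps: "distinct ps" "set ps = S"
      and OPT: "min_guard_set P \<alpha> S OPT"
    have \<alpha>1: "\<alpha> \<le> 1" using \<alpha>(2) sin_le_one[of "\<phi> / 2"] by linarith
    have m: "m = length ps" using S(2) ps distinct_card by fastforce
    obtain t s where ts: "exec guard_prog (input_state outer holes ps \<alpha>) t s"
      "t \<le> cost (1001 * (n + m)) (setup1 ;;; setup2 ;;; setup3 ;;; main)"
      "robustly_guards P (\<alpha> / 2) (output_points s) S"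
      "real (card (output_points s)) \<le> 1100000 / \<alpha>\<^sup>2 * real (card OPT)"
      using guard_prog_correct[OF pd \<alpha>(1) \<alpha>1, of ps OPT] S(1) ps(2) OPT
      unfolding P[symmetric] n[symmetric] m[symmetric] min_guard_set_def by auto
    have "simple_polygon outer" using pd by (simp add: polygonal_domain_def)
    then have "1 \<le> n" by (simp add: n num_vertices_def simple_polygon_def)
    then have "cost (1001 * (n + m)) (setup1 ;;; setup2 ;;; setup3 ;;; main) \<le> a * (1001 * (n + m)) ^ d" using ad by simp
    also have "\<dots> = a * 1001 ^ d * (n + m) ^ d" by (simp only: power_mult_distrib mult.assoc)
    finally have "t \<le> a * 1001 ^ d * (n + m) ^ d" using ts(2) by simp
    then show "\<exists>t s. exec guard_prog (input_state outer holes ps \<alpha>) t s \<and> t \<le> a * 1001 ^ d * (n + m) ^ d \<and>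
      robustly_guards P (\<alpha> / 2) (output_points s) S \<and>
      real (card (output_points s)) \<le> 1100000 / \<alpha>\<^sup>2 * real (card OPT)"
      using ts by blast
  qed
qed

end
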